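(* Let $p\ge 1$, $\beta^\star\in\mathbb{R}^p$ and $\tau>0$ be fixed, and let the data follow the Gaussian linear model with parameters $(\beta^\star,\tau)$ described in the context. Let $(\lambda_n)$ be a deterministic sequence of positive numbers with $\lambda_n=o(n)$, let $\hat\beta^{\mathrm{lasso}}_{\lambda_n}$ be the Lasso estimator with penalty parameter $\lambda_n$ computed from the training set $\mathbf Z$ of size $n$, and define $\tilde h_n^{\mathrm{sing}}(Z_0,\mathbf Z)=(Y_0-X_0^\top\hat\beta^{\mathrm{lasso}}_{\lambda_n})^2$. Then, as $n\to\infty$, $$\sigma^2(\tilde h_n^{\mathrm{sing}})=\Omega(1)\qquad\text{and}\qquad\gamma(\tilde h_n^{\mathrm{sing}})=o\Big(\frac1n\Big),$$ and consequently $r(\tilde h_n^{\mathrm{sing}})=o(1)$.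
   Context: Linear model: $Z_i=(X_i,Y_i)$, $i\ge 0$, are i.i.d. with $Y_i=X_i^\top\beta^\star+\varepsilon_i$, $X_i\sim\mathcal N(0,\mathbf I)$ in $\mathbb{R}^p$, $\varepsilon_i\sim\mathcal N(0,\tau^2)$, $\varepsilon_i$ independent of $X_i$. The training set is $\mathbf Z=(Z_1,\dots,Z_n)$ with $n\ge p$, $\mathbf X=(X_1,\dots,X_n)^\top\in\mathbb{R}^{n\times p}$, $\mathbf Y=(Y_1,\dots,Y_n)$; $Z_0$ is an independent test point. $\mathbf X^\top\mathbf X$ is almost surely invertible. Lasso: the Lasso estimator with penalty parameter $\lambda$ is $\hat\beta^{\mathrm{lasso}}_{\lambda}\in\arg\min_{\beta\in\mathbb R^p}\frac1{2n}\|\mathbf Y-\mathbf X\beta\|_2^2+\frac{\lambda}{n}\|\beta\|_1$ (almost surely unique since $\mathbf X^\top\mathbf X$ is almost surely invertible). Stability: let $Z_1'$ be an i.i.d. copy of $Z_1$, independent of everything else, and $\mathbf Z'=(Z_1',Z_2,\dots,Z_n)$. For a function $h_n(Z_0,\mathbf Z)$ that is invariant to the order of the $n$ elements of its second argument, - loss stability: $\gamma(h_n)=\mathbb E\big[\big(h_n(Z_0,\mathbf Z)-\mathbb E[h_n(Z_0,\mathbf Z)\mid\mathbf Z]-(h_n(Z_0,\mathbf Z')-\mathbb E[h_n(Z_0,\mathbf Z')\mid\mathbf Z'])\big)^2\big]$; - $\sigma^2(h_n)=\mathrm{Var}(\mathbb E[h_n(Z_0,\mathbf Z)\mid Z_0])$;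 - relative loss stability: $r(h_n)=n\,\gamma(h_n)/\sigma^2(h_n)$. Asymptotic notation ($n\to\infty$): $f_n=O(g_n)$ if $f_n/g_n$ is asymptotically bounded, $f_n=o(g_n)$ if $f_n/g_n\to0$, $f_n=\Omega(g_n)$ if $g_n=O(f_n)$. *)

theory Defs
  imports "HOL-Probability.Probability" "HOL-Library.Landau_Symbols"
begin

section \<open>Gaussian linear model\<close>

definition std_normal_vec_density :: "real ^ 'p \<Rightarrow> real" where
  "std_normal_vec_density x = exp (- (norm x)\<^sup>2 / 2) / sqrt (2 * pi) ^ CARD('p)"

text \<open>
  An observation is a pair $(x, y)$. The point \<open>Z 0\<close> is the test point, the training set of size
  \<open>n\<close> is \<open>Z 1, \<dots>, Z n\<close>, and \<open>Z1'\<close> is the independent copy of \<open>Z 1\<close>. In the assumption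
  \<open>indep_Z\<close> the index \<open>None\<close> stands for \<open>Z1'\<close>, so that all of \<open>Z1', Z 0, Z 1, \<dots>\<close> are jointly
  independent. In \<open>indep_X_eps\<close> independence is stated for the generated sigma-algebras because
  \<open>indep_var\<close> requires both variables to have the same range type. That the \<open>Z i\<close> are identically distributed follows from the first four assumptions.
\<close>

locale gaussian_linear_model = prob_space M for M :: "'a measure" +
  fixes Z :: "nat \<Rightarrow> 'a \<Rightarrow> (real ^ 'p) \<times> real"
    and \<epsilon> :: "nat \<Rightarrow> 'a \<Rightarrow> real"
    and Z1' :: "'a \<Rightarrow> (real ^ 'p) \<times> real"
    and \<beta> :: "real ^ 'p"
    and \<tau> :: real
  assumes linear: "\<And>i \<omega>. \<omega> \<in> space M \<Longrightarrow> snd (Z i \<omega>) = fst (Z i \<omega>) \<bullet> \<beta> + \<epsilon> i \<omega>"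
    and distr_X: "\<And>i. distributed M lborel (\<lambda>\<omega>. fst (Z i \<omega>)) std_normal_vec_density"
    and distr_eps: "\<And>i. distributed M lborel (\<epsilon> i) (normal_density 0 \<tau>)"
    and indep_X_eps: "\<And>i. indep_set (sets (vimage_algebra (space M) (\<lambda>\<omega>. fst (Z i \<omega>)) borel))
                                     (sets (vimage_algebra (space M) (\<epsilon> i) borel))"
    and indep_Z: "indep_vars (\<lambda>_. borel) (case_option Z1' Z) UNIV"
    and distr_copy: "distr M borel Z1' = distr M borel (Z 1)"

section \<open>Lasso\<close>

definition l1_norm :: "real ^ 'p \<Rightarrow> real" where
  "l1_norm b = (\<Sum>j\<in>UNIV. \<bar>b $ j\<bar>)"

text \<open>Data sets of size \<open>n\<close> are extensional functions on \<open>{1..n}\<close>.\<close>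

definition lasso_objective ::
    "nat \<Rightarrow> real \<Rightarrow> (nat \<Rightarrow> (real ^ 'p) \<times> real) \<Rightarrow> real ^ 'p \<Rightarrow> real" where
  "lasso_objective n l z b =
     1 / (2 * real n) * (\<Sum>i\<in>{1..n}. (snd (z i) - fst (z i) \<bullet> b)\<^sup>2) + l / real n * l1_norm b"

text \<open>
  The minimiser is unique only for data in a set of probability one, so an estimator is any
  selection of a minimiser. Borel measurability, which makes the estimator a random vector, has to
  be required of this selection: on the exceptional set of data, where there may be several
  minimisers, an arbitrary choice need not be measurable.
\<close>

definition lasso_estimator ::
    "nat \<Rightarrow> real \<Rightarrow> ((nat \<Rightarrow> (real ^ 'p) \<times> real) \<Rightarrow> real ^ 'p) \<Rightarrow> bool" where
  "lasso_estimator n l bhat \<longleftrightarrow>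
     bhat \<in> borel_measurable (\<Pi>\<^sub>M i\<in>{1..n}. borel) \<and>
     (\<forall>z \<in> {1..n} \<rightarrow>\<^sub>E UNIV. is_arg_min (lasso_objective n l z) (\<lambda>_. True) (bhat z))"

definition squared_loss ::
    "((nat \<Rightarrow> (real ^ 'p) \<times> real) \<Rightarrow> real ^ 'p) \<Rightarrow> (real ^ 'p) \<times> real \<Rightarrow>
     (nat \<Rightarrow> (real ^ 'p) \<times> real) \<Rightarrow> real" where
  "squared_loss bhat z0 z = (snd z0 - fst z0 \<bullet> bhat z)\<^sup>2"

section \<open>Loss stability\<close>

definition cond_expectation :: "'a measure \<Rightarrow> 'b measure \<Rightarrow> ('a \<Rightarrow> 'b) \<Rightarrow> ('a \<Rightarrow> real) \<Rightarrow> 'a \<Rightarrow> real" where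
  "cond_expectation M N W f = real_cond_exp M (vimage_algebra (space M) W N) f"

definition training_set :: "(nat \<Rightarrow> 'a \<Rightarrow> 'z) \<Rightarrow> nat \<Rightarrow> 'a \<Rightarrow> nat \<Rightarrow> 'z" where
  "training_set Z n \<omega> = (\<lambda>i\<in>{1..n}. Z i \<omega>)"

definition loss_stability ::
    "'a measure \<Rightarrow> (nat \<Rightarrow> 'a \<Rightarrow> 'z::topological_space) \<Rightarrow> ('a \<Rightarrow> 'z) \<Rightarrow> nat \<Rightarrow>
     ('z \<Rightarrow> (nat \<Rightarrow> 'z) \<Rightarrow> real) \<Rightarrow> real" where
  "loss_stability M Z Z1' n h =
     (let D = (\<Pi>\<^sub>M i\<in>{1..n}. borel);
          S = training_set Z n;
          S' = training_set (Z(1 := Z1')) n;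
          H = (\<lambda>\<omega>. h (Z 0 \<omega>) (S \<omega>));
          H' = (\<lambda>\<omega>. h (Z 0 \<omega>) (S' \<omega>))
      in \<integral>\<omega>. (H \<omega> - cond_expectation M D S H \<omega> - (H' \<omega> - cond_expectation M D S' H' \<omega>))\<^sup>2 \<partial>M)"

definition sigma_squared ::
    "'a measure \<Rightarrow> (nat \<Rightarrow> 'a \<Rightarrow> 'z::topological_space) \<Rightarrow> nat \<Rightarrow>
     ('z \<Rightarrow> (nat \<Rightarrow> 'z) \<Rightarrow> real) \<Rightarrow> real" where
  "sigma_squared M Z n h =
     prob_space.variance M
       (cond_expectation M borel (Z 0) (\<lambda>\<omega>. h (Z 0 \<omega>) (training_set Z n \<omega>)))"

definition relative_loss_stability ::
    "'a measure \<Rightarrow> (nat \<Rightarrow> 'a \<Rightarrow> 'z::topological_space) \<Rightarrow> ('a \<Rightarrow> 'z) \<Rightarrow> nat \<Rightarrow>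
     ('z \<Rightarrow> (nat \<Rightarrow> 'z) \<Rightarrow> real) \<Rightarrow> real" where
  "relative_loss_stability M Z Z1' n h = real n * loss_stability M Z Z1' n h / sigma_squared M Z n h"

end

theory Submission
  imports Defs
begin

text \<open>
  Exchanging one observation moves the Lasso estimator by at most \<open>O(1/n)\<close>: subtracting the quadratic growth
  inequalities of the two objectives at their minimisers cancels the penalty and leaves
  \<open>\<Sum>i\<ge>2. (x i \<bullet> \<Delta>)\<^sup>2 \<le> r' (x' \<bullet> \<Delta>) - r (x \<bullet> \<Delta>)\<close> for the difference \<open>\<Delta>\<close> of the estimators and the residuals
  \<open>r, r'\<close> at the exchanged observation. It remains to bound all moments of the inverse of the least
  eigenvalue of the Gram matrix divided by \<open>n\<close>, uniformly in \<open>n\<close>. For a block of observations of fixed size \<open>m\<close>,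
  a least eigenvalue \<open>t\<close> with eigenvector \<open>u\<close> makes all \<open>x i \<bullet> v\<close> of order \<open>\<surd>t\<close> for \<open>v\<close> in a ball of radius of
  order \<open>\<surd>t\<close> around \<open>u\<close>, so that an integral over \<open>v\<close> of a product of negative powers of the \<open>\<bar>x i \<bullet> v\<bar>\<close> is large; its
  expectation is finite because each \<open>x i \<bullet> v\<close> is Gaussian, and a large \<open>m\<close> gives any power of \<open>1/t\<close>.
  The least eigenvalues of disjoint blocks add up, and the harmonic mean is below the arithmetic mean.
  This gives \<open>\<gamma> = O(1/n\<^sup>2)\<close>. The lower bound \<open>\<sigma>\<^sup>2 \<ge> 2 \<tau>\<^sup>4\<close> comes from the part \<open>\<epsilon>\<^sup>2\<close> of the test loss.
\<close>

section \<open>Perturbation of the Lasso\<close>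

text \<open>Stability is an expectation, so a bound with high probability would not suffice: where
  the Gram matrix is nearly singular, the estimators are controlled only through the inverse least
  eigenvalue, and high powers of it must be integrable. The Gram matrix is taken over the
  observations \<open>2..n\<close> shared by both data sets, so one variable \<open>\<Theta>\<close>
  serves both estimators.

  Blocks have fixed size because the expectation of a product of \<open>n\<close> factors is bounded
  only by a constant to the power \<open>n\<close>. The size \<open>4 * (p + K)\<close> comes from
  counting exponents: if all inner products have order \<open>r\<close>, the factors contribute
  \<open>r\<close> to the power \<open>-(p + K)\<close>, the ball costs the power \<open>p\<close>,
  and the power \<open>-K\<close> remains. The exponent 1/4 of a single factor is half of 1/2: the
  radius of the ball depends on the norms of the vectors, which brings powers of these norms into
  the factors, and separating them by \<open>a * b \<le> a^2 + b^2\<close> doubles the exponent; the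
  singularity of exponent 1/2 is still integrable.\<close>

lemma l1_norm_nonneg: "0 \<le> l1_norm b"
  by (simp add: l1_norm_def sum_nonneg)

lemma l1_norm_segment:
  assumes "0 \<le> t" "t \<le> 1"
  shows "l1_norm (b + t *\<^sub>R (c - b)) \<le> (1 - t) * l1_norm b + t * l1_norm c"
proof -
  have "\<bar>(b + t *\<^sub>R (c - b)) $ j\<bar> \<le> (1 - t) * \<bar>b $ j\<bar> + t * \<bar>c $ j\<bar>" for j
  proof -
    have "(b + t *\<^sub>R (c - b)) $ j = (1 - t) * (b $ j) + t * (c $ j)"
      by (simp add: algebra_simps)
    also have "\<bar>\<dots>\<bar> \<le> \<bar>(1 - t) * (b $ j)\<bar> + \<bar>t * (c $ j)\<bar>" by (rule abs_triangle_ineq)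
    also have "\<dots> = (1 - t) * \<bar>b $ j\<bar> + t * \<bar>c $ j\<bar>" using assms by (simp add: abs_mult)
    finally show ?thesis .
  qed
  then show ?thesis
    unfolding l1_norm_def sum_distrib_left sum.distrib[symmetric] by (intro sum_mono)
qed

text \<open>Along the segment the squares satisfy an exact identity with defect
  \<open>t * (1 - t)\<close> times the squared increment, and the penalty is convex. The objective
  is thus strongly convex in the seminorm of the Gram matrix, although the penalty is not
  differentiable.\<close>

lemma lasso_objective_segment:
  assumes "0 \<le> t" "t \<le> 1" "0 \<le> l"
  shows "lasso_objective n l z (b + t *\<^sub>R (c - b)) \<le>
    (1 - t) * lasso_objective n l z b + t * lasso_objective n l z c
      - t * (1 - t) * (1 / (2 * real n) * (\<Sum>i\<in>{1..n}. (fst (z i) \<bullet> (c - b))\<^sup>2))"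
proof -
  have "(snd (z i) - fst (z i) \<bullet> (b + t *\<^sub>R (c - b)))\<^sup>2 =
      (1 - t) * (snd (z i) - fst (z i) \<bullet> b)\<^sup>2 + t * (snd (z i) - fst (z i) \<bullet> c)\<^sup>2
      - t * (1 - t) * (fst (z i) \<bullet> (c - b))\<^sup>2" for i
    by (simp add: inner_add_right inner_diff_right power2_eq_square algebra_simps)
  then have quad: "(\<Sum>i\<in>{1..n}. (snd (z i) - fst (z i) \<bullet> (b + t *\<^sub>R (c - b)))\<^sup>2) =
      (1 - t) * (\<Sum>i\<in>{1..n}. (snd (z i) - fst (z i) \<bullet> b)\<^sup>2)
      + t * (\<Sum>i\<in>{1..n}. (snd (z i) - fst (z i) \<bullet> c)\<^sup>2)
      - t * (1 - t) * (\<Sum>i\<in>{1..n}. (fst (z i) \<bullet> (c - b))\<^sup>2)"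
    by (simp only: sum.distrib sum_subtractf sum_distrib_left)
  have "l / real n * l1_norm (b + t *\<^sub>R (c - b)) \<le>
      l / real n * ((1 - t) * l1_norm b + t * l1_norm c)"
    using assms by (intro mult_left_mono l1_norm_segment) auto
  moreover have "k * ((1 - t) * Sb + t * Sc - t * (1 - t) * D) + q * L \<le>
      (1 - t) * (k * Sb + q * Lb) + t * (k * Sc + q * Lc) - t * (1 - t) * (k * D)"
    if "q * L \<le> q * ((1 - t) * Lb + t * Lc)" for k q L Lb Lc Sb Sc D :: real
    using that by (simp add: algebra_simps)
  ultimately show ?thesis
    unfolding lasso_objective_def quad by blast
qed

text \<open>Minimality is used against a point of the segment close to \<open>b\<close>: dividing by
  \<open>t\<close> and letting \<open>t\<close> tend to 0 leaves the full quadratic defect, without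
  any subgradient of the penalty.\<close>

lemma lasso_quadratic_growth:
  assumes "is_arg_min (lasso_objective n l z) (\<lambda>_. True) b" "0 \<le> l"
  shows "1 / (2 * real n) * (\<Sum>i\<in>{1..n}. (fst (z i) \<bullet> (c - b))\<^sup>2)
    \<le> lasso_objective n l z c - lasso_objective n l z b" (is "?A \<le> ?d")
proof (rule field_le_mult_one_interval)
  \<comment> \<open>\<open>s\<close> is \<open>1 - t\<close>; a bound for \<open>s * ?A\<close> with
    every \<open>s\<close> between 0 and 1 replaces the limit
    \<open>t \<rightarrow> 0\<close>.\<close>
  fix s :: real assume s: "0 < s" "s < 1"
  define t where "t = 1 - s"
  have t: "0 < t" "t < 1" using s by (auto simp: t_def)
  have "lasso_objective n l z b \<le> lasso_objective n l z (b + t *\<^sub>R (c - b))"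
    using assms by (simp add: is_arg_min_linorder)
  also have "\<dots> \<le> (1 - t) * lasso_objective n l z b + t * lasso_objective n l z c - t * (1 - t) * ?A"
    using t assms by (intro lasso_objective_segment) auto
  finally have "t * ((1 - t) * ?A) \<le> t * ?d" by (simp only: algebra_simps)
  then have "(1 - t) * ?A \<le> ?d" using t by (simp only: mult_le_cancel_left_pos)
  then show "s * ?A \<le> ?d" by (simp add: t_def)
qed

text \<open>The competitor 0 has no penalty and the penalty of \<open>b\<close> may be dropped, so
  the residual sum of squares is at most that of the zero vector, whatever the value of
  \<open>l\<close>.\<close>

lemma lasso_fitted_bound:
  assumes "is_arg_min (lasso_objective n l z) (\<lambda>_. True) b" "0 \<le> l" "n \<ge> 1"
  shows "(\<Sum>i\<in>{1..n}. (fst (z i) \<bullet> b)\<^sup>2) \<le> 4 * (\<Sum>i\<in>{1..n}. (snd (z i))\<^sup>2)"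
proof -
  have "lasso_objective n l z b \<le> lasso_objective n l z 0"
    using assms by (simp add: is_arg_min_linorder)
  moreover have "0 \<le> l / real n * l1_norm b"
    using assms by (simp add: l1_norm_nonneg)
  moreover have "l1_norm (0 :: real ^ 'a) = 0" by (simp add: l1_norm_def)
  ultimately have "1 / (2 * real n) * (\<Sum>i\<in>{1..n}. (snd (z i) - fst (z i) \<bullet> b)\<^sup>2)
      \<le> 1 / (2 * real n) * (\<Sum>i\<in>{1..n}. (snd (z i))\<^sup>2)"
    unfolding lasso_objective_def by simp
  then have res: "(\<Sum>i\<in>{1..n}. (snd (z i) - fst (z i) \<bullet> b)\<^sup>2) \<le> (\<Sum>i\<in>{1..n}. (snd (z i))\<^sup>2)"
    using assms(3) by (simp add: divide_right_mono field_simps)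
  have "(fst (z i) \<bullet> b)\<^sup>2 \<le> 2 * (snd (z i) - fst (z i) \<bullet> b)\<^sup>2 + 2 * (snd (z i))\<^sup>2" for i
  proof -
    have "0 \<le> (fst (z i) \<bullet> b - 2 * snd (z i))\<^sup>2" by simp
    then show ?thesis by (simp add: power2_eq_square algebra_simps)
  qed
  then have "(\<Sum>i\<in>{1..n}. (fst (z i) \<bullet> b)\<^sup>2) \<le>
      (\<Sum>i\<in>{1..n}. 2 * (snd (z i) - fst (z i) \<bullet> b)\<^sup>2 + 2 * (snd (z i))\<^sup>2)"
    by (intro sum_mono)
  also have "\<dots> = 2 * (\<Sum>i\<in>{1..n}. (snd (z i) - fst (z i) \<bullet> b)\<^sup>2) + 2 * (\<Sum>i\<in>{1..n}. (snd (z i))\<^sup>2)"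
    by (simp only: sum.distrib sum_distrib_left)
  finally show ?thesis using res by linarith
qed

text \<open>Each objective is tested at the minimiser of the other. In the sum of the two growth
  inequalities the penalties and all shared residuals cancel. The squares of the two exchanged inner
  products occur on both sides and cancel as well, which leaves twice the claim.\<close>

lemma lasso_replace_one:
  assumes min: "is_arg_min (lasso_objective n l z) (\<lambda>_. True) b"
    and min': "is_arg_min (lasso_objective n l z') (\<lambda>_. True) b'"
    and agree: "\<And>i. i \<in> {2..n} \<Longrightarrow> z' i = z i"
    and "0 \<le> l" "n \<ge> 1"
  shows "(\<Sum>i\<in>{2..n}. (fst (z i) \<bullet> (b' - b))\<^sup>2) \<le>
    (snd (z' 1) - fst (z' 1) \<bullet> b') * (fst (z' 1) \<bullet> (b' - b))
    - (snd (z 1) - fst (z 1) \<bullet> b) * (fst (z 1) \<bullet> (b' - b))"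
proof -
  have split: "(\<Sum>i\<in>{1..n}. F i) = F 1 + (\<Sum>i\<in>{2..n}. F i)" for F :: "nat \<Rightarrow> real"
    using assms(5) by (simp add: sum.atLeast_Suc_atMost numeral_2_eq_2)
  have obj: "2 * real n * lasso_objective n l w a =
      (\<Sum>i\<in>{1..n}. (snd (w i) - fst (w i) \<bullet> a)\<^sup>2) + 2 * l * l1_norm a" for w a
    using assms(5) unfolding lasso_objective_def by (simp add: field_simps)
  have scaled: "(\<Sum>i\<in>{1..n}. (fst (w i) \<bullet> (c - a))\<^sup>2)
      \<le> 2 * real n * lasso_objective n l w c - 2 * real n * lasso_objective n l w a"
    if "is_arg_min (lasso_objective n l w) (\<lambda>_. True) a" for w a c
  proof -
    have "2 * real n * (1 / (2 * real n) * (\<Sum>i\<in>{1..n}. (fst (w i) \<bullet> (c - a))\<^sup>2))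
        \<le> 2 * real n * (lasso_objective n l w c - lasso_objective n l w a)"
      by (intro mult_left_mono lasso_quadratic_growth that assms) auto
    then show ?thesis using assms(5) by (simp add: algebra_simps)
  qed
  have tail: "(\<Sum>i\<in>{2..n}. G (z' i)) = (\<Sum>i\<in>{2..n}. G (z i))" for G :: "(real ^ 'a) \<times> real \<Rightarrow> real"
    using agree by simp
  have "(\<Sum>i\<in>{2..n}. (fst (z i) \<bullet> (b - b'))\<^sup>2) = (\<Sum>i\<in>{2..n}. (fst (z i) \<bullet> (b' - b))\<^sup>2)"
    by (simp add: inner_diff_right power2_commute)
  then show ?thesis
    using scaled[OF min, of b'] scaled[OF min', of b]
    unfolding obj split tail[of "\<lambda>w. (snd w - fst w \<bullet> _)\<^sup>2"] tail[of "\<lambda>w. (fst w \<bullet> _)\<^sup>2"]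
    by (simp add: inner_diff_right power2_eq_square algebra_simps)
qed

text \<open>The summand 1 keeps the weight at least 1, so that its powers increase with the exponent
  and factors can be added freely when bounds are enlarged.\<close>

definition data_weight :: "'b::real_normed_vector \<times> real \<Rightarrow> real" where
  "data_weight z = 1 + norm (fst z) + \<bar>snd z\<bar>"

lemma data_weight_ge: "1 \<le> data_weight z" "norm (fst z) \<le> data_weight z" "\<bar>snd z\<bar> \<le> data_weight z"
  by (auto simp: data_weight_def)

lemma measurable_data_weight[measurable]:
  "(data_weight :: 'b::{real_normed_vector, second_countable_topology} \<times> real \<Rightarrow> real) \<in> borel_measurable borel"
  unfolding data_weight_def borel_prod[symmetric] by measurable

lemma lasso_norm_bound:
  assumes min: "is_arg_min (lasso_objective n l z) (\<lambda>_. True) b" and "0 \<le> l" "n \<ge> 1"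
    and \<Theta>: "1 \<le> \<Theta>" "real n * (norm b)\<^sup>2 \<le> \<Theta> * (\<Sum>i\<in>{2..n}. (fst (z i) \<bullet> b)\<^sup>2)"
    and T: "1 \<le> T" "(\<Sum>i\<in>{1..n}. (snd (z i))\<^sup>2) \<le> real n * T"
  shows "norm b \<le> 2 * \<Theta> * T"
proof -
  have "(\<Sum>i\<in>{2..n}. (fst (z i) \<bullet> b)\<^sup>2) \<le> (\<Sum>i\<in>{1..n}. (fst (z i) \<bullet> b)\<^sup>2)"
    by (intro sum_mono2) auto
  also have "\<dots> \<le> 4 * (real n * T)"
    using lasso_fitted_bound[OF min assms(2,3)] T(2) by linarith
  finally have "\<Theta> * (\<Sum>i\<in>{2..n}. (fst (z i) \<bullet> b)\<^sup>2) \<le> \<Theta> * (4 * (real n * T))"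
    using \<Theta>(1) by (intro mult_left_mono) auto
  then have "real n * (norm b)\<^sup>2 \<le> real n * (4 * (\<Theta> * T))"
    using \<Theta>(2) by (simp add: mult_ac)
  then have "(norm b)\<^sup>2 \<le> 4 * (\<Theta> * T)" using assms(3) by simp
  also have "\<dots> \<le> (2 * (\<Theta> * T))\<^sup>2"
  proof -
    have "1 * 1 \<le> \<Theta> * T" using \<Theta>(1) T(1) by (intro mult_mono) auto
    then have "(\<Theta> * T) * 1 \<le> (\<Theta> * T) * (\<Theta> * T)" by (intro mult_left_mono) auto
    then show ?thesis by (simp add: power2_eq_square)
  qed
  finally have "(norm b)\<^sup>2 \<le> (2 * \<Theta> * T)\<^sup>2" by (simp add: mult.assoc)
  then show ?thesis by (rule power2_le_imp_le) (use \<Theta>(1) T(1) in auto)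
qed

text \<open>The deterministic half of the argument. One factor \<open>\<Theta>\<close> comes from
  the size of the estimator inside the residual, the second from inverting the shared Gram matrix.
  Each exchanged observation contributes the constant 3, and one factor \<open>norm \<Delta>\<close>
  divides out.\<close>

lemma lasso_perturbation:
  fixes b b' :: "real ^ 'p"
  assumes min: "is_arg_min (lasso_objective n l z) (\<lambda>_. True) b"
    and min': "is_arg_min (lasso_objective n l z') (\<lambda>_. True) b'"
    and agree: "\<And>i. i \<in> {2..n} \<Longrightarrow> z' i = z i"
    and l: "0 \<le> l" and n: "n \<ge> 1"
    and \<Theta>: "1 \<le> \<Theta>" "\<And>u. real n * (norm u)\<^sup>2 \<le> \<Theta> * (\<Sum>i\<in>{2..n}. (fst (z i) \<bullet> u)\<^sup>2)"
    and T: "1 \<le> T" "(\<Sum>i\<in>{1..n}. (snd (z i))\<^sup>2) \<le> real n * T" "(\<Sum>i\<in>{1..n}. (snd (z' i))\<^sup>2) \<le> real n * T"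
    and w: "data_weight (z 1) \<le> w" "data_weight (z' 1) \<le> w"
  shows "norm b \<le> 2 * \<Theta> * T" "norm b' \<le> 2 * \<Theta> * T"
    "norm (b' - b) \<le> 6 * \<Theta>\<^sup>2 * T * w\<^sup>2 / real n"
proof -
  have agree_sum: "(\<Sum>i\<in>{2..n}. (fst (z' i) \<bullet> u)\<^sup>2) = (\<Sum>i\<in>{2..n}. (fst (z i) \<bullet> u)\<^sup>2)" for u
    using agree by simp
  show b: "norm b \<le> 2 * \<Theta> * T"
    using lasso_norm_bound[OF min l n \<Theta>(1) \<Theta>(2) T(1,2)] .
  show b': "norm b' \<le> 2 * \<Theta> * T"
    using lasso_norm_bound[OF min' l n \<Theta>(1) _ T(1,3)] \<Theta>(2) agree_sum by simp
  define \<Delta> where "\<Delta> = b' - b"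
  have "1 * 1 \<le> \<Theta> * T" using \<Theta>(1) T(1) by (intro mult_mono) auto
  then have \<Theta>T: "1 \<le> \<Theta> * T" by simp
  have "1 \<le> w" using w(1) data_weight_ge(1)[of "z 1"] by linarith
  have res: "\<bar>(snd v - fst v \<bullet> a) * (fst v \<bullet> \<Delta>)\<bar> \<le> 3 * \<Theta> * T * w\<^sup>2 * norm \<Delta>"
    if "data_weight v \<le> w" "norm a \<le> 2 * \<Theta> * T" for v a
  proof -
    have v: "norm (fst v) \<le> w" "\<bar>snd v\<bar> \<le> w"
      using that(1) data_weight_ge(2,3)[of v] by auto
    have "\<bar>fst v \<bullet> a\<bar> \<le> norm (fst v) * norm a" by (rule Cauchy_Schwarz_ineq2)
    also have "\<dots> \<le> w * (2 * \<Theta> * T)" using v that \<open>1 \<le> w\<close> by (intro mult_mono) auto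
    finally have "\<bar>snd v - fst v \<bullet> a\<bar> \<le> w * 1 + w * (2 * \<Theta> * T)" using v(2) by linarith
    also have "\<dots> \<le> w * (\<Theta> * T) + w * (2 * \<Theta> * T)"
      using \<Theta>T \<open>1 \<le> w\<close> by (intro add_right_mono mult_left_mono) auto
    finally have r: "\<bar>snd v - fst v \<bullet> a\<bar> \<le> 3 * \<Theta> * T * w" by (simp add: algebra_simps)
    have "\<bar>fst v \<bullet> \<Delta>\<bar> \<le> norm (fst v) * norm \<Delta>" by (rule Cauchy_Schwarz_ineq2)
    also have "\<dots> \<le> w * norm \<Delta>" using v by (intro mult_right_mono) auto
    finally have "\<bar>snd v - fst v \<bullet> a\<bar> * \<bar>fst v \<bullet> \<Delta>\<bar> \<le> (3 * \<Theta> * T * w) * (w * norm \<Delta>)"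
      using r \<open>1 \<le> w\<close> \<Theta> T by (intro mult_mono) auto
    then show ?thesis by (simp add: abs_mult power2_eq_square mult_ac)
  qed
  have "(\<Sum>i\<in>{2..n}. (fst (z i) \<bullet> \<Delta>)\<^sup>2) \<le>
      (snd (z' 1) - fst (z' 1) \<bullet> b') * (fst (z' 1) \<bullet> \<Delta>) - (snd (z 1) - fst (z 1) \<bullet> b) * (fst (z 1) \<bullet> \<Delta>)"
    unfolding \<Delta>_def by (rule lasso_replace_one[OF min min' agree l n])
  also have "\<dots> \<le> 6 * \<Theta> * T * w\<^sup>2 * norm \<Delta>"
    using res[OF w(1) b] res[OF w(2) b'] by linarith
  finally have "\<Theta> * (\<Sum>i\<in>{2..n}. (fst (z i) \<bullet> \<Delta>)\<^sup>2) \<le> \<Theta> * (6 * \<Theta> * T * w\<^sup>2 * norm \<Delta>)"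
    using \<Theta>(1) by (intro mult_left_mono) auto
  then have "real n * (norm \<Delta>)\<^sup>2 \<le> 6 * \<Theta>\<^sup>2 * T * w\<^sup>2 * norm \<Delta>"
    using \<Theta>(2)[of \<Delta>] by (simp add: power2_eq_square mult_ac)
  then have "norm \<Delta> * (real n * norm \<Delta>) \<le> norm \<Delta> * (6 * \<Theta>\<^sup>2 * T * w\<^sup>2)"
    by (simp add: power2_eq_square mult_ac)
  then have "real n * norm \<Delta> \<le> 6 * \<Theta>\<^sup>2 * T * w\<^sup>2"
  proof (cases "\<Delta> = 0")
    case True
    then show ?thesis using \<Theta>(1) T(1) by simp
  qed simp
  then show "norm (b' - b) \<le> 6 * \<Theta>\<^sup>2 * T * w\<^sup>2 / real n"
    using n by (simp add: \<Delta>_def field_simps)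
qed

text \<open>A difference of squares factors into the increment of the prediction and the sum of the
  two residuals, each at most linear in the weight.\<close>

lemma squared_error_diff:
  fixes b b' :: "'b::real_inner"
  assumes "norm b \<le> R" "norm b' \<le> R" "1 \<le> R"
  shows "\<bar>(snd z - fst z \<bullet> b)\<^sup>2 - (snd z - fst z \<bullet> b')\<^sup>2\<bar> \<le> 2 * R * norm (b' - b) * (data_weight z)\<^sup>2"
proof -
  let ?w = "data_weight z"
  note w = data_weight_ge[of z]
  have "(snd z - fst z \<bullet> b)\<^sup>2 - (snd z - fst z \<bullet> b')\<^sup>2 = (fst z \<bullet> (b' - b)) * (2 * snd z - fst z \<bullet> (b + b'))"
    by (simp add: inner_diff_right inner_add_right power2_eq_square algebra_simps)
  moreover have "\<bar>fst z \<bullet> (b' - b)\<bar> \<le> ?w * norm (b' - b)"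
    by (rule order_trans[OF Cauchy_Schwarz_ineq2]) (use w in \<open>intro mult_right_mono, auto\<close>)
  moreover have "\<bar>2 * snd z - fst z \<bullet> (b + b')\<bar> \<le> 2 * R * ?w"
  proof -
    have "\<bar>fst z \<bullet> (b + b')\<bar> \<le> norm (fst z) * norm (b + b')" by (rule Cauchy_Schwarz_ineq2)
    also have "\<dots> \<le> norm (fst z) * (2 * R)"
      using assms norm_triangle_ineq[of b b'] by (intro mult_left_mono) auto
    finally have "\<bar>2 * snd z - fst z \<bullet> (b + b')\<bar> \<le> 2 * \<bar>snd z\<bar> * 1 + norm (fst z) * (2 * R)" by linarith
    also have "\<dots> \<le> 2 * \<bar>snd z\<bar> * R + norm (fst z) * (2 * R)"
      using assms by (intro add_right_mono mult_left_mono) auto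
    also have "\<dots> = 2 * R * (\<bar>snd z\<bar> + norm (fst z))" by (simp add: algebra_simps)
    also have "\<dots> \<le> 2 * R * ?w" using assms by (intro mult_left_mono) (auto simp: data_weight_def)
    finally show ?thesis .
  qed
  ultimately have "\<bar>(snd z - fst z \<bullet> b)\<^sup>2 - (snd z - fst z \<bullet> b')\<^sup>2\<bar> \<le> (?w * norm (b' - b)) * (2 * R * ?w)"
    using w by (simp only: abs_mult) (intro mult_mono, auto)
  then show ?thesis by (simp add: power2_eq_square mult_ac)
qed

lemma squared_error_le:
  fixes b :: "'b::real_inner"
  assumes "norm b \<le> R" "1 \<le> R"
  shows "(snd z - fst z \<bullet> b)\<^sup>2 \<le> R\<^sup>2 * (data_weight z)\<^sup>2"
proof -
  have "\<bar>fst z \<bullet> b\<bar> \<le> norm (fst z) * R"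
    by (rule order_trans[OF Cauchy_Schwarz_ineq2]) (use assms in \<open>intro mult_left_mono, auto\<close>)
  moreover have "\<bar>snd z\<bar> * 1 \<le> \<bar>snd z\<bar> * R" using assms by (intro mult_left_mono) auto
  ultimately have "\<bar>snd z - fst z \<bullet> b\<bar> \<le> R * (norm (fst z) + \<bar>snd z\<bar>)"
    by (simp add: algebra_simps)
  also have "\<dots> \<le> R * data_weight z" using assms by (intro mult_left_mono) (auto simp: data_weight_def)
  finally have "\<bar>snd z - fst z \<bullet> b\<bar>\<^sup>2 \<le> (R * data_weight z)\<^sup>2" by (intro power_mono) auto
  then show ?thesis by (simp add: power_mult_distrib)
qed

section \<open>Gaussian vectors\<close>

lemma std_normal_vec_density_prod:
  fixes x :: "real ^ 'p"
  shows "std_normal_vec_density x = (\<Prod>b\<in>Basis. std_normal_density (x \<bullet> b))"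
proof -
  have norm_sq: "(\<Sum>b\<in>Basis. (x \<bullet> b)\<^sup>2) = (norm x)\<^sup>2"
    unfolding power2_norm_eq_inner by (subst euclidean_inner) (simp add: power2_eq_square)
  have "(\<Prod>b\<in>Basis. std_normal_density (x \<bullet> b)) =
      (\<Prod>b\<in>(Basis :: (real ^ 'p) set). 1 / sqrt (2 * pi)) * (\<Prod>b\<in>Basis. exp (- (x \<bullet> b)\<^sup>2 / 2))"
    by (simp only: std_normal_density_def prod.distrib)
  also have "(\<Prod>b\<in>Basis. exp (- (x \<bullet> b)\<^sup>2 / 2)) = exp (- (norm x)\<^sup>2 / 2)"
    by (simp add: exp_sum[symmetric] sum_negf sum_divide_distrib[symmetric] norm_sq)
  finally show ?thesis
    by (simp add: std_normal_vec_density_def power_divide)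
qed

context prob_space begin

text \<open>Product functions are all that is needed below: an indicator in one coordinate gives the
  marginal law, indicators in all coordinates give independence.\<close>

lemma nn_integral_std_normal_vec_prod:
  fixes X :: "'a \<Rightarrow> real ^ 'p"
  assumes X: "distributed M lborel X std_normal_vec_density"
    and [measurable]: "\<And>b. b \<in> Basis \<Longrightarrow> g b \<in> borel_measurable borel"
  shows "(\<integral>\<^sup>+\<omega>. (\<Prod>b\<in>Basis. g b (X \<omega> \<bullet> b)) \<partial>M) =
    (\<Prod>b\<in>Basis. \<integral>\<^sup>+t. ennreal (std_normal_density t) * g b t \<partial>lborel)"
proof -
  have "(\<integral>\<^sup>+\<omega>. (\<Prod>b\<in>Basis. g b (X \<omega> \<bullet> b)) \<partial>M) =
      (\<integral>\<^sup>+x. ennreal (std_normal_vec_density x) * (\<Prod>b\<in>Basis. g b (x \<bullet> b)) \<partial>lborel)"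
    by (rule distributed_nn_integral[OF X, symmetric]) measurable
  also have "\<dots> = (\<integral>\<^sup>+x. (\<Prod>b\<in>(Basis :: (real ^ 'p) set). ennreal (std_normal_density (x \<bullet> b)) * g b (x \<bullet> b)) \<partial>lborel)"
    by (simp add: std_normal_vec_density_prod prod.distrib prod_ennreal)
  also have "\<dots> = (\<Prod>b\<in>(Basis :: (real ^ 'p) set). \<integral>\<^sup>+t. ennreal (std_normal_density t) * g b t \<partial>lborel)"
    by (rule nn_integral_lborel_prod) auto
  finally show ?thesis .
qed

lemma std_normal_vec_coordinate:
  fixes X :: "'a \<Rightarrow> real ^ 'p"
  assumes X: "distributed M lborel X std_normal_vec_density" and b: "b \<in> Basis"
  shows "distributed M lborel (\<lambda>\<omega>. X \<omega> \<bullet> b) std_normal_density"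
  unfolding distributed_def
proof (intro conjI measure_eqI)
  have [measurable]: "X \<in> borel_measurable M"
    using distributed_measurable[OF X] by simp
  show "(\<lambda>\<omega>. X \<omega> \<bullet> b) \<in> M \<rightarrow>\<^sub>M lborel" by simp
  show "sets (distr M lborel (\<lambda>\<omega>. X \<omega> \<bullet> b)) = sets (density lborel (\<lambda>x. ennreal (std_normal_density x)))"
    by simp
  show "(\<lambda>x. ennreal (std_normal_density x)) \<in> borel_measurable lborel" by simp
  fix A assume "A \<in> sets (distr M lborel (\<lambda>\<omega>. X \<omega> \<bullet> b))"
  then have A[measurable]: "A \<in> sets borel" by simp
  \<comment> \<open>All directions other than \<open>b\<close> carry the constant 1, whose Gaussian
    integral is 1, so the product over the basis collapses to the factor of
    \<open>b\<close>.\<close>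
  define g :: "real ^ 'p \<Rightarrow> real \<Rightarrow> ennreal" where "g c t = (if c = b then indicator A t else 1)" for c t
  have [measurable]: "g c \<in> borel_measurable borel" for c
    unfolding g_def by (cases "c = b") auto
  have one: "(\<integral>\<^sup>+t. ennreal (std_normal_density t) \<partial>lborel) = 1"
    using emeasure_eq_measure prob_space.emeasure_space_1[OF prob_space_normal_density[of 1 0]]
    by (simp add: emeasure_density)
  have "emeasure (distr M lborel (\<lambda>\<omega>. X \<omega> \<bullet> b)) A =
      (\<integral>\<^sup>+\<omega>. indicator ((\<lambda>\<omega>. X \<omega> \<bullet> b) -` A \<inter> space M) \<omega> \<partial>M)"
    by (simp add: emeasure_distr)
  also have "\<dots> = (\<integral>\<^sup>+\<omega>. indicator A (X \<omega> \<bullet> b) \<partial>M)"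
    by (rule nn_integral_cong) (simp add: indicator_def)
  also have "\<dots> = (\<integral>\<^sup>+\<omega>. (\<Prod>c\<in>Basis. g c (X \<omega> \<bullet> c)) \<partial>M)"
    using b by (simp add: g_def prod.delta)
  also have "\<dots> = (\<Prod>c\<in>(Basis :: (real ^ 'p) set). \<integral>\<^sup>+t. ennreal (std_normal_density t) * g c t \<partial>lborel)"
    by (rule nn_integral_std_normal_vec_prod[OF X]) auto
  also have "\<dots> = (\<Prod>c\<in>(Basis :: (real ^ 'p) set).
      if c = b then \<integral>\<^sup>+t. ennreal (std_normal_density t) * indicator A t \<partial>lborel else 1)"
    by (intro prod.cong refl) (simp add: g_def one)
  also have "\<dots> = emeasure (density lborel (\<lambda>x. ennreal (std_normal_density x))) A"
    using b by (simp add: prod.delta emeasure_density)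
  finally show "emeasure (distr M lborel (\<lambda>\<omega>. X \<omega> \<bullet> b)) A =
      emeasure (density lborel (\<lambda>x. ennreal (std_normal_density x))) A" .
qed

lemma std_normal_vec_coordinates_indep:
  fixes X :: "'a \<Rightarrow> real ^ 'p"
  assumes X: "distributed M lborel X std_normal_vec_density"
  shows "indep_vars (\<lambda>_. borel) (\<lambda>b \<omega>. X \<omega> \<bullet> b) Basis"
proof -
  have rv[measurable]: "X \<in> borel_measurable M"
    using distributed_measurable[OF X] by simp
  have distr_coord: "(\<integral>\<^sup>+t. ennreal (std_normal_density t) * indicator A t \<partial>lborel) =
      emeasure M ((\<lambda>\<omega>. X \<omega> \<bullet> b) -` A \<inter> space M)"
    if "b \<in> Basis" "A \<in> sets borel" for b A
    using distributed_emeasure[OF std_normal_vec_coordinate[OF X that(1)], of A] that by simp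
  show ?thesis
  proof (subst indep_vars_finite[where E = "\<lambda>_. sets borel"])
    show "sets borel = sigma_sets (space borel) (sets (borel :: real measure))" for i :: "real ^ 'p"
      by (rule sets.sigma_sets_eq[symmetric])
    show "Int_stable (sets (borel :: real measure))" for i :: "real ^ 'p" by (rule sets.Int_stable)
    show "sets borel \<subseteq> Pow (space (borel :: real measure))" for i :: "real ^ 'p" by (rule sets.space_closed)
    show "\<forall>A\<in>Basis \<rightarrow> sets borel. prob (\<Inter>j\<in>Basis. (\<lambda>\<omega>. X \<omega> \<bullet> j) -` A j \<inter> space M) =
        (\<Prod>j\<in>Basis. prob ((\<lambda>\<omega>. X \<omega> \<bullet> j) -` A j \<inter> space M))"
    proof
      fix A :: "real ^ 'p \<Rightarrow> real set" assume A: "A \<in> Basis \<rightarrow> sets borel"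
      let ?E = "\<Inter>j\<in>Basis. (\<lambda>\<omega>. X \<omega> \<bullet> j) -` A j \<inter> space M"
      have E: "?E \<in> sets M"
      proof (intro sets.finite_INT)
        fix j :: "real ^ 'p" assume "j \<in> Basis"
        then show "(\<lambda>\<omega>. X \<omega> \<bullet> j) -` A j \<inter> space M \<in> events"
          using A by (intro measurable_sets[of _ M borel]) (auto simp: Pi_iff)
      qed auto
      have "emeasure M ?E = (\<integral>\<^sup>+\<omega>. indicator ?E \<omega> \<partial>M)" using E by simp
      also have "\<dots> = (\<integral>\<^sup>+\<omega>. (\<Prod>b\<in>(Basis :: (real ^ 'p) set). indicator (A b) (X \<omega> \<bullet> b)) \<partial>M)"
      proof (rule nn_integral_cong)
        fix \<omega> assume "\<omega> \<in> space M"
        then show "(indicator ?E \<omega> :: ennreal) = (\<Prod>b\<in>(Basis :: (real ^ 'p) set). indicator (A b) (X \<omega> \<bullet> b))"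
          by (cases "\<forall>b\<in>Basis. X \<omega> \<bullet> b \<in> A b") (auto simp: indicator_def intro!: prod.neutral[symmetric])
      qed
      also have "\<dots> = (\<Prod>b\<in>(Basis :: (real ^ 'p) set).
          \<integral>\<^sup>+t. ennreal (std_normal_density t) * indicator (A b) t \<partial>lborel)"
        using A by (intro nn_integral_std_normal_vec_prod[OF X]) (auto simp: Pi_iff)
      also have "\<dots> = (\<Prod>b\<in>(Basis :: (real ^ 'p) set). emeasure M ((\<lambda>\<omega>. X \<omega> \<bullet> b) -` A b \<inter> space M))"
        using A by (intro prod.cong refl distr_coord) auto
      finally show "prob ?E = (\<Prod>j\<in>Basis. prob ((\<lambda>\<omega>. X \<omega> \<bullet> j) -` A j \<inter> space M))"
        by (simp add: emeasure_eq_measure prod_ennreal prod_nonneg measure_nonneg)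
    qed
  qed auto
qed

lemma std_normal_vec_inner:
  fixes X :: "'a \<Rightarrow> real ^ 'p"
  assumes X: "distributed M lborel X std_normal_vec_density" and "v \<noteq> 0"
  shows "distributed M lborel (\<lambda>\<omega>. X \<omega> \<bullet> v) (normal_density 0 (norm v))"
proof -
  \<comment> \<open>Directions in which \<open>v\<close> vanishes are removed: the rule for sums of
    independent normal variables asks for positive standard deviations and a nonempty index
    set.\<close>
  define I where "I = {b \<in> Basis. v \<bullet> b \<noteq> 0}"
  have I: "finite I" "I \<subseteq> Basis" by (auto simp: I_def)
  have "\<exists>b\<in>Basis. v \<bullet> b \<noteq> 0"
    using \<open>v \<noteq> 0\<close> euclidean_all_zero_iff[of v] by blast
  then have "I \<noteq> {}" by (auto simp: I_def)
  have restrict: "(\<Sum>b\<in>Basis. f b * (v \<bullet> b)) = (\<Sum>b\<in>I. f b * (v \<bullet> b))" for f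
    by (rule sum.mono_neutral_right) (auto simp: I_def)
  have "distributed M lborel (\<lambda>\<omega>. \<Sum>b\<in>I. (v \<bullet> b) * (X \<omega> \<bullet> b))
      (normal_density (\<Sum>b\<in>I. 0) (sqrt (\<Sum>b\<in>I. \<bar>v \<bullet> b\<bar>\<^sup>2)))"
  proof (rule sum_indep_normal)
    show "indep_vars (\<lambda>i. borel) (\<lambda>b \<omega>. v \<bullet> b * (X \<omega> \<bullet> b)) I"
      by (rule indep_vars_compose2[OF indep_vars_subset[OF std_normal_vec_coordinates_indep[OF X] I(2)]]) simp
    fix b assume b: "b \<in> I"
    then show "0 < \<bar>v \<bullet> b\<bar>" by (simp add: I_def)
    have "distributed M lborel (\<lambda>\<omega>. X \<omega> \<bullet> b) (normal_density 0 1)"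
      using std_normal_vec_coordinate[OF X] b I(2) by auto
    from normal_density_affine[OF this, of "v \<bullet> b" 0] b
    show "distributed M lborel (\<lambda>\<omega>. v \<bullet> b * (X \<omega> \<bullet> b)) (normal_density 0 \<bar>v \<bullet> b\<bar>)"
      by (simp add: I_def)
  qed (use I \<open>I \<noteq> {}\<close> in auto)
  moreover have "(\<Sum>b\<in>I. (v \<bullet> b) * (X \<omega> \<bullet> b)) = X \<omega> \<bullet> v" for \<omega>
    by (subst euclidean_inner, subst restrict) (simp add: mult.commute)
  moreover have "sqrt (\<Sum>b\<in>I. \<bar>v \<bullet> b\<bar>\<^sup>2) = norm v"
    unfolding norm_eq_sqrt_inner by (subst euclidean_inner, subst restrict) (simp add: power2_eq_square)
  ultimately show ?thesis by simp
qed

end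

section \<open>Power inequalities and one-dimensional Gaussian integrals\<close>

lemma power_mean:
  fixes a :: "'i \<Rightarrow> real"
  assumes "finite I" "I \<noteq> {}" "\<And>i. i \<in> I \<Longrightarrow> 0 \<le> a i"
  shows "((\<Sum>i\<in>I. a i) / card I) ^ k \<le> (\<Sum>i\<in>I. a i ^ k) / card I"
proof -
  have "convex_on {0::real..} (\<lambda>x. x ^ k)"
  proof (cases "even k")
    case True
    then show ?thesis
      by (intro convex_on_subset[OF convex_power_even]) auto
  qed (rule convex_power_odd)
  then have "(\<Sum>i\<in>I. (1 / card I) *\<^sub>R a i) ^ k \<le> (\<Sum>i\<in>I. 1 / card I * a i ^ k)"
    by (rule convex_on_sum[OF assms(1,2)]) (use assms in auto)
  then show ?thesis by (simp add: sum_divide_distrib)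
qed

text \<open>All \<open>1 + card I\<close> summands are compared with the largest of them, which is
  either the constant 1 or some \<open>a j\<close> greater than 1.\<close>

lemma one_plus_sum_power_le:
  fixes a :: "'i \<Rightarrow> real"
  assumes "finite I" "\<And>i. i \<in> I \<Longrightarrow> 0 \<le> a i"
  shows "(1 + (\<Sum>i\<in>I. a i)) ^ k \<le> (1 + real (card I)) ^ k * (1 + (\<Sum>i\<in>I. a i ^ k))"
proof (cases "\<forall>i\<in>I. a i \<le> 1")
  case True
  then have "(\<Sum>i\<in>I. a i) \<le> card I"
    using sum_bounded_above[of I a 1] by simp
  then have "(1 + (\<Sum>i\<in>I. a i)) ^ k \<le> (1 + real (card I)) ^ k * 1"
    using assms by (auto intro!: power_mono add_nonneg_nonneg sum_nonneg)
  also have "\<dots> \<le> (1 + real (card I)) ^ k * (1 + (\<Sum>i\<in>I. a i ^ k))"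
    using assms by (intro mult_left_mono) (auto intro!: sum_nonneg)
  finally show ?thesis .
next
  case False
  define c where "c = Max (a ` I)"
  have "I \<noteq> {}" using False by auto
  then have "c \<in> a ` I"
    unfolding c_def using assms(1) by (intro Max_in) auto
  then obtain j where j: "j \<in> I" "a j = c" by auto
  have le: "a i \<le> c" if "i \<in> I" for i
    unfolding c_def using that assms(1) by simp
  have "c > 1" using False le by force
  have "1 + (\<Sum>i\<in>I. a i) \<le> c + real (card I) * c"
    using sum_bounded_above[of I a c] le \<open>c > 1\<close> by auto
  then have "(1 + (\<Sum>i\<in>I. a i)) ^ k \<le> ((1 + real (card I)) * c) ^ k"
    using assms by (intro power_mono) (auto intro!: add_nonneg_nonneg sum_nonneg simp: algebra_simps)
  also have "\<dots> = (1 + real (card I)) ^ k * a j ^ k" by (simp add: power_mult_distrib j)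
  also have "\<dots> \<le> (1 + real (card I)) ^ k * (1 + (\<Sum>i\<in>I. a i ^ k))"
  proof (intro mult_left_mono)
    have "a j ^ k \<le> (\<Sum>i\<in>I. a i ^ k)"
      using assms j by (intro member_le_sum) auto
    then show "a j ^ k \<le> 1 + (\<Sum>i\<in>I. a i ^ k)" by simp
  qed auto
  finally show ?thesis .
qed

lemma nn_integral_inverse_sqrt_Icc:
  "(\<integral>\<^sup>+t. inverse (ennreal (\<bar>t\<bar> powr (1/2))) * indicator {-1..1} t \<partial>lborel) \<le> 4"
proof -
  let ?g = "\<lambda>t::real. inverse (ennreal (\<bar>t\<bar> powr (1/2)))"
  have half: "(\<integral>\<^sup>+t. ?g t * indicator {0..1} t \<partial>lborel) = 2"
  proof -
    have "(\<integral>\<^sup>+t. ?g t * indicator {0..1} t \<partial>lborel) =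
        (\<integral>\<^sup>+t. ennreal (t powr (-1/2)) * indicator {0..1} t \<partial>lborel)"
    proof (rule nn_integral_cong_AE)
      \<comment> \<open>The two sides differ at 0, where the inverse is infinite and the real power
        is 0; a single point is a null set.\<close>
      show "AE t in lborel. ?g t * indicator {0..1} t = ennreal (t powr (-1/2)) * indicator {0..1} t"
        using AE_lborel_singleton[of "0::real"]
        by eventually_elim (auto simp: indicator_def inverse_ennreal powr_minus)
    qed
    also have "\<dots> = ennreal (1 powr ((-1/2) + 1) / ((-1/2) + 1))"
      using has_integral_powr_from_0[of "-1/2" 1]
      by (intro nn_integral_has_integral_lebesgue') auto
    finally show ?thesis by simp
  qed
  \<comment> \<open>The negative half is written with \<open>0 + -1 * t\<close>, the form in which
    the affine substitution rule reflects it onto the positive half. Each half has integral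
    2.\<close>
  have "(\<integral>\<^sup>+t. ?g t * indicator {-1..1} t \<partial>lborel) \<le>
      (\<integral>\<^sup>+t. ?g t * indicator {0..1} t + ?g (0 + -1 * t) * indicator {0..1} (0 + -1 * t) \<partial>lborel)"
    by (rule nn_integral_mono) (auto simp: indicator_def)
  also have "\<dots> = 2 + (\<integral>\<^sup>+t. ?g (0 + -1 * t) * indicator {0..1} (0 + -1 * t) \<partial>lborel)"
    by (subst nn_integral_add) (auto simp: half)
  also have "(\<integral>\<^sup>+t. ?g (0 + -1 * t) * indicator {0..1} (0 + -1 * t) \<partial>lborel) = 2"
    using nn_integral_real_affine[of "\<lambda>t. ?g t * indicator {0..1} t" "-1" 0] half by simp
  finally show ?thesis by simp
qed

text \<open>The peak of the density is at most 1 once \<open>2 * pi * \<sigma>^2\<close> is at least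
  1. The threshold 1/2 is the inner radius of the shell over which directions will be
  integrated.\<close>

lemma normal_density_le_one:
  assumes "1 / 2 \<le> \<sigma>"
  shows "normal_density 0 \<sigma> t \<le> 1"
proof -
  have "1 = 2 * (2::real) * (1/2)\<^sup>2" by (simp add: power2_eq_square)
  also have "\<dots> \<le> 2 * pi * \<sigma>\<^sup>2"
    using assms pi_ge_two by (intro mult_mono power_mono) auto
  finally have "1 / sqrt (2 * pi * \<sigma>\<^sup>2) \<le> 1" by simp
  then have "1 / sqrt (2 * pi * \<sigma>\<^sup>2) * exp (- t\<^sup>2 / (2 * \<sigma>\<^sup>2)) \<le> 1 * 1"
    by (intro mult_mono) auto
  then show ?thesis by (simp add: normal_density_def)
qed

context prob_space begin

text \<open>On \<open>[-1, 1]\<close> the density is at most 1 and the singularity has integral at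
  most 4; outside, the integrand is at most the density, of mass 1. The bound does not depend on
  \<open>\<sigma>\<close>, hence not on the direction that the inner product is taken with.\<close>

lemma normal_inverse_sqrt_moment:
  assumes Y: "distributed M lborel Y (normal_density 0 \<sigma>)" and \<sigma>: "1 / 2 \<le> \<sigma>"
  shows "(\<integral>\<^sup>+\<omega>. inverse (ennreal (\<bar>Y \<omega>\<bar> powr (1/2))) \<partial>M) \<le> 5"
proof -
  let ?g = "\<lambda>t::real. inverse (ennreal (\<bar>t\<bar> powr (1/2)))"
  have density: "(\<integral>\<^sup>+t. ennreal (normal_density 0 \<sigma> t) \<partial>lborel) = 1"
    using prob_space.emeasure_space_1[OF prob_space_normal_density[of \<sigma> 0]] \<sigma>
    by (simp add: emeasure_density)
  have "(\<integral>\<^sup>+\<omega>. ?g (Y \<omega>) \<partial>M) = (\<integral>\<^sup>+t. ennreal (normal_density 0 \<sigma> t) * ?g t \<partial>lborel)"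
    by (rule distributed_nn_integral[OF Y, symmetric]) simp
  also have "\<dots> \<le> (\<integral>\<^sup>+t. ennreal (normal_density 0 \<sigma> t) + ?g t * indicator {-1..1} t \<partial>lborel)"
  proof (rule nn_integral_mono)
    fix t :: real
    show "ennreal (normal_density 0 \<sigma> t) * ?g t \<le> ennreal (normal_density 0 \<sigma> t) + ?g t * indicator {-1..1} t"
    proof (cases "\<bar>t\<bar> \<le> 1")
      case True
      have "ennreal (normal_density 0 \<sigma> t) * ?g t \<le> 1 * ?g t"
        using normal_density_le_one[OF \<sigma>] by (intro mult_right_mono) auto
      also have "\<dots> \<le> ennreal (normal_density 0 \<sigma> t) + ?g t * indicator {-1..1} t"
        using True by (simp add: indicator_def abs_le_iff)
      finally show ?thesis .
    next
      case False
      then have "1 \<le> \<bar>t\<bar> powr (1/2)" by (intro ge_one_powr_ge_zero) auto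
      then have "?g t \<le> 1" using False by (simp add: inverse_ennreal inverse_le_1_iff)
      then have "ennreal (normal_density 0 \<sigma> t) * ?g t \<le> ennreal (normal_density 0 \<sigma> t) * 1"
        by (rule mult_left_mono) simp
      then show ?thesis by (simp add: add_increasing2)
    qed
  qed
  also have "\<dots> = 1 + (\<integral>\<^sup>+t. ?g t * indicator {-1..1} t \<partial>lborel)"
    by (subst nn_integral_add) (auto simp: density)
  also have "\<dots> \<le> 1 + 4"
    by (intro add_left_mono nn_integral_inverse_sqrt_Icc)
  finally show ?thesis by simp
qed

lemma normal_abs_moment:
  assumes Y: "distributed M lborel Y (normal_density 0 \<sigma>)" and "0 < \<sigma>"
  shows "(\<integral>\<^sup>+\<omega>. ennreal (\<bar>Y \<omega>\<bar> ^ k) \<partial>M) = ennreal (\<integral>t. normal_density 0 \<sigma> t * \<bar>t\<bar> ^ k \<partial>lborel)"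
proof -
  have "(\<integral>\<^sup>+\<omega>. ennreal (\<bar>Y \<omega>\<bar> ^ k) \<partial>M) =
      (\<integral>\<^sup>+t. ennreal (normal_density 0 \<sigma> t) * ennreal (\<bar>t\<bar> ^ k) \<partial>lborel)"
    by (rule distributed_nn_integral[OF Y, symmetric]) simp
  also have "\<dots> = (\<integral>\<^sup>+t. ennreal (normal_density 0 \<sigma> t * \<bar>t\<bar> ^ k) \<partial>lborel)"
    by (simp add: ennreal_mult')
  also have "\<dots> = ennreal (\<integral>t. normal_density 0 \<sigma> t * \<bar>t\<bar> ^ k \<partial>lborel)"
    using integrable_normal_moment_abs[OF \<open>0 < \<sigma>\<close>, of 0 k]
    by (intro nn_integral_eq_integral) auto
  finally show ?thesis .
qed

text \<open>The norm is at most the sum of the absolute coordinates, which are standard normal. The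
  constant is fixed before \<open>X\<close>, so that one value serves all observations.\<close>

lemma std_normal_vec_moment_bound:
  obtains C where "0 \<le> C" "\<And>X. distributed M lborel X (std_normal_vec_density :: real ^ 'p \<Rightarrow> real) \<Longrightarrow>
    (\<integral>\<^sup>+\<omega>. ennreal ((1 + norm (X \<omega>)) ^ k) \<partial>M) \<le> ennreal C"
proof
  define m where "m = (\<integral>t. std_normal_density t * \<bar>t\<bar> ^ k \<partial>lborel)"
  define d where "d = card (Basis :: (real ^ 'p) set)"
  have "0 \<le> m" unfolding m_def by (intro integral_nonneg_AE) auto
  then show "0 \<le> (1 + real d) ^ k * (1 + d * m)" by simp
  fix X :: "'a \<Rightarrow> real ^ 'p" assume X: "distributed M lborel X std_normal_vec_density"
  have [measurable]: "X \<in> borel_measurable M"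
    using distributed_measurable[OF X] by simp
  have "(\<integral>\<^sup>+\<omega>. ennreal ((1 + norm (X \<omega>)) ^ k) \<partial>M) \<le>
      (\<integral>\<^sup>+\<omega>. ennreal ((1 + real d) ^ k) * (1 + (\<Sum>b\<in>Basis. ennreal (\<bar>X \<omega> \<bullet> b\<bar> ^ k))) \<partial>M)"
  proof (rule nn_integral_mono)
    fix \<omega>
    have "(1 + norm (X \<omega>)) ^ k \<le> (1 + (\<Sum>b\<in>Basis. \<bar>X \<omega> \<bullet> b\<bar>)) ^ k"
      by (intro power_mono add_left_mono norm_le_l1) auto
    also have "\<dots> \<le> (1 + real d) ^ k * (1 + (\<Sum>b\<in>Basis. \<bar>X \<omega> \<bullet> b\<bar> ^ k))"
      unfolding d_def by (intro one_plus_sum_power_le) auto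
    finally show "ennreal ((1 + norm (X \<omega>)) ^ k) \<le>
        ennreal ((1 + real d) ^ k) * (1 + (\<Sum>b\<in>Basis. ennreal (\<bar>X \<omega> \<bullet> b\<bar> ^ k)))"
      by (simp add: sum_ennreal ennreal_mult'[symmetric] sum_nonneg ennreal_plus[symmetric]
            ennreal_1[symmetric] del: ennreal_1 ennreal_plus)
  qed
  also have "\<dots> = ennreal ((1 + real d) ^ k) * (1 + (\<Sum>b\<in>(Basis :: (real ^ 'p) set). ennreal m))"
  proof -
    have "(\<integral>\<^sup>+\<omega>. ennreal (\<bar>X \<omega> \<bullet> b\<bar> ^ k) \<partial>M) = ennreal m" if "b \<in> Basis" for b
      unfolding m_def by (rule normal_abs_moment[OF std_normal_vec_coordinate[OF X that]]) simp
    then show ?thesis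
      by (simp add: nn_integral_cmult nn_integral_add nn_integral_sum emeasure_space_1
          del: sum_ennreal)
  qed
  also have "\<dots> = ennreal ((1 + real d) ^ k * (1 + d * m))"
    using \<open>0 \<le> m\<close> by (simp add: sum_ennreal ennreal_mult' d_def
        ennreal_of_nat_eq_real_of_nat)
  finally show "(\<integral>\<^sup>+\<omega>. ennreal ((1 + norm (X \<omega>)) ^ k) \<partial>M) \<le> ennreal ((1 + real d) ^ k * (1 + d * m))" .
qed

end

section \<open>Inverse moments of the least eigenvalue\<close>

text \<open>The inverse is that of \<open>ennreal\<close>, infinite at \<open>0\<close>; a real power would have the junk value \<open>0\<close> there.\<close>

definition small_ball_factor :: "real ^ 'p \<Rightarrow> real ^ 'p \<Rightarrow> ennreal" where
  "small_ball_factor x v =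
     ennreal ((1 + norm x) ^ CARD('p)) * inverse (ennreal (\<bar>x \<bullet> v\<bar> powr (1/4)))"

text \<open>The shell contains the ball of radius 1/2 around every unit vector, which the lower
  bound needs, and stays away from 0, so that \<open>x \<bullet> v\<close> has standard deviation at
  least 1/2, which the upper bound needs.\<close>

definition small_ball_integral :: "'i set \<Rightarrow> ('i \<Rightarrow> real ^ 'p) \<Rightarrow> ennreal" where
  "small_ball_integral I x =
     (\<integral>\<^sup>+v. (\<Prod>i\<in>I. small_ball_factor (x i) v) * indicator (cball 0 2 - ball 0 (1/2)) v \<partial>lborel)"

text \<open>The volume of the unit ball, divided by 2 to the power \<open>p\<close> for the halved
  radius and by 2 to the power \<open>p + K\<close> for the bound \<open>2 * r\<close> on the inner
  products.\<close>

definition small_ball_const :: "'p::finite itself \<Rightarrow> nat \<Rightarrow> real" where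
  "small_ball_const _ K = unit_ball_vol CARD('p) / 2 ^ (2 * CARD('p) + K)"

lemma small_ball_const_pos: "0 < small_ball_const TYPE('p::finite) K"
  by (simp add: small_ball_const_def)

text \<open>The integral is restricted to a small ball around \<open>u\<close>, on which all inner
  products remain of order \<open>r\<close>. The radius has to shrink with the norms of the
  \<open>x i\<close>, through the product \<open>P\<close>; the lost volume is paid back exactly by
  the factors \<open>(1 + norm x) ^ p\<close>, so that the bound depends on \<open>r\<close>
  alone.\<close>

lemma small_ball_integral_ge:
  fixes x :: "'i \<Rightarrow> real ^ 'p"
  assumes "finite I" and card: "card I = 4 * (CARD('p) + K)"
    and u: "norm u = 1" and r: "0 < r" "r \<le> 1" and small: "\<And>i. i \<in> I \<Longrightarrow> \<bar>x i \<bullet> u\<bar> \<le> r"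
  shows "ennreal (small_ball_const TYPE('p) K / r ^ K) \<le> small_ball_integral I x"
proof -
  define p where "p = CARD('p)"
  define P where "P = (\<Prod>i\<in>I. 1 + norm (x i))"
  have P_ge: "1 + norm (x i) \<le> P" if "i \<in> I" for i
  proof -
    have "(\<Prod>j\<in>{i}. 1 + norm (x j)) \<le> P" unfolding P_def
      using \<open>finite I\<close> that by (intro prod_mono2) (auto simp: add_nonneg_nonneg)
    then show ?thesis by simp
  qed
  have P: "1 \<le> P" unfolding P_def by (intro prod_ge_1) auto
  \<comment> \<open>\<open>P\<close> bounds every norm, so moving by \<open>\<delta>\<close> changes
    an inner product by at most \<open>r\<close>. The 2 in the denominator gives
    \<open>\<delta> \<le> 1 / 2\<close>, which keeps the ball inside the shell.\<close>
  define \<delta> where "\<delta> = r / (2 * P)"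
  have \<delta>: "0 < \<delta>" "\<delta> \<le> 1 / 2" "2 * P * \<delta> = r"
    using r P by (auto simp: \<delta>_def field_simps)
  have ball_sub: "ball u \<delta> \<subseteq> cball 0 2 - ball 0 (1/2)"
  proof
    fix v assume "v \<in> ball u \<delta>"
    then have "norm (v - u) < 1 / 2" using \<delta> by (simp add: dist_norm norm_minus_commute)
    then show "v \<in> cball 0 2 - ball 0 (1/2)"
      using norm_triangle_ineq2[of u v] norm_triangle_ineq2[of v u] u
      by (auto simp: norm_minus_commute)
  qed
  have close: "\<bar>x i \<bullet> v\<bar> \<le> 2 * r" if i: "i \<in> I" and v: "v \<in> ball u \<delta>" for i v
  proof -
    have "\<bar>x i \<bullet> (v - u)\<bar> \<le> norm (x i) * norm (v - u)" by (rule Cauchy_Schwarz_ineq2)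
    also have "\<dots> \<le> P * \<delta>"
      using v P_ge[OF i] P by (intro mult_mono) (auto simp: dist_norm norm_minus_commute)
    also have "\<dots> \<le> r" using \<delta> r by simp
    finally show ?thesis using small[OF i] by (simp add: inner_diff_right)
  qed
  define t where "t = inverse ((2 * r) powr (1/4))"
  have "0 \<le> t" by (simp add: t_def)
  have t: "ennreal t \<le> inverse (ennreal (\<bar>x i \<bullet> v\<bar> powr (1/4)))" if "i \<in> I" "v \<in> ball u \<delta>" for i v
  \<comment> \<open>For a vanishing inner product the right-hand side is infinite and nothing is to
    be shown.\<close>
  proof (cases "x i \<bullet> v = 0")
    case False
    then have "inverse ((2 * r) powr (1/4)) \<le> inverse (\<bar>x i \<bullet> v\<bar> powr (1/4))"
      using close[OF that] by (intro le_imp_inverse_le powr_mono2) auto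
    then show ?thesis using False by (simp add: inverse_ennreal t_def)
  qed simp
  have "P ^ p * t ^ card I = (\<Prod>i\<in>I. (1 + norm (x i)) ^ p * t)"
    by (simp add: prod.distrib P_def prod_power_distrib)
  then have "ennreal (P ^ p * t ^ card I) = (\<Prod>i\<in>I. ennreal ((1 + norm (x i)) ^ p * t))"
    using \<open>0 \<le> t\<close> by (simp only:) (rule prod_ennreal[symmetric], simp)
  also have "\<dots> = (\<Prod>i\<in>I. ennreal ((1 + norm (x i)) ^ p) * ennreal t)"
    using \<open>0 \<le> t\<close> by (intro prod.cong refl ennreal_mult) auto
  also have prod_le: "\<dots> \<le> (\<Prod>i\<in>I. small_ball_factor (x i) v)" if "v \<in> ball u \<delta>" for v
    unfolding small_ball_factor_def p_def using t that by (intro prod_mono_ennreal) (auto intro!: mult_left_mono)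
  finally have ge: "ennreal (P ^ p * t ^ card I) \<le> (\<Prod>i\<in>I. small_ball_factor (x i) v)"
    if "v \<in> ball u \<delta>" for v using that .
  have t_card: "t ^ card I = inverse ((2 * r) ^ (p + K))"
  proof -
    have "((2 * r) powr (1/4)) ^ (4 * (p + K)) = (2 * r) powr (1/4 * real (4 * (p + K)))"
      using r by (subst powr_power) auto
    also have "1/4 * real (4 * (p + K)) = real (p + K)" by simp
    also have "(2 * r) powr real (p + K) = (2 * r) ^ (p + K)" using r by (intro powr_realpow) simp
    finally show ?thesis by (simp add: t_def card p_def power_inverse)
  qed
  have \<delta>_p: "\<delta> ^ p = r ^ p / (2 ^ p * P ^ p)" by (simp add: \<delta>_def power_divide power_mult_distrib)
  have pow2: "(2::real) ^ (2 * p + K) = 2 ^ p * 2 ^ p * 2 ^ K" by (simp add: power_add mult_2)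
  have "small_ball_const TYPE('p) K / r ^ K = P ^ p * t ^ card I * (unit_ball_vol p * \<delta> ^ p)"
    unfolding t_card \<delta>_p small_ball_const_def p_def[symmetric] pow2
    using r P by (simp add: power_add power_mult_distrib field_simps)
  also have "ennreal \<dots> = ennreal (P ^ p * t ^ card I) * emeasure lborel (ball u \<delta>)"
    using \<delta> P \<open>0 \<le> t\<close> by (subst emeasure_ball) (auto simp: p_def ennreal_mult')
  also have "\<dots> = (\<integral>\<^sup>+v. ennreal (P ^ p * t ^ card I) * indicator (ball u \<delta>) v \<partial>lborel)"
    by (rule nn_integral_cmult_indicator[symmetric]) simp
  also have "\<dots> \<le> small_ball_integral I x"
    unfolding small_ball_integral_def
    by (intro nn_integral_mono) (use ge ball_sub in \<open>auto simp: indicator_def\<close>)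
  finally show ?thesis .
qed

text \<open>If some unit vector violated the claim, all inner products would be at most
  \<open>r\<close>, the root of \<open>1 / \<theta>\<close>, and the small-ball integral
  \<open>J\<close> would be at least \<open>c * \<theta> ^ k = c + J\<close>. The summand 1 in
  \<open>\<theta>\<close> makes this a contradiction and also gives
  \<open>r \<le> 1\<close>.\<close>

lemma block_least_eigenvalue:
  fixes x :: "'i \<Rightarrow> real ^ 'p"
  assumes "finite I" and card: "card I = 4 * (CARD('p) + 2 * k)" and "0 < k"
    and fin: "small_ball_integral I x < \<infinity>"
  defines "\<theta> \<equiv> root k (1 + enn2real (small_ball_integral I x) / small_ball_const TYPE('p) (2 * k))"
  shows "(norm u)\<^sup>2 \<le> \<theta> * (\<Sum>i\<in>I. (x i \<bullet> u)\<^sup>2)"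
proof -
  define c where "c = small_ball_const TYPE('p) (2 * k)"
  define J where "J = enn2real (small_ball_integral I x)"
  have J: "0 \<le> J" "small_ball_integral I x = ennreal J"
    using fin by (auto simp: J_def ennreal_enn2real_if)
  have "0 < c" by (simp add: c_def small_ball_const_pos)
  have \<theta>: "\<theta> ^ k = 1 + J / c" "1 \<le> \<theta>"
    using \<open>0 < k\<close> \<open>0 < c\<close> J(1) by (auto simp: \<theta>_def c_def[symmetric] J_def[symmetric])
  have unit: "1 \<le> \<theta> * (\<Sum>i\<in>I. (x i \<bullet> w)\<^sup>2)" if w: "norm w = 1" for w
  proof (rule ccontr)
    assume "\<not> ?thesis"
    then have lt: "(\<Sum>i\<in>I. (x i \<bullet> w)\<^sup>2) < 1 / \<theta>" using \<theta>(2) by (simp add: field_simps)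
    \<comment> \<open>Since \<open>r^2\<close> is \<open>1 / \<theta>\<close>, the exponent
      \<open>2 * k\<close> in the small-ball bound becomes the \<open>k\<close>-th power of
      \<open>\<theta>\<close>.\<close>
    define r where "r = sqrt (1 / \<theta>)"
    have r: "0 < r" "r \<le> 1" "r\<^sup>2 = 1 / \<theta>" using \<theta>(2) by (auto simp: r_def)
    have "\<bar>x i \<bullet> w\<bar> \<le> r" if "i \<in> I" for i
    proof -
      have "(x i \<bullet> w)\<^sup>2 \<le> (\<Sum>i\<in>I. (x i \<bullet> w)\<^sup>2)"
        using \<open>finite I\<close> that by (intro member_le_sum) auto
      then have "(x i \<bullet> w)\<^sup>2 \<le> r\<^sup>2" using lt r by simp
      then show ?thesis using r(1) by (simp add: abs_le_square_iff[symmetric])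
    qed
    then have "ennreal (c / r ^ (2 * k)) \<le> ennreal J"
      unfolding c_def J(2)[symmetric] using r w \<open>finite I\<close> card by (intro small_ball_integral_ge) auto
    then have "c / r ^ (2 * k) \<le> J" using J(1) by simp
    moreover have "c / r ^ (2 * k) = c * \<theta> ^ k"
      by (simp add: power_mult r(3) power_divide)
    ultimately show False using \<open>0 < c\<close> by (simp add: \<theta>(1) distrib_left)
  qed
  show ?thesis
  proof (cases "u = 0")
    case False
    have "(\<Sum>i\<in>I. (x i \<bullet> u)\<^sup>2) = (norm u)\<^sup>2 * (\<Sum>i\<in>I. (x i \<bullet> sgn u)\<^sup>2)"
      unfolding sum_distrib_left using False
      by (intro sum.cong) (auto simp: sgn_div_norm power_mult_distrib power_divide field_simps)
    moreover have "(norm u)\<^sup>2 * 1 \<le> (norm u)\<^sup>2 * (\<theta> * (\<Sum>i\<in>I. (x i \<bullet> sgn u)\<^sup>2))"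
      using False by (intro mult_left_mono unit) (auto simp: norm_sgn)
    ultimately show ?thesis by (simp add: mult_ac)
  qed (use \<theta>(2) in \<open>auto intro!: mult_nonneg_nonneg sum_nonneg\<close>)
qed

lemma measurable_small_ball_factor[measurable]:
  assumes [measurable]: "f \<in> borel_measurable M" "g \<in> borel_measurable M"
  shows "(\<lambda>\<omega>. small_ball_factor (f \<omega>) (g \<omega>)) \<in> borel_measurable M"
  unfolding small_ball_factor_def by measurable

lemma measurable_small_ball_integral[measurable (raw)]:
  fixes X :: "'i \<Rightarrow> 'a \<Rightarrow> real ^ 'p"
  assumes "\<And>i. i \<in> I \<Longrightarrow> X i \<in> borel_measurable M"
  shows "(\<lambda>\<omega>. small_ball_integral I (\<lambda>i. X i \<omega>)) \<in> borel_measurable M"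
proof -
  define A :: "(real ^ 'p) set" where "A = cball 0 2 - ball 0 (1/2)"
  have [measurable]: "A \<in> sets borel" by (simp add: A_def)
  show ?thesis
    unfolding small_ball_integral_def A_def[symmetric] using assms by measurable
qed

section \<open>Expectation of the small-ball integral\<close>

context prob_space begin

text \<open>After exchanging the integrals the direction \<open>v\<close> is fixed and the factors
  are independent, so the expectation of the product splits into \<open>m\<close> expectations
  bounded uniformly over the shell; the finite volume of the shell does the rest.\<close>

lemma small_ball_integral_expectation:
  obtains C where "0 \<le> C" "\<And>(I :: 'i set) X. finite I \<Longrightarrow> card I = m \<Longrightarrow> indep_vars (\<lambda>_. borel) X I \<Longrightarrow>
    (\<And>i. i \<in> I \<Longrightarrow> distributed M lborel (X i) (std_normal_vec_density :: real ^ 'p \<Rightarrow> real)) \<Longrightarrow>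
    (\<integral>\<^sup>+\<omega>. small_ball_integral I (\<lambda>i. X i \<omega>) \<partial>M) \<le> ennreal C"
proof -
  obtain C where C: "0 \<le> C" "\<And>X. distributed M lborel X (std_normal_vec_density :: real ^ 'p \<Rightarrow> real) \<Longrightarrow>
      (\<integral>\<^sup>+\<omega>. ennreal ((1 + norm (X \<omega>)) ^ (2 * CARD('p))) \<partial>M) \<le> ennreal C"
    using std_normal_vec_moment_bound[where k = "2 * CARD('p)"] by blast
  define A :: "(real ^ 'p) set" where "A = cball 0 2 - ball 0 (1/2)"
  have A[measurable]: "A \<in> sets borel" by (simp add: A_def)
  have "emeasure lborel (cball (0 :: real ^ 'p) 2) \<noteq> \<top>"
    using emeasure_lborel_cball_finite[of "0 :: real ^ 'p" 2] by auto
  then have vol: "emeasure lborel A \<le> ennreal (measure lborel (cball (0 :: real ^ 'p) 2))"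
    unfolding A_def by (subst emeasure_eq_ennreal_measure[symmetric]) (auto intro!: emeasure_mono)
  show thesis
  proof
    show "0 \<le> (C + 5) ^ m * measure lborel (cball (0 :: real ^ 'p) 2)" using C(1) by simp
    fix I :: "'i set" and X :: "'i \<Rightarrow> 'a \<Rightarrow> real ^ 'p"
    assume I: "finite I" "card I = m" and indep: "indep_vars (\<lambda>_. borel) X I"
      and X: "\<And>i. i \<in> I \<Longrightarrow> distributed M lborel (X i) std_normal_vec_density"
    have [measurable]: "X i \<in> borel_measurable M" if "i \<in> I" for i
      using distributed_measurable[OF X[OF that]] by simp
    have factor: "(\<integral>\<^sup>+\<omega>. small_ball_factor (X i \<omega>) v \<partial>M) \<le> ennreal (C + 5)" if i: "i \<in> I" and v: "v \<in> A" for i v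
    proof -
      \<comment> \<open>The norm and the inner product of the same vector are dependent; bounding
        the product by the sum of squares separates them into a Gaussian moment and an inverse
        square root.\<close>
      have "(\<integral>\<^sup>+\<omega>. small_ball_factor (X i \<omega>) v \<partial>M) \<le>
          (\<integral>\<^sup>+\<omega>. ennreal ((1 + norm (X i \<omega>)) ^ (2 * CARD('p))) + inverse (ennreal (\<bar>X i \<omega> \<bullet> v\<bar> powr (1/2))) \<partial>M)"
      proof (rule nn_integral_mono)
        fix \<omega>
        let ?a = "ennreal ((1 + norm (X i \<omega>)) ^ CARD('p))"
        let ?b = "inverse (ennreal (\<bar>X i \<omega> \<bullet> v\<bar> powr (1/4)))"
        have "\<bar>X i \<omega> \<bullet> v\<bar> powr (1/2) = (\<bar>X i \<omega> \<bullet> v\<bar> powr (1/4))\<^sup>2"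
          by (simp add: power2_eq_square powr_add[symmetric])
        then have b: "inverse (ennreal (\<bar>X i \<omega> \<bullet> v\<bar> powr (1/2))) = ?b\<^sup>2"
          by (simp add: ennreal_power[symmetric] ennreal_inverse_power)
        have a: "ennreal ((1 + norm (X i \<omega>)) ^ (2 * CARD('p))) = ?a\<^sup>2"
          by (simp add: ennreal_power power_mult[symmetric] mult.commute)
        have "?a * ?b \<le> ?a\<^sup>2 + ?b\<^sup>2"
        \<comment> \<open>With possibly infinite values the square of a difference cannot be
          expanded; the product is bounded by the square of the larger factor instead.\<close>
        proof (cases "?a \<le> ?b")
          case True
          then have "?a * ?b \<le> ?b * ?b" by (intro mult_right_mono) auto
          then show ?thesis by (simp add: power2_eq_square add_increasing)
        next
          case False
          then have "?a * ?b \<le> ?a * ?a" by (intro mult_left_mono) auto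
          then show ?thesis by (simp add: power2_eq_square add_increasing2)
        qed
        then show "small_ball_factor (X i \<omega>) v \<le>
            ennreal ((1 + norm (X i \<omega>)) ^ (2 * CARD('p))) + inverse (ennreal (\<bar>X i \<omega> \<bullet> v\<bar> powr (1/2)))"
          unfolding a b small_ball_factor_def .
      qed
      also have "\<dots> = (\<integral>\<^sup>+\<omega>. ennreal ((1 + norm (X i \<omega>)) ^ (2 * CARD('p))) \<partial>M) +
          (\<integral>\<^sup>+\<omega>. inverse (ennreal (\<bar>X i \<omega> \<bullet> v\<bar> powr (1/2))) \<partial>M)"
        using i by (intro nn_integral_add) auto
      also have "\<dots> \<le> ennreal C + 5"
      proof (intro add_mono C(2) X i)
        have "1 / 2 \<le> norm v" using v by (simp add: A_def)
        moreover then have "v \<noteq> 0" by auto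
        ultimately show "(\<integral>\<^sup>+\<omega>. inverse (ennreal (\<bar>X i \<omega> \<bullet> v\<bar> powr (1/2))) \<partial>M) \<le> 5"
          by (intro normal_inverse_sqrt_moment[OF std_normal_vec_inner[OF X[OF i]]])
      qed
      finally show ?thesis using C(1) by simp
    qed
    interpret pair_sigma_finite M "lborel :: (real ^ 'p) measure" ..
    have "(\<integral>\<^sup>+\<omega>. small_ball_integral I (\<lambda>i. X i \<omega>) \<partial>M) =
        (\<integral>\<^sup>+v. \<integral>\<^sup>+\<omega>. (\<Prod>i\<in>I. small_ball_factor (X i \<omega>) v) * indicator A v \<partial>M \<partial>lborel)"
      unfolding small_ball_integral_def A_def[symmetric]
      by (rule Fubini'[symmetric]) (auto simp: case_prod_beta)
    also have "\<dots> \<le> (\<integral>\<^sup>+v. ennreal ((C + 5) ^ m) * indicator A v \<partial>lborel)"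
    proof (rule nn_integral_mono)
      fix v
      show "(\<integral>\<^sup>+\<omega>. (\<Prod>i\<in>I. small_ball_factor (X i \<omega>) v) * indicator A v \<partial>M)
          \<le> ennreal ((C + 5) ^ m) * indicator A v"
      proof (cases "v \<in> A")
        case True
        have "indep_vars (\<lambda>_. borel) (\<lambda>i \<omega>. small_ball_factor (X i \<omega>) v) I"
          by (rule indep_vars_compose2[OF indep]) measurable
        then have "(\<integral>\<^sup>+\<omega>. (\<Prod>i\<in>I. small_ball_factor (X i \<omega>) v) \<partial>M) =
            (\<Prod>i\<in>I. \<integral>\<^sup>+\<omega>. small_ball_factor (X i \<omega>) v \<partial>M)"
          by (intro indep_vars_nn_integral I) auto
        also have "\<dots> \<le> (\<Prod>i\<in>I. ennreal (C + 5))"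
          using True by (intro prod_mono_ennreal) (auto intro!: factor)
        also have "\<dots> = ennreal ((C + 5) ^ m)" using C(1) I ennreal_power[of "C + 5" m] by simp
        finally show ?thesis using True by simp
      qed simp
    qed
    also have "\<dots> = ennreal ((C + 5) ^ m) * emeasure lborel A"
      by (rule nn_integral_cmult_indicator) simp
    also have "\<dots> \<le> ennreal ((C + 5) ^ m) * ennreal (measure lborel (cball (0 :: real ^ 'p) 2))"
      by (intro mult_left_mono vol) simp
    also have "\<dots> = ennreal ((C + 5) ^ m * measure lborel (cball (0 :: real ^ 'p) 2))"
      using C(1) by (simp add: ennreal_mult')
    finally show "(\<integral>\<^sup>+\<omega>. small_ball_integral I (\<lambda>i. X i \<omega>) \<partial>M)
        \<le> ennreal ((C + 5) ^ m * measure lborel (cball (0 :: real ^ 'p) 2))" .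
  qed
qed

end

section \<open>Averaging over blocks of observations\<close>

lemma arith_harmonic_mean:
  fixes a :: "'i \<Rightarrow> real"
  assumes "\<And>i. i \<in> I \<Longrightarrow> 0 < a i"
  shows "(real (card I))\<^sup>2 \<le> (\<Sum>i\<in>I. a i) * (\<Sum>i\<in>I. 1 / a i)"
proof -
  have "real (card I) = (\<Sum>i\<in>I. sqrt (a i) * sqrt (1 / a i))"
  proof -
    have "sqrt (a i) * sqrt (1 / a i) = 1" if "i \<in> I" for i
      using assms[OF that] by (simp add: real_sqrt_mult[symmetric])
    then show ?thesis by simp
  qed
  then have "(real (card I))\<^sup>2 = (\<Sum>i\<in>I. sqrt (a i) * sqrt (1 / a i))\<^sup>2" by simp
  also have "\<dots> \<le> (\<Sum>i\<in>I. (sqrt (a i))\<^sup>2) * (\<Sum>i\<in>I. (sqrt (1 / a i))\<^sup>2)"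
    by (rule Cauchy_Schwarz_ineq_sum)
  also have "\<dots> = (\<Sum>i\<in>I. a i) * (\<Sum>i\<in>I. 1 / a i)"
    using assms by (intro arg_cong2[where f = "(*)"] sum.cong) (auto simp: less_imp_le)
  finally show ?thesis .
qed

context prob_space begin

text \<open>\<open>\<Theta>\<close> may depend on \<open>n\<close>, but the bound for its moment may
  not. The block size is tied to \<open>k\<close> and the dimension only; as \<open>n\<close> grows,
  more blocks of the same kind are averaged.\<close>

lemma gram_matrix_inverse_moment:
  fixes X :: "nat \<Rightarrow> 'a \<Rightarrow> real ^ 'p"
  assumes indep: "indep_vars (\<lambda>_. borel) X UNIV"
    and X: "\<And>i. distributed M lborel (X i) std_normal_vec_density"
    and "0 < k"
  obtains C where "0 \<le> C" "\<And>n. 4 * (CARD('p) + 2 * k) < n \<Longrightarrow>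
    \<exists>\<Theta>. \<Theta> \<in> borel_measurable M \<and> (\<forall>\<omega>. 1 \<le> \<Theta> \<omega>) \<and>
      (AE \<omega> in M. \<forall>u. real n * (norm u)\<^sup>2 \<le> \<Theta> \<omega> * (\<Sum>i\<in>{2..n}. (X i \<omega> \<bullet> u)\<^sup>2)) \<and>
      (\<integral>\<^sup>+\<omega>. ennreal (\<Theta> \<omega> ^ k) \<partial>M) \<le> ennreal C"
proof -
  define m where "m = 4 * (CARD('p) + 2 * k)"
  define c where "c = small_ball_const TYPE('p) (2 * k)"
  have "0 < c" by (simp add: c_def small_ball_const_pos)
  have "0 < m" using \<open>0 < k\<close> by (simp add: m_def)
  have [measurable]: "X i \<in> borel_measurable M" for i
    using distributed_measurable[OF X] by simp
  obtain C where C: "0 \<le> C" "\<And>(I :: nat set) X. finite I \<Longrightarrow> card I = m \<Longrightarrow> indep_vars (\<lambda>_. borel) X I \<Longrightarrow>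
      (\<And>i. i \<in> I \<Longrightarrow> distributed M lborel (X i) (std_normal_vec_density :: real ^ 'p \<Rightarrow> real)) \<Longrightarrow>
      (\<integral>\<^sup>+\<omega>. small_ball_integral I (\<lambda>i. X i \<omega>) \<partial>M) \<le> ennreal C"
    using small_ball_integral_expectation[where m = m] by blast
  show thesis
  proof
    show "0 \<le> real (2 * m) ^ k * (1 + C / c)" using C(1) \<open>0 < c\<close> by simp
    fix n assume n: "4 * (CARD('p) + 2 * k) < n"
    \<comment> \<open>The indices \<open>2..n\<close> offer \<open>n - 1\<close> places. Since
      \<open>n\<close> exceeds \<open>m\<close> there is at least one full block, so the incomplete
      remainder costs at most the factor 2 in \<open>n \<le> 2 * m * N\<close>.\<close>
    define N where "N = (n - 1) div m"
    have N: "0 < N" "N * m < n" "n \<le> 2 * m * N"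
    proof -
      have "m \<le> n - 1" using n by (simp add: m_def)
      then show "0 < N" using \<open>0 < m\<close> by (simp add: N_def div_greater_zero_iff)
      have "N * m \<le> n - 1" by (simp add: N_def)
      then show "N * m < n" using n by simp
      have "n - 1 = N * m + (n - 1) mod m" by (simp add: N_def)
      moreover have "(n - 1) mod m < m" using \<open>0 < m\<close> by simp
      moreover have "m \<le> N * m" using \<open>0 < N\<close> by simp
      moreover have "2 * m * N = N * m + N * m" by simp
      ultimately show "n \<le> 2 * m * N" using n by linarith
    qed
    define I where "I l = {2 + l * m..<2 + l * m + m}" for l
    have I: "finite (I l)" "card (I l) = m" for l by (simp_all add: I_def)
    have I_sub: "(\<Union>l<N. I l) \<subseteq> {2..n}"
    proof safe
      fix l i assume "l < N" "i \<in> I l"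
      moreover from \<open>l < N\<close> have "(l + 1) * m \<le> N * m" by (intro mult_right_mono) auto
      then have "l * m + m \<le> N * m" by simp
      ultimately show "i \<in> {2..n}" using N(2) unfolding I_def atLeastLessThan_iff atLeastAtMost_iff by linarith
    qed
    have disj: "I l \<inter> I l' = {}" if "l \<noteq> l'" for l l'
    proof -
      have "I l \<inter> I l' = {}" if "l < l'" for l l'
      proof -
        have "(l + 1) * m \<le> l' * m" using that by (intro mult_right_mono) auto
        then have "l * m + m \<le> l' * m" by simp
        then have "\<not> (i \<in> I l \<and> i \<in> I l')" for i
          unfolding I_def atLeastLessThan_iff by linarith
        then show ?thesis by blast
      qed
      from this[of l l'] this[of l' l] that show ?thesis
        by (cases l l' rule: linorder_cases) (simp_all add: Int_commute)
    qed
    define J where "J l \<omega> = small_ball_integral (I l) (\<lambda>i. X i \<omega>)" for l \<omega>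
    have [measurable]: "J l \<in> borel_measurable M" for l unfolding J_def by measurable
    have J_int: "(\<integral>\<^sup>+\<omega>. J l \<omega> \<partial>M) \<le> ennreal C" for l
      unfolding J_def by (rule C(2)[OF I indep_vars_subset[OF indep] X]) simp
    define \<theta> where "\<theta> l \<omega> = root k (1 + enn2real (J l \<omega>) / c)" for l \<omega>
    have \<theta>: "1 \<le> \<theta> l \<omega>" "\<theta> l \<omega> ^ k = 1 + enn2real (J l \<omega>) / c" for l \<omega>
      using \<open>0 < k\<close> \<open>0 < c\<close> by (auto simp: \<theta>_def)
    \<comment> \<open>The block bounds add up to at least the sum of the
      \<open>1 / \<theta> l\<close>, which is at least \<open>N^2\<close> divided by the sum of the
      \<open>\<theta> l\<close>. Together with \<open>n \<le> 2 * m * N\<close> this gives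
      \<open>2 * m\<close> times the mean of the \<open>\<theta> l\<close>.\<close>
    define \<Theta> where "\<Theta> \<omega> = real (2 * m) * ((\<Sum>l<N. \<theta> l \<omega>) / N)" for \<omega>
    have "\<Theta> \<in> borel_measurable M" unfolding \<Theta>_def \<theta>_def by measurable
    moreover have "1 \<le> \<Theta> \<omega>" for \<omega>
    proof -
      have "real N \<le> (\<Sum>l<N. \<theta> l \<omega>)" using sum_mono[of "{..<N}" "\<lambda>_. 1" "\<lambda>l. \<theta> l \<omega>"] \<theta>(1) by simp
      then have "1 \<le> (\<Sum>l<N. \<theta> l \<omega>) / N" using N(1) by simp
      moreover have "1 \<le> real (2 * m)" using \<open>0 < m\<close> by simp
      ultimately have "1 * 1 \<le> \<Theta> \<omega>" unfolding \<Theta>_def by (intro mult_mono) auto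
      then show ?thesis by simp
    qed
    moreover have "AE \<omega> in M. \<forall>u. real n * (norm u)\<^sup>2 \<le> \<Theta> \<omega> * (\<Sum>i\<in>{2..n}. (X i \<omega> \<bullet> u)\<^sup>2)"
    proof -
      \<comment> \<open>\<open>enn2real\<close> would turn an infinite value into 0 and spoil the
        block bound; a finite expectation excludes infinity almost surely.\<close>
      have "AE \<omega> in M. J l \<omega> < \<infinity>" for l
      proof -
        have "(\<integral>\<^sup>+\<omega>. J l \<omega> \<partial>M) \<noteq> \<infinity>" using J_int[of l] by (auto simp: top_unique)
        from nn_integral_PInf_AE[OF _ this] show ?thesis by (simp add: less_top)
      qed
      then have "AE \<omega> in M. \<forall>l\<in>{..<N}. J l \<omega> < \<infinity>" by (intro AE_finite_allI) auto
      then show ?thesis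
      proof eventually_elim
        fix \<omega> assume fin: "\<forall>l\<in>{..<N}. J l \<omega> < \<infinity>"
        show "\<forall>u. real n * (norm u)\<^sup>2 \<le> \<Theta> \<omega> * (\<Sum>i\<in>{2..n}. (X i \<omega> \<bullet> u)\<^sup>2)"
        proof
          fix u :: "real ^ 'p"
          define S where "S = (\<Sum>l<N. \<theta> l \<omega>)"
          define R where "R = (\<Sum>l<N. 1 / \<theta> l \<omega>)"
          have pos: "0 < \<theta> l \<omega>" for l using \<theta>(1)[of l \<omega>] by simp
          have SR: "(real N)\<^sup>2 \<le> S * R"
            using arith_harmonic_mean[of "{..<N}" "\<lambda>l. \<theta> l \<omega>"] pos by (simp add: S_def R_def)
          have "(norm u)\<^sup>2 * R = (\<Sum>l<N. (norm u)\<^sup>2 / \<theta> l \<omega>)" by (simp add: R_def sum_distrib_left)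
          also have "\<dots> \<le> (\<Sum>l<N. \<Sum>i\<in>I l. (X i \<omega> \<bullet> u)\<^sup>2)"
          proof (rule sum_mono)
            fix l assume "l \<in> {..<N}"
            then have "(norm u)\<^sup>2 \<le> \<theta> l \<omega> * (\<Sum>i\<in>I l. (X i \<omega> \<bullet> u)\<^sup>2)"
              unfolding \<theta>_def J_def c_def
              using I fin \<open>0 < k\<close> by (intro block_least_eigenvalue) (auto simp: m_def J_def)
            then show "(norm u)\<^sup>2 / \<theta> l \<omega> \<le> (\<Sum>i\<in>I l. (X i \<omega> \<bullet> u)\<^sup>2)"
              using pos[of l] by (simp add: pos_divide_le_eq mult.commute)
          qed
          also have "\<dots> = (\<Sum>i\<in>(\<Union>l<N. I l). (X i \<omega> \<bullet> u)\<^sup>2)"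
            using disj I by (intro sum.UNION_disjoint[symmetric]) auto
          also have "\<dots> \<le> (\<Sum>i\<in>{2..n}. (X i \<omega> \<bullet> u)\<^sup>2)"
            using I_sub by (intro sum_mono2) auto
          finally have Q: "(norm u)\<^sup>2 * R \<le> (\<Sum>i\<in>{2..n}. (X i \<omega> \<bullet> u)\<^sup>2)" .
          have "0 \<le> S" unfolding S_def using pos by (intro sum_nonneg) (simp add: less_imp_le)
          have "real n * (norm u)\<^sup>2 \<le> real (2 * m * N) * (norm u)\<^sup>2"
            using N(3) by (intro mult_right_mono) (auto simp del: of_nat_mult)
          also have "\<dots> = real (2 * m) / N * (norm u)\<^sup>2 * (real N)\<^sup>2"
            using N(1) by (simp add: power2_eq_square)
          also have "\<dots> \<le> real (2 * m) / N * (norm u)\<^sup>2 * (S * R)"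
            using SR by (intro mult_left_mono) auto
          also have "\<dots> = \<Theta> \<omega> * ((norm u)\<^sup>2 * R)" by (simp add: \<Theta>_def S_def[symmetric])
          also have "\<dots> \<le> \<Theta> \<omega> * (\<Sum>i\<in>{2..n}. (X i \<omega> \<bullet> u)\<^sup>2)"
            using \<open>0 \<le> S\<close> by (intro mult_left_mono Q) (simp add: \<Theta>_def S_def[symmetric])
          finally show "real n * (norm u)\<^sup>2 \<le> \<Theta> \<omega> * (\<Sum>i\<in>{2..n}. (X i \<omega> \<bullet> u)\<^sup>2)" .
        qed
      qed
    qed
    moreover have "(\<integral>\<^sup>+\<omega>. ennreal (\<Theta> \<omega> ^ k) \<partial>M) \<le> ennreal (real (2 * m) ^ k * (1 + C / c))"
    proof -
      have "(\<integral>\<^sup>+\<omega>. ennreal (\<Theta> \<omega> ^ k) \<partial>M) \<le>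
          (\<integral>\<^sup>+\<omega>. ennreal (real (2 * m) ^ k / N) * (\<Sum>l<N. 1 + ennreal (1 / c) * J l \<omega>) \<partial>M)"
      proof (rule nn_integral_mono)
        fix \<omega>
        \<comment> \<open>Convexity moves the power inside the mean. The number of blocks then
          cancels, and the expectation of a single block decides.\<close>
        have "((\<Sum>l<N. \<theta> l \<omega>) / N) ^ k \<le> (\<Sum>l<N. \<theta> l \<omega> ^ k) / N"
          using power_mean[of "{..<N}" "\<lambda>l. \<theta> l \<omega>" k] \<theta>(1) N(1)
          by (auto intro: order_trans[OF zero_le_one])
        then have "\<Theta> \<omega> ^ k \<le> real (2 * m) ^ k * ((\<Sum>l<N. \<theta> l \<omega> ^ k) / N)"
          unfolding \<Theta>_def power_mult_distrib by (intro mult_left_mono) auto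
        also have "\<dots> = real (2 * m) ^ k / N * (\<Sum>l<N. 1 + enn2real (J l \<omega>) / c)"
          by (simp add: \<theta>(2))
        finally have "ennreal (\<Theta> \<omega> ^ k) \<le>
            ennreal (real (2 * m) ^ k / N) * ennreal (\<Sum>l<N. 1 + enn2real (J l \<omega>) / c)"
          by (subst ennreal_mult'[symmetric]) (auto intro!: ennreal_leI)
        also have "ennreal (\<Sum>l<N. 1 + enn2real (J l \<omega>) / c) = (\<Sum>l<N. ennreal (1 + enn2real (J l \<omega>) / c))"
          using \<open>0 < c\<close> by (intro sum_ennreal[symmetric]) (simp add: add_nonneg_nonneg)
        also have "\<dots> \<le> (\<Sum>l<N. 1 + ennreal (1 / c) * J l \<omega>)"
        proof (rule sum_mono)
          fix l
          have "ennreal (1 + enn2real (J l \<omega>) / c) = 1 + ennreal (1 / c) * ennreal (enn2real (J l \<omega>))"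
            using \<open>0 < c\<close> by (simp add: ennreal_mult'[symmetric])
          also have "\<dots> \<le> 1 + ennreal (1 / c) * J l \<omega>"
            by (intro add_left_mono mult_left_mono) (auto simp: ennreal_enn2real_if)
          finally show "ennreal (1 + enn2real (J l \<omega>) / c) \<le> 1 + ennreal (1 / c) * J l \<omega>" .
        qed
        finally show "ennreal (\<Theta> \<omega> ^ k) \<le>
            ennreal (real (2 * m) ^ k / N) * (\<Sum>l<N. 1 + ennreal (1 / c) * J l \<omega>)"
          by (simp add: mult_left_mono)
      qed
      also have "\<dots> = ennreal (real (2 * m) ^ k / N) * (\<Sum>l<N. 1 + ennreal (1 / c) * (\<integral>\<^sup>+\<omega>. J l \<omega> \<partial>M))"
        by (simp add: nn_integral_cmult nn_integral_sum nn_integral_add emeasure_space_1)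
      also have "\<dots> \<le> ennreal (real (2 * m) ^ k / N) * (\<Sum>l<N. 1 + ennreal (1 / c) * ennreal C)"
        by (intro mult_left_mono sum_mono add_left_mono J_int) auto
      also have "\<dots> = ennreal (real (2 * m) ^ k / N) * (\<Sum>l<N. ennreal (1 + C / c))"
        using C(1) \<open>0 < c\<close> by (simp add: ennreal_mult'[symmetric])
      also have "\<dots> = ennreal (real (2 * m) ^ k / N * (\<Sum>l<N. 1 + C / c))"
        using C(1) \<open>0 < c\<close>
        by (subst sum_ennreal, simp, subst ennreal_mult[symmetric]) (auto intro!: sum_nonneg add_nonneg_nonneg)
      also have "real (2 * m) ^ k / N * (\<Sum>l<N. 1 + C / c) = real (2 * m) ^ k * (1 + C / c)"
        using N(1) by simp
      finally show ?thesis .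
    qed
    ultimately show "\<exists>\<Theta>. \<Theta> \<in> borel_measurable M \<and> (\<forall>\<omega>. 1 \<le> \<Theta> \<omega>) \<and>
      (AE \<omega> in M. \<forall>u. real n * (norm u)\<^sup>2 \<le> \<Theta> \<omega> * (\<Sum>i\<in>{2..n}. (X i \<omega> \<bullet> u)\<^sup>2)) \<and>
      (\<integral>\<^sup>+\<omega>. ennreal (\<Theta> \<omega> ^ k) \<partial>M) \<le> ennreal (real (2 * m) ^ k * (1 + C / c))"
      by (intro exI[of _ \<Theta>] conjI allI)
  qed
qed

end

section \<open>Conditional expectations and variances\<close>

context prob_space begin

text \<open>Independence is stated as an identity of product measures because the test point and a
  sample have different types.\<close>

lemma distr_pair_restrict:
  assumes indep: "indep_vars M' X UNIV" and "A \<inter> B = {}"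
    and f: "f \<in> PiM A M' \<rightarrow>\<^sub>M N1" and g: "g \<in> PiM B M' \<rightarrow>\<^sub>M N2"
  shows "distr M N1 (\<lambda>\<omega>. f (restrict (\<lambda>i. X i \<omega>) A)) \<Otimes>\<^sub>M distr M N2 (\<lambda>\<omega>. g (restrict (\<lambda>i. X i \<omega>) B)) =
    distr M (N1 \<Otimes>\<^sub>M N2) (\<lambda>\<omega>. (f (restrict (\<lambda>i. X i \<omega>) A), g (restrict (\<lambda>i. X i \<omega>) B)))"
proof -
  let ?U = "\<lambda>\<omega>. restrict (\<lambda>i. X i \<omega>) A" and ?V = "\<lambda>\<omega>. restrict (\<lambda>i. X i \<omega>) B"
  have U: "?U \<in> M \<rightarrow>\<^sub>M PiM A M'" and V: "?V \<in> M \<rightarrow>\<^sub>M PiM B M'"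
    and joint: "distr M (PiM A M') ?U \<Otimes>\<^sub>M distr M (PiM B M') ?V = distr M (PiM A M' \<Otimes>\<^sub>M PiM B M') (\<lambda>\<omega>. (?U \<omega>, ?V \<omega>))"
    using indep_var_restrict[OF indep \<open>A \<inter> B = {}\<close>] unfolding indep_var_distribution_eq by auto
  note [measurable] = f g U V
  have fU: "distr M N1 (\<lambda>\<omega>. f (?U \<omega>)) = distr (distr M (PiM A M') ?U) N1 f"
    and gV: "distr M N2 (\<lambda>\<omega>. g (?V \<omega>)) = distr (distr M (PiM B M') ?V) N2 g"
    by (simp_all add: distr_distr comp_def)
  have "sigma_finite_measure (distr (distr M (PiM B M') ?V) N2 g)"
    unfolding gV[symmetric] by (intro prob_space_imp_sigma_finite prob_space_distr) measurable
  then show ?thesis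
    unfolding fU gV
    by (subst pair_measure_distr) (auto simp: joint distr_distr comp_def)
qed

text \<open>The freezing lemma: conditionally on \<open>Y\<close>, an independent \<open>X\<close>
  is integrated out with \<open>Y\<close> held fixed. The events of the generated algebra are
  preimages under \<open>Y\<close>, so the defining identity becomes an iterated integral over the
  product of the two laws.\<close>

lemma real_cond_exp_indep:
  fixes X :: "'a \<Rightarrow> 'b" and Y :: "'a \<Rightarrow> 'c" and h :: "'b \<Rightarrow> 'c \<Rightarrow> real"
  assumes joint: "distr M N1 X \<Otimes>\<^sub>M distr M N2 Y = distr M (N1 \<Otimes>\<^sub>M N2) (\<lambda>\<omega>. (X \<omega>, Y \<omega>))"
    and [measurable]: "X \<in> M \<rightarrow>\<^sub>M N1" "Y \<in> M \<rightarrow>\<^sub>M N2" "case_prod h \<in> borel_measurable (N1 \<Otimes>\<^sub>M N2)"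
    and int: "integrable M (\<lambda>\<omega>. h (X \<omega>) (Y \<omega>))"
  shows "AE \<omega> in M. real_cond_exp M (vimage_algebra (space M) Y N2) (\<lambda>\<omega>. h (X \<omega>) (Y \<omega>)) \<omega>
    = (\<integral>\<omega>'. h (X \<omega>') (Y \<omega>) \<partial>M)"
proof -
  define P where "P = distr M N1 X"
  define Q where "Q = distr M N2 Y"
  interpret P: prob_space P unfolding P_def by (intro prob_space_distr) measurable
  interpret Q: prob_space Q unfolding Q_def by (intro prob_space_distr) measurable
  interpret PQ: pair_prob_space P Q ..
  have [measurable_cong, simp]: "sets P = sets N1" "sets Q = sets N2" by (simp_all add: P_def Q_def)
  define g where "g y = (\<integral>x. h x y \<partial>P)" for y
  have [measurable]: "g \<in> borel_measurable N2" unfolding g_def by measurable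
  have g_eq: "(\<integral>\<omega>'. h (X \<omega>') (Y \<omega>) \<partial>M) = g (Y \<omega>)" if "\<omega> \<in> space M" for \<omega>
  proof -
    have "Y \<omega> \<in> space N2" using that by (rule measurable_space[rotated]) measurable
    then have "(\<lambda>x. h x (Y \<omega>)) \<in> borel_measurable N1" by measurable
    then show ?thesis unfolding g_def P_def by (subst integral_distr) auto
  qed
  have int_joint: "integrable (P \<Otimes>\<^sub>M Q) (case_prod h)"
    unfolding P_def Q_def joint using int by (subst integrable_distr_eq) (auto simp: case_prod_beta)
  define F where "F = vimage_algebra (space M) Y N2"
  have Y_space: "Y \<in> space M \<rightarrow> space N2" by (auto intro: measurable_space[of Y M N2])
  have sets_F: "sets F = {Y -` B \<inter> space M |B. B \<in> sets N2}"
    unfolding F_def by (rule sets_vimage_algebra2[OF Y_space])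
  have sub: "subalgebra M F"
    unfolding subalgebra_def sets_F by (auto simp: F_def intro!: measurable_sets[of Y M N2])
  interpret fin: finite_measure_subalgebra M F
    by (intro finite_measure_subalgebra.intro finite_measure_subalgebra_axioms.intro sub finite_measure_axioms)
  have "AE \<omega> in M. real_cond_exp M F (\<lambda>\<omega>. h (X \<omega>) (Y \<omega>)) \<omega> = g (Y \<omega>)"
  proof (rule fin.real_cond_exp_charact[OF _ int])
    show "integrable M (\<lambda>\<omega>. g (Y \<omega>))"
    proof -
      have "integrable Q g" unfolding g_def by (rule PQ.integrable_snd[OF int_joint])
      then show ?thesis unfolding Q_def by (simp add: integrable_distr_eq)
    qed
    have "Y \<in> F \<rightarrow>\<^sub>M N2"
      unfolding F_def by (rule measurable_vimage_algebra1[OF Y_space])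
    then show "(\<lambda>\<omega>. g (Y \<omega>)) \<in> borel_measurable F" by measurable
    fix A assume "A \<in> sets F"
    then obtain B where B[measurable]: "B \<in> sets N2" and A: "A = Y -` B \<inter> space M"
      unfolding sets_F by auto
    have "(\<integral>\<omega>\<in>A. h (X \<omega>) (Y \<omega>) \<partial>M) = (\<integral>\<omega>. indicator B (Y \<omega>) * h (X \<omega>) (Y \<omega>) \<partial>M)"
      unfolding set_lebesgue_integral_def by (intro Bochner_Integration.integral_cong) (auto simp: A indicator_def)
    also have "\<dots> = (\<integral>(x, y). indicator B y * h x y \<partial>(P \<Otimes>\<^sub>M Q))"
      unfolding P_def Q_def joint by (subst integral_distr) (auto simp: case_prod_beta)
    also have "\<dots> = (\<integral>y. (\<integral>x. indicator B y * h x y \<partial>P) \<partial>Q)"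
    proof (rule PQ.integral_snd[symmetric])
      show "integrable (P \<Otimes>\<^sub>M Q) (\<lambda>(x, y). indicator B y * h x y)"
        by (rule Bochner_Integration.integrable_bound[OF int_joint])
          (auto simp: case_prod_beta indicator_def)
    qed
    also have "\<dots> = (\<integral>y. indicator B y * g y \<partial>Q)" by (simp add: g_def)
    also have "\<dots> = (\<integral>\<omega>. indicator B (Y \<omega>) * g (Y \<omega>) \<partial>M)"
      unfolding Q_def by (subst integral_distr) auto
    also have "\<dots> = (\<integral>\<omega>\<in>A. g (Y \<omega>) \<partial>M)"
      unfolding set_lebesgue_integral_def by (intro Bochner_Integration.integral_cong) (auto simp: A indicator_def)
    finally show "(\<integral>\<omega>\<in>A. h (X \<omega>) (Y \<omega>) \<partial>M) = (\<integral>\<omega>\<in>A. g (Y \<omega>) \<partial>M)" .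
  qed
  with AE_space show ?thesis
    unfolding F_def by eventually_elim (simp add: g_eq)
qed

text \<open>Expansion of the nonnegative mean square of \<open>V - m - \<phi>\<close>. If the
  covariance equals the variance of \<open>\<phi>\<close>, the bound is that variance.\<close>

lemma variance_ge_covariance:
  fixes V \<phi> :: "'a \<Rightarrow> real"
  assumes [measurable]: "V \<in> borel_measurable M" "\<phi> \<in> borel_measurable M"
    and V2: "integrable M (\<lambda>\<omega>. (V \<omega>)\<^sup>2)" and \<phi>2: "integrable M (\<lambda>\<omega>. (\<phi> \<omega>)\<^sup>2)" and mean: "expectation \<phi> = 0"
  shows "2 * expectation (\<lambda>\<omega>. V \<omega> * \<phi> \<omega>) - expectation (\<lambda>\<omega>. (\<phi> \<omega>)\<^sup>2) \<le> variance V"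
proof -
  have V: "integrable M V" by (rule square_integrable_imp_integrable[OF _ V2]) simp
  have \<phi>: "integrable M \<phi>" by (rule square_integrable_imp_integrable[OF _ \<phi>2]) simp
  have V\<phi>: "integrable M (\<lambda>\<omega>. V \<omega> * \<phi> \<omega>)"
  proof (rule Bochner_Integration.integrable_bound[OF Bochner_Integration.integrable_add[OF V2 \<phi>2]])
    show "AE \<omega> in M. norm (V \<omega> * \<phi> \<omega>) \<le> norm ((V \<omega>)\<^sup>2 + (\<phi> \<omega>)\<^sup>2)"
    proof (rule AE_I2)
      fix \<omega>
      have "0 \<le> (\<bar>V \<omega>\<bar> - \<bar>\<phi> \<omega>\<bar>)\<^sup>2" by simp
      then have "2 * (\<bar>V \<omega>\<bar> * \<bar>\<phi> \<omega>\<bar>) \<le> (V \<omega>)\<^sup>2 + (\<phi> \<omega>)\<^sup>2"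
        by (simp add: power2_diff mult_ac)
      moreover have "0 \<le> \<bar>V \<omega>\<bar> * \<bar>\<phi> \<omega>\<bar>" by simp
      ultimately have "\<bar>V \<omega>\<bar> * \<bar>\<phi> \<omega>\<bar> \<le> (V \<omega>)\<^sup>2 + (\<phi> \<omega>)\<^sup>2" by linarith
      then show "norm (V \<omega> * \<phi> \<omega>) \<le> norm ((V \<omega>)\<^sup>2 + (\<phi> \<omega>)\<^sup>2)"
        by (simp add: abs_mult)
    qed
  qed simp
  define m where "m = expectation V"
  have W: "integrable M (\<lambda>\<omega>. (V \<omega> - m)\<^sup>2)"
    using V V2 by (simp add: power2_diff)
  have prod: "expectation (\<lambda>\<omega>. (V \<omega> - m) * \<phi> \<omega>) = expectation (\<lambda>\<omega>. V \<omega> * \<phi> \<omega>)"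
    using V\<phi> \<phi> mean by (simp add: left_diff_distrib)
  have "0 \<le> expectation (\<lambda>\<omega>. (V \<omega> - m - \<phi> \<omega>)\<^sup>2)" by simp
  also have "\<dots> = expectation (\<lambda>\<omega>. (V \<omega> - m)\<^sup>2 - 2 * ((V \<omega> - m) * \<phi> \<omega>) + (\<phi> \<omega>)\<^sup>2)"
    by (intro Bochner_Integration.integral_cong refl) (simp add: power2_eq_square algebra_simps)
  also have "\<dots> = expectation (\<lambda>\<omega>. (V \<omega> - m)\<^sup>2) - 2 * expectation (\<lambda>\<omega>. (V \<omega> - m) * \<phi> \<omega>) + expectation (\<lambda>\<omega>. (\<phi> \<omega>)\<^sup>2)"
    using W V\<phi> \<phi> \<phi>2 by (simp add: left_diff_distrib)
  finally show ?thesis unfolding prod by (simp add: m_def)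
qed

end

section \<open>Test loss in the Gaussian linear model\<close>

lemma measurable_fst_borel[measurable]:
  "fst \<in> borel_measurable (borel :: ('a::second_countable_topology \<times> 'b::second_countable_topology) measure)"
  unfolding borel_prod[symmetric] by (rule measurable_fst)

lemma measurable_snd_borel[measurable]:
  "snd \<in> borel_measurable (borel :: ('a::second_countable_topology \<times> 'b::second_countable_topology) measure)"
  unfolding borel_prod[symmetric] by (rule measurable_snd)

lemma measurable_squared_loss:
  fixes bh :: "(nat \<Rightarrow> (real ^ 'p) \<times> real) \<Rightarrow> real ^ 'p"
  assumes [measurable]: "bh \<in> borel_measurable D"
  shows "case_prod (squared_loss bh) \<in> borel_measurable (borel \<Otimes>\<^sub>M D)"
  unfolding squared_loss_def case_prod_beta by measurable

lemma add_power_le: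
  fixes a b :: real
  assumes "0 \<le> a" "0 \<le> b"
  shows "(a + b) ^ k \<le> 2 ^ k * (a ^ k + b ^ k)"
proof -
  have "(a + b) ^ k \<le> (2 * max a b) ^ k" using assms by (intro power_mono) auto
  also have "\<dots> = 2 ^ k * max a b ^ k" by (rule power_mult_distrib)
  also have "\<dots> \<le> 2 ^ k * (a ^ k + b ^ k)"
    using assms by (intro mult_left_mono) (auto simp: max_def)
  finally show ?thesis .
qed

text \<open>A crude substitute for Hoelder's inequality: it reduces the mean of a product of four
  dependent factors to their fourth moments.\<close>

lemma prod4_le_sum_power4:
  fixes a b c d :: real
  shows "a * b * c * d \<le> a ^ 4 + b ^ 4 + c ^ 4 + d ^ 4"
proof -
  have le: "x * y \<le> x\<^sup>2 + y\<^sup>2" for x y :: real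
  proof -
    have "0 \<le> (x - y)\<^sup>2" by simp
    then have "2 * (x * y) \<le> x\<^sup>2 + y\<^sup>2" by (simp add: power2_diff mult_ac)
    moreover have "0 \<le> x\<^sup>2 + y\<^sup>2" by simp
    ultimately show ?thesis by linarith
  qed
  have "a * b * c * d = (a * b) * (c * d)" by simp
  also have "\<dots> \<le> (a * b)\<^sup>2 + (c * d)\<^sup>2" by (rule le)
  also have "\<dots> = a\<^sup>2 * b\<^sup>2 + c\<^sup>2 * d\<^sup>2" by (simp add: power_mult_distrib)
  also have "\<dots> \<le> ((a\<^sup>2)\<^sup>2 + (b\<^sup>2)\<^sup>2) + ((c\<^sup>2)\<^sup>2 + (d\<^sup>2)\<^sup>2)" by (intro add_mono le)
  finally show ?thesis by simp
qed

section \<open>Samples, and their independence of the test point\<close>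

context gaussian_linear_model begin

definition observation :: "nat option \<Rightarrow> 'a \<Rightarrow> (real ^ 'p) \<times> real" where
  "observation = case_option Z1' Z"

text \<open>\<open>\<sigma>\<close> tells which observation stands at which place, so that
  \<open>Some\<close> gives the training set and \<open>Some(1 := None)\<close> the exchanged one,
  and each fact is proved for both at once.\<close>

definition sample :: "(nat \<Rightarrow> nat option) \<Rightarrow> nat \<Rightarrow> 'a \<Rightarrow> nat \<Rightarrow> (real ^ 'p) \<times> real" where
  "sample \<sigma> n \<omega> = (\<lambda>i\<in>{1..n}. observation (\<sigma> i) \<omega>)"

lemma observation_Some[simp]: "observation (Some i) = Z i" and observation_None[simp]: "observation None = Z1'"
  by (auto simp: observation_def)

lemma training_set_sample: "training_set Z n = sample Some n"
  by (auto simp: training_set_def sample_def fun_eq_iff)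

lemma training_set_copy_sample: "training_set (Z(1 := Z1')) n = sample (Some(1 := None)) n"
  by (auto simp: training_set_def sample_def fun_eq_iff)

lemma measurable_observation[measurable]: "observation j \<in> borel_measurable M"
  using indep_Z by (auto simp: indep_vars_def observation_def)

lemma measurable_Z[measurable]: "Z i \<in> borel_measurable M"
  using measurable_observation[of "Some i"] by simp

lemma measurable_Z1'[measurable]: "Z1' \<in> borel_measurable M"
  using measurable_observation[of None] by simp

lemma measurable_eps[measurable]: "\<epsilon> i \<in> borel_measurable M"
  using distributed_measurable[OF distr_eps] by simp

lemma measurable_sample[measurable]: "sample \<sigma> n \<in> M \<rightarrow>\<^sub>M (\<Pi>\<^sub>M i\<in>{1..n}. borel)"
  unfolding sample_def by measurable

lemma indep_X: "indep_vars (\<lambda>_. borel) (\<lambda>i \<omega>. fst (Z i \<omega>)) UNIV"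
proof -
  \<comment> \<open>Restriction to singletons changes the index type from \<open>nat option\<close>
    to \<open>nat\<close> and drops the copy.\<close>
  have "indep_vars (\<lambda>j. PiM {Some j} (\<lambda>_. borel)) (\<lambda>j \<omega>. restrict (\<lambda>i. observation i \<omega>) {Some j}) UNIV"
    unfolding observation_def by (rule indep_vars_restrict[OF indep_Z]) (auto simp: disjoint_family_on_def)
  then have "indep_vars (\<lambda>_. borel) (\<lambda>j \<omega>. fst (restrict (\<lambda>i. observation i \<omega>) {Some j} (Some j))) UNIV"
    by (rule indep_vars_compose2) measurable
  then show ?thesis by simp
qed

text \<open>Both orders are stated because the freezing lemma conditions on the second component: on
  the sample for stability, on the test point for the variance.\<close>

lemma distr_test_point_sample:
  assumes "Some 0 \<notin> \<sigma> ` {1..n}"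
  shows "distr M borel (Z 0) \<Otimes>\<^sub>M distr M (\<Pi>\<^sub>M i\<in>{1..n}. borel) (sample \<sigma> n) =
      distr M (borel \<Otimes>\<^sub>M (\<Pi>\<^sub>M i\<in>{1..n}. borel)) (\<lambda>\<omega>. (Z 0 \<omega>, sample \<sigma> n \<omega>))" (is ?A)
    and "distr M (\<Pi>\<^sub>M i\<in>{1..n}. borel) (sample \<sigma> n) \<Otimes>\<^sub>M distr M borel (Z 0) =
      distr M ((\<Pi>\<^sub>M i\<in>{1..n}. borel) \<Otimes>\<^sub>M borel) (\<lambda>\<omega>. (sample \<sigma> n \<omega>, Z 0 \<omega>))" (is ?B)
proof -
  define f where "f w = w (Some 0)" for w :: "nat option \<Rightarrow> (real ^ 'p) \<times> real"
  define g where "g w = (\<lambda>i\<in>{1..n}. w (\<sigma> i))" for w :: "nat option \<Rightarrow> (real ^ 'p) \<times> real"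
  have f: "f \<in> PiM {Some 0} (\<lambda>_. borel) \<rightarrow>\<^sub>M borel" unfolding f_def by measurable
  have g: "g \<in> PiM (\<sigma> ` {1..n}) (\<lambda>_. borel) \<rightarrow>\<^sub>M (\<Pi>\<^sub>M i\<in>{1..n}. borel)"
    unfolding g_def by (intro measurable_restrict measurable_component_singleton) auto
  have Z0: "f (restrict (\<lambda>i. observation i \<omega>) {Some 0}) = Z 0 \<omega>" for \<omega> by (simp add: f_def)
  have S: "g (restrict (\<lambda>i. observation i \<omega>) (\<sigma> ` {1..n})) = sample \<sigma> n \<omega>" for \<omega>
    by (auto simp: g_def sample_def fun_eq_iff)
  have ind: "indep_vars (\<lambda>_. borel) observation UNIV" using indep_Z by (simp add: observation_def)
  have "{Some 0} \<inter> \<sigma> ` {1..n} = {}" "\<sigma> ` {1..n} \<inter> {Some 0} = {}" using assms by auto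
  from distr_pair_restrict[OF ind this(1) f g] distr_pair_restrict[OF ind this(2) g f]
  show ?A ?B unfolding Z0 S by auto
qed

lemma cond_expectation_sample:
  assumes bh: "bh \<in> borel_measurable (\<Pi>\<^sub>M i\<in>{1..n}. borel)" and \<sigma>: "Some 0 \<notin> \<sigma> ` {1..n}"
    and int: "integrable M (\<lambda>\<omega>. squared_loss bh (Z 0 \<omega>) (sample \<sigma> n \<omega>))"
  shows "AE \<omega> in M. cond_expectation M (\<Pi>\<^sub>M i\<in>{1..n}. borel) (sample \<sigma> n)
      (\<lambda>\<omega>. squared_loss bh (Z 0 \<omega>) (sample \<sigma> n \<omega>)) \<omega>
    = (\<integral>\<omega>'. (snd (Z 0 \<omega>') - fst (Z 0 \<omega>') \<bullet> bh (sample \<sigma> n \<omega>))\<^sup>2 \<partial>M)"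
  using real_cond_exp_indep[where X = "Z 0" and Y = "sample \<sigma> n" and h = "squared_loss bh",
      OF distr_test_point_sample(1)[OF \<sigma>] measurable_Z measurable_sample measurable_squared_loss[OF bh] int]
  unfolding cond_expectation_def squared_loss_def .

lemma cond_expectation_test_point:
  assumes [measurable]: "bh \<in> borel_measurable (\<Pi>\<^sub>M i\<in>{1..n}. borel)" and \<sigma>: "Some 0 \<notin> \<sigma> ` {1..n}"
    and int: "integrable M (\<lambda>\<omega>. squared_loss bh (Z 0 \<omega>) (sample \<sigma> n \<omega>))"
  shows "AE \<omega> in M. cond_expectation M borel (Z 0)
      (\<lambda>\<omega>. squared_loss bh (Z 0 \<omega>) (sample \<sigma> n \<omega>)) \<omega>
    = (\<integral>\<omega>'. (snd (Z 0 \<omega>) - fst (Z 0 \<omega>) \<bullet> bh (sample \<sigma> n \<omega>'))\<^sup>2 \<partial>M)"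
proof -
  have "(\<lambda>(s, z). squared_loss bh z s) \<in> borel_measurable ((\<Pi>\<^sub>M i\<in>{1..n}. borel) \<Otimes>\<^sub>M borel)"
    unfolding squared_loss_def case_prod_beta by measurable
  from real_cond_exp_indep[where X = "sample \<sigma> n" and Y = "Z 0" and h = "\<lambda>s z. squared_loss bh z s",
      OF distr_test_point_sample(2)[OF \<sigma>] measurable_sample measurable_Z this int]
  show ?thesis unfolding cond_expectation_def squared_loss_def .
qed

text \<open>Borel functions generate smaller algebras, so independence is inherited; once both
  variables have the same range type it can be expressed by \<open>indep_var\<close>.\<close>

lemma indep_X_eps_compose:
  assumes [measurable]: "f \<in> borel_measurable borel" "g \<in> borel_measurable borel"
  shows "indep_var borel (\<lambda>\<omega>. f (fst (Z i \<omega>))) borel (\<lambda>\<omega>. g (\<epsilon> i \<omega>))"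
proof -
  have sub: "sets (vimage_algebra (space M) (\<lambda>\<omega>. k (V \<omega>)) borel) \<subseteq> sets (vimage_algebra (space M) V borel)"
    if k: "k \<in> borel_measurable borel" for V :: "'a \<Rightarrow> 'v::topological_space" and k :: "'v \<Rightarrow> 'w::topological_space"
  proof -
    have "(\<lambda>\<omega>. k (V \<omega>)) \<in> vimage_algebra (space M) V borel \<rightarrow>\<^sub>M borel"
      by (rule measurable_compose[OF measurable_vimage_algebra1 k]) simp
    then show ?thesis
      by (auto simp: sets_vimage_algebra2 dest: measurable_sets)
  qed
  have "indep_set (sets (vimage_algebra (space M) (\<lambda>\<omega>. f (fst (Z i \<omega>))) borel))
      (sets (vimage_algebra (space M) (\<lambda>\<omega>. g (\<epsilon> i \<omega>)) borel))"
    unfolding indep_set_def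
    by (rule indep_sets_mono_sets[OF indep_X_eps[of i, unfolded indep_set_def]])
      (use sub[OF assms(1), of "\<lambda>\<omega>. fst (Z i \<omega>)"] sub[OF assms(2), of "\<epsilon> i"] in \<open>auto split: bool.splits\<close>)
  then show ?thesis
    unfolding indep_var_eq sets_vimage_algebra by simp
qed

context
  assumes tau_pos: "0 < \<tau>"
begin

text \<open>By the linear model the weight is at most a multiple of \<open>1 + norm x\<close> plus
  the absolute noise. The copy has the law of \<open>Z 1\<close>, so one constant serves every
  observation.\<close>

lemma data_weight_moment:
  obtains C where "0 \<le> C" "\<And>j. (\<integral>\<^sup>+\<omega>. ennreal (data_weight (observation j \<omega>) ^ k) \<partial>M) \<le> ennreal C"
proof -
  obtain C1 where C1: "0 \<le> C1" "\<And>X. distributed M lborel X (std_normal_vec_density :: real ^ 'p \<Rightarrow> real) \<Longrightarrow>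
      (\<integral>\<^sup>+\<omega>. ennreal ((1 + norm (X \<omega>)) ^ k) \<partial>M) \<le> ennreal C1"
    using std_normal_vec_moment_bound[where k = k] by blast
  define C2 where "C2 = (\<integral>t. normal_density 0 \<tau> t * \<bar>t\<bar> ^ k \<partial>lborel)"
  have "0 \<le> C2" unfolding C2_def by (intro integral_nonneg_AE) auto
  define C where "C = 2 ^ k * ((1 + norm \<beta>) ^ k * C1 + C2)"
  have "0 \<le> C" using C1(1) \<open>0 \<le> C2\<close> by (simp add: C_def)
  have Z_bound: "(\<integral>\<^sup>+\<omega>. ennreal (data_weight (Z i \<omega>) ^ k) \<partial>M) \<le> ennreal C" for i
  proof -
    have "(\<integral>\<^sup>+\<omega>. ennreal (data_weight (Z i \<omega>) ^ k) \<partial>M) \<le>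
        (\<integral>\<^sup>+\<omega>. ennreal (2 ^ k) * (ennreal ((1 + norm \<beta>) ^ k) * ennreal ((1 + norm (fst (Z i \<omega>))) ^ k) + ennreal (\<bar>\<epsilon> i \<omega>\<bar> ^ k)) \<partial>M)"
    proof (rule nn_integral_mono)
      fix \<omega> assume "\<omega> \<in> space M"
      then have "snd (Z i \<omega>) = fst (Z i \<omega>) \<bullet> \<beta> + \<epsilon> i \<omega>" by (rule linear)
      then have "\<bar>snd (Z i \<omega>)\<bar> \<le> norm (fst (Z i \<omega>)) * norm \<beta> + \<bar>\<epsilon> i \<omega>\<bar>"
        using Cauchy_Schwarz_ineq2[of "fst (Z i \<omega>)" \<beta>] by linarith
      then have "data_weight (Z i \<omega>) \<le> (1 + norm \<beta>) * (1 + norm (fst (Z i \<omega>))) + \<bar>\<epsilon> i \<omega>\<bar>"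
        unfolding data_weight_def distrib_left distrib_right
        mult_1_left mult_1_right
        using norm_ge_zero[of \<beta>] by (simp only: mult.commute)
      then have "data_weight (Z i \<omega>) ^ k \<le> ((1 + norm \<beta>) * (1 + norm (fst (Z i \<omega>))) + \<bar>\<epsilon> i \<omega>\<bar>) ^ k"
        by (intro power_mono) (auto simp: data_weight_def)
      also have "\<dots> \<le> 2 ^ k * (((1 + norm \<beta>) * (1 + norm (fst (Z i \<omega>)))) ^ k + \<bar>\<epsilon> i \<omega>\<bar> ^ k)"
        by (rule add_power_le) auto
      finally have "data_weight (Z i \<omega>) ^ k \<le> 2 ^ k * ((1 + norm \<beta>) ^ k * (1 + norm (fst (Z i \<omega>))) ^ k + \<bar>\<epsilon> i \<omega>\<bar> ^ k)"
        by (simp only: power_mult_distrib)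
      then have "ennreal (data_weight (Z i \<omega>) ^ k) \<le>
          ennreal (2 ^ k * ((1 + norm \<beta>) ^ k * (1 + norm (fst (Z i \<omega>))) ^ k + \<bar>\<epsilon> i \<omega>\<bar> ^ k))"
        by (rule ennreal_leI)
      also have "\<dots> = ennreal (2 ^ k) * (ennreal ((1 + norm \<beta>) ^ k) * ennreal ((1 + norm (fst (Z i \<omega>))) ^ k) + ennreal (\<bar>\<epsilon> i \<omega>\<bar> ^ k))"
        by (subst ennreal_mult, simp, simp, subst ennreal_plus, simp, simp, subst ennreal_mult) auto
      finally show "ennreal (data_weight (Z i \<omega>) ^ k) \<le> ennreal (2 ^ k) * (ennreal ((1 + norm \<beta>) ^ k) * ennreal ((1 + norm (fst (Z i \<omega>))) ^ k) + ennreal (\<bar>\<epsilon> i \<omega>\<bar> ^ k))" .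
    qed
    also have "\<dots> = ennreal (2 ^ k) * (ennreal ((1 + norm \<beta>) ^ k) * (\<integral>\<^sup>+\<omega>. ennreal ((1 + norm (fst (Z i \<omega>))) ^ k) \<partial>M)
        + (\<integral>\<^sup>+\<omega>. ennreal (\<bar>\<epsilon> i \<omega>\<bar> ^ k) \<partial>M))"
      by (subst nn_integral_cmult, measurable, subst nn_integral_add, measurable, subst nn_integral_cmult, measurable)
    also have "\<dots> \<le> ennreal (2 ^ k) * (ennreal ((1 + norm \<beta>) ^ k) * ennreal C1 + ennreal C2)"
      using C1(2)[OF distr_X] normal_abs_moment[OF distr_eps tau_pos, of i k]
      unfolding C2_def[symmetric] by (intro mult_left_mono add_mono) auto
    also have "\<dots> = ennreal C"
      unfolding C_def using C1(1) \<open>0 \<le> C2\<close>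
      by (subst ennreal_mult, simp, simp, subst ennreal_plus, simp, simp, subst ennreal_mult) auto
    finally show ?thesis .
  qed
  have "(\<integral>\<^sup>+\<omega>. ennreal (data_weight (Z1' \<omega>) ^ k) \<partial>M) = (\<integral>\<^sup>+\<omega>. ennreal (data_weight (Z 1 \<omega>) ^ k) \<partial>M)"
  proof -
    have "(\<integral>\<^sup>+\<omega>. ennreal (data_weight (V \<omega>) ^ k) \<partial>M) = (\<integral>\<^sup>+z. ennreal (data_weight z ^ k) \<partial>distr M borel V)"
      if [measurable]: "V \<in> borel_measurable M" for V :: "'a \<Rightarrow> (real ^ 'p) \<times> real"
      by (rule nn_integral_distr[symmetric]) measurable
    from this[of Z1'] this[of "Z 1"] show ?thesis by (simp add: distr_copy)
  qed
  then have "(\<integral>\<^sup>+\<omega>. ennreal (data_weight (observation j \<omega>) ^ k) \<partial>M) \<le> ennreal C" for j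
    using Z_bound by (cases j) auto
  with \<open>0 \<le> C\<close> show thesis by (rule that)
qed

end
end

section \<open>Noise moments and the lower bound for the variance\<close>

context gaussian_linear_model begin

context
  assumes tau_pos: "0 < \<tau>"
begin

lemma eps_moments:
  "integrable M (\<lambda>\<omega>. \<epsilon> i \<omega> ^ k)"
  "expectation (\<epsilon> i) = 0" "expectation (\<lambda>\<omega>. (\<epsilon> i \<omega>)\<^sup>2) = \<tau>\<^sup>2"
  "expectation (\<lambda>\<omega>. \<epsilon> i \<omega> ^ 3) = 0" "expectation (\<lambda>\<omega>. \<epsilon> i \<omega> ^ 4) = 3 * \<tau> ^ 4"
proof -
  have expect: "expectation (\<lambda>\<omega>. \<epsilon> i \<omega> ^ k) = (\<integral>t. normal_density 0 \<tau> t * (t - 0) ^ k \<partial>lborel)" for k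
    using distributed_integral[OF distr_eps, of "\<lambda>t. t ^ k" i] by simp
  show "integrable M (\<lambda>\<omega>. \<epsilon> i \<omega> ^ k)"
    using distributed_integrable[OF distr_eps, of "\<lambda>t. t ^ k" i] integrable_normal_moment[OF tau_pos, of 0 k] by simp
  show "expectation (\<epsilon> i) = 0"
    using expect[of 1] integral_normal_moment_odd[OF tau_pos, of 0 0] by simp
  show "expectation (\<lambda>\<omega>. (\<epsilon> i \<omega>)\<^sup>2) = \<tau>\<^sup>2"
    using expect[of 2] integral_normal_moment_even[OF tau_pos, of 0 1] by simp
  show "expectation (\<lambda>\<omega>. \<epsilon> i \<omega> ^ 3) = 0"
    using expect[of 3] integral_normal_moment_odd[OF tau_pos, of 0 1] by simp
  have "fact 4 / ((2 / \<tau>\<^sup>2)\<^sup>2 * fact 2) = 3 * \<tau> ^ 4"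
    using tau_pos by (simp add: fact_numeral power_divide field_simps)
  then show "expectation (\<lambda>\<omega>. \<epsilon> i \<omega> ^ 4) = 3 * \<tau> ^ 4"
    using expect[of 4] integral_normal_moment_even[OF tau_pos, of 0 2] by simp
qed

lemma X_moment: "integrable M (\<lambda>\<omega>. norm (fst (Z i \<omega>)) ^ k)"
proof -
  obtain C where C: "0 \<le> C" "\<And>X. distributed M lborel X (std_normal_vec_density :: real ^ 'p \<Rightarrow> real) \<Longrightarrow>
      (\<integral>\<^sup>+\<omega>. ennreal ((1 + norm (X \<omega>)) ^ k) \<partial>M) \<le> ennreal C"
    using std_normal_vec_moment_bound[where k = k] by blast
  have "(\<integral>\<^sup>+\<omega>. ennreal (norm (fst (Z i \<omega>)) ^ k) \<partial>M) \<le> (\<integral>\<^sup>+\<omega>. ennreal ((1 + norm (fst (Z i \<omega>))) ^ k) \<partial>M)"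
    by (intro nn_integral_mono ennreal_leI power_mono) auto
  also have "\<dots> \<le> ennreal C" by (rule C(2)[OF distr_X])
  finally have "(\<integral>\<^sup>+\<omega>. ennreal (norm (fst (Z i \<omega>)) ^ k) \<partial>M) < \<infinity>"
    by (rule le_less_trans) simp
  then show ?thesis by (intro integrableI_nonneg) auto
qed

text \<open>The noise part \<open>\<epsilon> 0 ^ 2 - \<tau> ^ 2\<close> is uncorrelated with everything in \<open>E[H | Z 0]\<close> except \<open>\<epsilon> 0 ^ 2\<close>,
  so it contributes its full variance whatever the estimator is.\<close>

lemma sigma_squared_ge:
  assumes bh[measurable]: "bh \<in> borel_measurable (\<Pi>\<^sub>M i\<in>{1..n}. borel)"
    and bh2: "integrable M (\<lambda>\<omega>. (norm (bh (training_set Z n \<omega>)))\<^sup>2)"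
    and int: "integrable M (\<lambda>\<omega>. squared_loss bh (Z 0 \<omega>) (training_set Z n \<omega>))"
  shows "2 * \<tau> ^ 4 \<le> sigma_squared M Z n (squared_loss bh)"
proof -
  define S where "S = training_set Z n"
  have [measurable]: "S \<in> M \<rightarrow>\<^sub>M (\<Pi>\<^sub>M i\<in>{1..n}. borel)"
    unfolding S_def training_set_sample by (rule measurable_sample)
  define d where "d \<omega> = bh (S \<omega>) - \<beta>" for \<omega>
  have [measurable]: "d \<in> borel_measurable M" unfolding d_def by measurable
  have d2: "integrable M (\<lambda>\<omega>. (norm (d \<omega>))\<^sup>2)"
  proof (rule Bochner_Integration.integrable_bound)
    show "integrable M (\<lambda>\<omega>. 2\<^sup>2 * ((norm (bh (S \<omega>)))\<^sup>2 + (norm \<beta>)\<^sup>2))" using bh2 by (simp add: S_def)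
    show "AE \<omega> in M. norm ((norm (d \<omega>))\<^sup>2) \<le> norm (2\<^sup>2 * ((norm (bh (S \<omega>)))\<^sup>2 + (norm \<beta>)\<^sup>2))"
    proof (rule AE_I2)
      fix \<omega>
      have "(norm (d \<omega>))\<^sup>2 \<le> (norm (bh (S \<omega>)) + norm \<beta>)\<^sup>2"
        unfolding d_def by (intro power_mono norm_triangle_ineq4) auto
      also have "\<dots> \<le> 2\<^sup>2 * ((norm (bh (S \<omega>)))\<^sup>2 + (norm \<beta>)\<^sup>2)" by (rule add_power_le) auto
      finally show "norm ((norm (d \<omega>))\<^sup>2) \<le> norm (2\<^sup>2 * ((norm (bh (S \<omega>)))\<^sup>2 + (norm \<beta>)\<^sup>2))" by simp
    qed
  qed simp
  have d1: "integrable M (\<lambda>\<omega>. norm (d \<omega>))"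
    by (rule square_integrable_imp_integrable[OF _ d2]) simp
  define m1 where "m1 = expectation (\<lambda>\<omega>. norm (d \<omega>))"
  define m2 where "m2 = expectation (\<lambda>\<omega>. (norm (d \<omega>))\<^sup>2)"
  have m: "0 \<le> m1" "0 \<le> m2" by (auto simp: m1_def m2_def)
  have xd: "integrable M (\<lambda>\<omega>. x \<bullet> d \<omega>)" for x
    by (rule Bochner_Integration.integrable_bound[OF integrable_mult_right[OF d1, of "norm x"]])
      (auto simp: Cauchy_Schwarz_ineq2)
  have xd_sq: "(x \<bullet> d \<omega>)\<^sup>2 \<le> (norm x)\<^sup>2 * (norm (d \<omega>))\<^sup>2" for x \<omega>
    using power_mono[OF Cauchy_Schwarz_ineq2[of x "d \<omega>"], of 2] by (simp add: power_mult_distrib)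
  have xd2: "integrable M (\<lambda>\<omega>. (x \<bullet> d \<omega>)\<^sup>2)" for x
    by (rule Bochner_Integration.integrable_bound[OF integrable_mult_right[OF d2, of "(norm x)\<^sup>2"]])
      (auto simp: xd_sq)
  \<comment> \<open>The residual at the test point is \<open>e - X \<bullet> d\<close>. Averaging
    its square over the training data alone leaves two deterministic functions of the covariate, the
    linear part \<open>\<mu>\<close> and the quadratic part \<open>q\<close>.\<close>
  define \<mu> where "\<mu> x = expectation (\<lambda>\<omega>. x \<bullet> d \<omega>)" for x
  define q where "q x = expectation (\<lambda>\<omega>. (x \<bullet> d \<omega>)\<^sup>2)" for x
  have [measurable]: "\<mu> \<in> borel_measurable borel" "q \<in> borel_measurable borel"
    unfolding \<mu>_def q_def by measurable
  have \<mu>_le: "\<bar>\<mu> x\<bar> \<le> norm x * m1" for x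
  proof -
    have "\<bar>\<mu> x\<bar> \<le> expectation (\<lambda>\<omega>. \<bar>x \<bullet> d \<omega>\<bar>)" unfolding \<mu>_def by (rule integral_abs_bound)
    also have "\<dots> \<le> expectation (\<lambda>\<omega>. norm x * norm (d \<omega>))"
      using xd d1 by (intro integral_mono) (auto simp: Cauchy_Schwarz_ineq2)
    finally show ?thesis by (simp add: m1_def)
  qed
  have q_le: "0 \<le> q x" "q x \<le> (norm x)\<^sup>2 * m2" for x
  proof -
    show "0 \<le> q x" unfolding q_def by simp
    have "q x \<le> expectation (\<lambda>\<omega>. (norm x)\<^sup>2 * (norm (d \<omega>))\<^sup>2)"
      unfolding q_def using xd2 d2 by (intro integral_mono) (auto simp: xd_sq)
    then show "q x \<le> (norm x)\<^sup>2 * m2" by (simp add: m2_def)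
  qed
  define X where "X \<omega> = fst (Z 0 \<omega>)" for \<omega>
  define e where "e = \<epsilon> 0"
  have [measurable]: "X \<in> borel_measurable M" "e \<in> borel_measurable M" unfolding X_def e_def by measurable
  \<comment> \<open>An explicit version of the conditional expectation of the loss given the test
    point.\<close>
  define V where "V \<omega> = (e \<omega>)\<^sup>2 - 2 * (e \<omega> * \<mu> (X \<omega>)) + q (X \<omega>)" for \<omega>
  have [measurable]: "V \<in> borel_measurable M" unfolding V_def by measurable
  define \<phi> where "\<phi> \<omega> = (e \<omega>)\<^sup>2 - \<tau>\<^sup>2" for \<omega>
  have [measurable]: "\<phi> \<in> borel_measurable M" unfolding \<phi>_def by measurable
  note e_int = eps_moments(1)[of 0, folded e_def]
  note e_mom = eps_moments(2-5)[of 0, folded e_def]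
  note X_int = X_moment[of 0, folded X_def]

  have \<phi>2: "(\<lambda>\<omega>. (\<phi> \<omega>)\<^sup>2) = (\<lambda>\<omega>. e \<omega> ^ 4 - 2 * \<tau>\<^sup>2 * (e \<omega>)\<^sup>2 + \<tau> ^ 4)"
    by (simp add: fun_eq_iff \<phi>_def power2_eq_square power4_eq_xxxx algebra_simps)
  have \<phi>_int: "integrable M (\<lambda>\<omega>. (\<phi> \<omega>)\<^sup>2)" unfolding \<phi>2 using e_int by simp
  have \<phi>_mean: "expectation \<phi> = 0" unfolding \<phi>_def using e_int[of 2] e_mom(2) by (simp add: prob_space)
  have \<phi>_var: "expectation (\<lambda>\<omega>. (\<phi> \<omega>)\<^sup>2) = 2 * \<tau> ^ 4"
    unfolding \<phi>2 using e_int[of 2] e_int[of 4] e_mom by (simp add: prob_space power2_eq_square power4_eq_xxxx)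

  have V2: "integrable M (\<lambda>\<omega>. (V \<omega>)\<^sup>2)"
  proof (rule Bochner_Integration.integrable_bound)
    show "integrable M (\<lambda>\<omega>. 2\<^sup>2 * (4 * e \<omega> ^ 4 + (m1\<^sup>2 + m2)\<^sup>2 * norm (X \<omega>) ^ 4))"
      using e_int X_int by simp
    show "AE \<omega> in M. norm ((V \<omega>)\<^sup>2) \<le> norm (2\<^sup>2 * (4 * e \<omega> ^ 4 + (m1\<^sup>2 + m2)\<^sup>2 * norm (X \<omega>) ^ 4))"
    proof (rule AE_I2)
      fix \<omega>
      have "(\<mu> (X \<omega>))\<^sup>2 \<le> (norm (X \<omega>) * m1)\<^sup>2"
        using power_mono[OF \<mu>_le[of "X \<omega>"], of 2] by simp
      then have \<mu>2: "(\<mu> (X \<omega>))\<^sup>2 \<le> m1\<^sup>2 * (norm (X \<omega>))\<^sup>2" by (simp add: power_mult_distrib mult.commute)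
      have "0 \<le> (e \<omega> - \<mu> (X \<omega>))\<^sup>2" "0 \<le> (e \<omega> + \<mu> (X \<omega>))\<^sup>2" by simp_all
      then have cross: "2 * (e \<omega> * \<mu> (X \<omega>)) \<le> (e \<omega>)\<^sup>2 + (\<mu> (X \<omega>))\<^sup>2"
          "- (2 * (e \<omega> * \<mu> (X \<omega>))) \<le> (e \<omega>)\<^sup>2 + (\<mu> (X \<omega>))\<^sup>2"
        by (simp_all add: power2_diff power2_sum)
      have "q (X \<omega>) \<le> m2 * (norm (X \<omega>))\<^sup>2" using q_le(2)[of "X \<omega>"] by (simp add: mult.commute)
      moreover have "0 \<le> (e \<omega>)\<^sup>2" "0 \<le> q (X \<omega>)" using q_le(1) by auto
      ultimately have "\<bar>V \<omega>\<bar> \<le> 2 * (e \<omega>)\<^sup>2 + (m1\<^sup>2 + m2) * (norm (X \<omega>))\<^sup>2"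
        using \<mu>2 cross unfolding V_def abs_le_iff distrib_right by (intro conjI; linarith)
      then have "\<bar>V \<omega>\<bar>\<^sup>2 \<le> (2 * (e \<omega>)\<^sup>2 + (m1\<^sup>2 + m2) * (norm (X \<omega>))\<^sup>2)\<^sup>2" by (intro power_mono) auto
      also have "\<dots> \<le> 2\<^sup>2 * ((2 * (e \<omega>)\<^sup>2)\<^sup>2 + ((m1\<^sup>2 + m2) * (norm (X \<omega>))\<^sup>2)\<^sup>2)"
        using m by (intro add_power_le) auto
      also have "\<dots> = 2\<^sup>2 * (4 * e \<omega> ^ 4 + (m1\<^sup>2 + m2)\<^sup>2 * norm (X \<omega>) ^ 4)"
        by (simp add: power_mult_distrib power_mult[symmetric])
      finally show "norm ((V \<omega>)\<^sup>2) \<le> norm (2\<^sup>2 * (4 * e \<omega> ^ 4 + (m1\<^sup>2 + m2)\<^sup>2 * norm (X \<omega>) ^ 4))"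
        by simp
    qed
  qed simp

  \<comment> \<open>The cross term vanishes because \<open>e * \<phi>\<close> involves only odd
    moments of the noise and is independent of the covariate; the quadratic term vanishes because
    \<open>\<phi>\<close> has mean 0. The covariance is therefore the variance of
    \<open>\<phi>\<close>.\<close>
  have V\<phi>: "expectation (\<lambda>\<omega>. V \<omega> * \<phi> \<omega>) = 2 * \<tau> ^ 4"
  proof -
    have \<mu>_int: "integrable M (\<lambda>\<omega>. \<mu> (X \<omega>))"
      by (rule Bochner_Integration.integrable_bound[OF integrable_mult_left[OF X_int[of 1], of m1]])
        (use \<mu>_le m in \<open>auto simp: abs_mult\<close>)
    have q_int: "integrable M (\<lambda>\<omega>. q (X \<omega>))"
      by (rule Bochner_Integration.integrable_bound[OF integrable_mult_left[OF X_int[of 2], of m2]])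
        (use q_le m in \<open>auto simp: abs_mult\<close>)
    have e\<phi>: "(\<lambda>\<omega>. e \<omega> * \<phi> \<omega>) = (\<lambda>\<omega>. e \<omega> ^ 3 - \<tau>\<^sup>2 * e \<omega>)"
      by (simp add: fun_eq_iff \<phi>_def power2_eq_square power3_eq_cube algebra_simps)
    have e\<phi>_int: "integrable M (\<lambda>\<omega>. e \<omega> * \<phi> \<omega>)" unfolding e\<phi> using e_int[of 3] e_int[of 1] by simp
    have e\<phi>_mean: "expectation (\<lambda>\<omega>. e \<omega> * \<phi> \<omega>) = 0"
      unfolding e\<phi> using e_int[of 3] e_int[of 1] e_mom by simp
    have \<phi>_int1: "integrable M \<phi>" unfolding \<phi>_def using e_int by simp
    have "indep_var borel (\<lambda>\<omega>. \<mu> (X \<omega>)) borel (\<lambda>\<omega>. e \<omega> * \<phi> \<omega>)"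
      unfolding X_def e_def \<phi>_def by (rule indep_X_eps_compose) measurable
    note cross = indep_var_lebesgue_integral[OF this \<mu>_int e\<phi>_int] indep_var_integrable[OF this \<mu>_int e\<phi>_int]
    have "indep_var borel (\<lambda>\<omega>. q (X \<omega>)) borel \<phi>"
      unfolding X_def e_def \<phi>_def by (rule indep_X_eps_compose) measurable
    note quad = indep_var_lebesgue_integral[OF this q_int \<phi>_int1] indep_var_integrable[OF this q_int \<phi>_int1]
    have "(\<lambda>\<omega>. V \<omega> * \<phi> \<omega>) =
        (\<lambda>\<omega>. (e \<omega> ^ 4 - \<tau>\<^sup>2 * (e \<omega>)\<^sup>2) - 2 * (\<mu> (X \<omega>) * (e \<omega> * \<phi> \<omega>)) + q (X \<omega>) * \<phi> \<omega>)"
      by (simp add: fun_eq_iff V_def \<phi>_def power2_eq_square power4_eq_xxxx algebra_simps)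
    then show ?thesis
      using cross quad e_int[of 4] e_int[of 2] e_mom \<phi>_mean e\<phi>_mean
      by (simp add: power2_eq_square power4_eq_xxxx)
  qed

  define C where "C = cond_expectation M borel (Z 0) (\<lambda>\<omega>. squared_loss bh (Z 0 \<omega>) (S \<omega>))"
  have [measurable]: "C \<in> borel_measurable M" unfolding C_def cond_expectation_def by measurable
  have "AE \<omega> in M. C \<omega> = (\<integral>\<omega>'. (snd (Z 0 \<omega>) - fst (Z 0 \<omega>) \<bullet> bh (S \<omega>'))\<^sup>2 \<partial>M)"
    unfolding C_def S_def training_set_sample
    by (rule cond_expectation_test_point[OF bh _ int[unfolded training_set_sample]]) auto
  with AE_space have CV: "AE \<omega> in M. C \<omega> = V \<omega>"
  proof eventually_elim
    fix \<omega> assume \<omega>: "\<omega> \<in> space M" and C: "C \<omega> = (\<integral>\<omega>'. (snd (Z 0 \<omega>) - fst (Z 0 \<omega>) \<bullet> bh (S \<omega>'))\<^sup>2 \<partial>M)"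
    have residual: "snd (Z 0 \<omega>) - fst (Z 0 \<omega>) \<bullet> bh (S \<omega>') = e \<omega> - X \<omega> \<bullet> d \<omega>'" for \<omega>'
      using linear[OF \<omega>, of 0] by (simp add: d_def X_def e_def inner_diff_right)
    have "C \<omega> = (\<integral>\<omega>'. (e \<omega>)\<^sup>2 - 2 * e \<omega> * (X \<omega> \<bullet> d \<omega>') + (X \<omega> \<bullet> d \<omega>')\<^sup>2 \<partial>M)"
      unfolding C residual
      by (intro Bochner_Integration.integral_cong refl) (simp add: power2_eq_square algebra_simps)
    also have "\<dots> = V \<omega>"
      using xd xd2 by (simp add: V_def \<mu>_def q_def prob_space)
    finally show "C \<omega> = V \<omega>" .
  qed
  have mean: "expectation C = expectation V" using CV by (intro integral_cong_AE) auto
  have "2 * \<tau> ^ 4 \<le> variance V"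
    using variance_ge_covariance[OF _ _ V2 \<phi>_int \<phi>_mean] V\<phi> \<phi>_var by simp
  also have "variance V = variance C"
    unfolding mean using CV by (intro integral_cong_AE) auto
  also have "\<dots> = sigma_squared M Z n (squared_loss bh)"
    by (simp add: sigma_squared_def C_def S_def)
  finally show ?thesis .
qed

end
end

section \<open>Domination of the stability\<close>

context gaussian_linear_model begin

text \<open>Evaluated at the estimator, this is the conditional expectation of the test loss given
  the training set, which loss stability subtracts.\<close>

definition risk :: "real ^ 'p \<Rightarrow> real" where
  "risk b = expectation (\<lambda>\<omega>. (snd (Z 0 \<omega>) - fst (Z 0 \<omega>) \<bullet> b)\<^sup>2)"

context
  assumes tau_pos: "0 < \<tau>"
begin

lemma data_weight_integrable: "integrable M (\<lambda>\<omega>. data_weight (Z i \<omega>) ^ k)"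
proof -
  obtain C where "0 \<le> C" "\<And>j. (\<integral>\<^sup>+\<omega>. ennreal (data_weight (observation j \<omega>) ^ k) \<partial>M) \<le> ennreal C"
    using data_weight_moment[OF tau_pos, where k = k] by blast
  from this(2)[of "Some i"] have "(\<integral>\<^sup>+\<omega>. ennreal (data_weight (Z i \<omega>) ^ k) \<partial>M) < \<infinity>"
    by (auto simp: le_less_trans)
  then show ?thesis
    by (intro integrableI_nonneg) (auto simp: data_weight_def)
qed

lemma risk_diff:
  assumes R: "norm b \<le> R" "norm b' \<le> R" "1 \<le> R"
  shows "\<bar>risk b - risk b'\<bar> \<le> 2 * R * norm (b' - b) * expectation (\<lambda>\<omega>. (data_weight (Z 0 \<omega>))\<^sup>2)"
proof -
  have int: "integrable M (\<lambda>\<omega>. (snd (Z 0 \<omega>) - fst (Z 0 \<omega>) \<bullet> a)\<^sup>2)" if "norm a \<le> R" for a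
    by (rule Bochner_Integration.integrable_bound[OF integrable_mult_right[OF data_weight_integrable[of 0 2], of "R\<^sup>2"]])
      (use squared_error_le[OF that R(3)] in auto)
  have "\<bar>risk b - risk b'\<bar> = \<bar>expectation (\<lambda>\<omega>. (snd (Z 0 \<omega>) - fst (Z 0 \<omega>) \<bullet> b)\<^sup>2 - (snd (Z 0 \<omega>) - fst (Z 0 \<omega>) \<bullet> b')\<^sup>2)\<bar>"
    unfolding risk_def using int[OF R(1)] int[OF R(2)] by simp
  also have "\<dots> \<le> expectation (\<lambda>\<omega>. \<bar>(snd (Z 0 \<omega>) - fst (Z 0 \<omega>) \<bullet> b)\<^sup>2 - (snd (Z 0 \<omega>) - fst (Z 0 \<omega>) \<bullet> b')\<^sup>2\<bar>)"
    by (rule integral_abs_bound)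
  also have "\<dots> \<le> expectation (\<lambda>\<omega>. 2 * R * norm (b' - b) * (data_weight (Z 0 \<omega>))\<^sup>2)"
    using int[OF R(1)] int[OF R(2)] data_weight_integrable[of 0 2]
    by (intro integral_mono squared_error_diff[OF R]) auto
  finally show ?thesis by simp
qed

text \<open>One variable \<open>Q\<close> dominates all that is integrated later: the estimator and
  the losses, for integrability, and the squared increment, for the rate. \<open>Q\<close> varies
  with \<open>n\<close>, but its expectation stays below one \<open>K\<close>.\<close>

lemma lasso_domination:
  assumes est: "\<And>n. n \<ge> CARD('p) \<Longrightarrow> lasso_estimator n (lam n) (bhat n)"
    and lam: "\<And>n. n \<ge> 1 \<Longrightarrow> lam n > 0"
  obtains K n0 where "0 \<le> K" "CARD('p) \<le> n0" "\<And>n. n0 < n \<Longrightarrow>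
    \<exists>Q. Q \<in> borel_measurable M \<and> (\<integral>\<^sup>+\<omega>. ennreal (Q \<omega>) \<partial>M) \<le> ennreal K \<and>
      (AE \<omega> in M. 0 \<le> Q \<omega> \<and>
        (norm (bhat n (sample Some n \<omega>)))\<^sup>2 \<le> 4 * Q \<omega> \<and>
        squared_loss (bhat n) (Z 0 \<omega>) (sample Some n \<omega>) \<le> 4 * Q \<omega> \<and>
        squared_loss (bhat n) (Z 0 \<omega>) (sample (Some(1 := None)) n \<omega>) \<le> 4 * Q \<omega> \<and>
        (squared_loss (bhat n) (Z 0 \<omega>) (sample Some n \<omega>) - risk (bhat n (sample Some n \<omega>))
          - (squared_loss (bhat n) (Z 0 \<omega>) (sample (Some(1 := None)) n \<omega>)
             - risk (bhat n (sample (Some(1 := None)) n \<omega>))))\<^sup>2 \<le> 576 / (real n)\<^sup>2 * Q \<omega>)"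
proof -
  \<comment> \<open>\<open>Q\<close> will contain the sixth power of \<open>\<Theta>\<close>, and
    the separation of its four factors raises this to the fourth power. The moments 16 and 32 of the
    weights arise in the same way.\<close>
  obtain C\<Theta> where C\<Theta>: "0 \<le> C\<Theta>" "\<And>n. 4 * (CARD('p) + 2 * 24) < n \<Longrightarrow>
    \<exists>\<Theta>. \<Theta> \<in> borel_measurable M \<and> (\<forall>\<omega>. 1 \<le> \<Theta> \<omega>) \<and>
      (AE \<omega> in M. \<forall>u. real n * (norm u)\<^sup>2 \<le> \<Theta> \<omega> * (\<Sum>i\<in>{2..n}. (fst (Z i \<omega>) \<bullet> u)\<^sup>2)) \<and>
      (\<integral>\<^sup>+\<omega>. ennreal (\<Theta> \<omega> ^ 24) \<partial>M) \<le> ennreal C\<Theta>"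
    by (rule gram_matrix_inverse_moment[OF indep_X distr_X, of 24]) auto
  obtain C16 where C16: "0 \<le> C16" "\<And>j. (\<integral>\<^sup>+\<omega>. ennreal (data_weight (observation j \<omega>) ^ 16) \<partial>M) \<le> ennreal C16"
    using data_weight_moment[OF tau_pos, where k = 16] by blast
  obtain C32 where C32: "0 \<le> C32" "\<And>j. (\<integral>\<^sup>+\<omega>. ennreal (data_weight (observation j \<omega>) ^ 32) \<partial>M) \<le> ennreal C32"
    using data_weight_moment[OF tau_pos, where k = 32] by blast
  define c2 where "c2 = expectation (\<lambda>\<omega>. (data_weight (Z 0 \<omega>))\<^sup>2)"
  have "0 \<le> c2" by (simp add: c2_def)
  define K where "K = C\<Theta> + 2 ^ 16 * C32 + 2 ^ 16 * (C16 + C16) + (1 + c2) ^ 8 * C16"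
  show thesis
  proof
    show "0 \<le> K" using C\<Theta>(1) C32(1) C16(1) \<open>0 \<le> c2\<close> by (simp add: K_def)
    show "CARD('p) \<le> 4 * (CARD('p) + 2 * 24)" by simp
    fix n assume n: "4 * (CARD('p) + 2 * 24) < n"
    then have "1 \<le> n" "CARD('p) \<le> n" by auto
    obtain \<Theta> where \<Theta>[measurable]: "\<Theta> \<in> borel_measurable M" and \<Theta>_ge: "\<And>\<omega>. 1 \<le> \<Theta> \<omega>"
      and \<Theta>_gram: "AE \<omega> in M. \<forall>u. real n * (norm u)\<^sup>2 \<le> \<Theta> \<omega> * (\<Sum>i\<in>{2..n}. (fst (Z i \<omega>) \<bullet> u)\<^sup>2)"
      and \<Theta>_int: "(\<integral>\<^sup>+\<omega>. ennreal (\<Theta> \<omega> ^ 24) \<partial>M) \<le> ennreal C\<Theta>"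
      using C\<Theta>(2)[OF n] by blast
    \<comment> \<open>All observations of either data set, so that one average of squared weights
      controls the responses of both.\<close>
    define J where "J = insert None (Some ` {1..n})"
    have J: "finite J" "J \<noteq> {}" "card J = n + 1"
      by (auto simp: J_def card_image)
    \<comment> \<open>The factor 2 compensates for averaging over \<open>n + 1\<close> observations
      where \<open>n\<close> responses are bounded: \<open>(n + 1) / 2 \<le> n\<close>.\<close>
    define T where "T \<omega> = (\<Sum>j\<in>J. 2 * (data_weight (observation j \<omega>))\<^sup>2) / real (card J)" for \<omega>
    define w where "w \<omega> = data_weight (Z 1 \<omega>) + data_weight (Z1' \<omega>)" for \<omega>
    define v where "v \<omega> = (data_weight (Z 0 \<omega>))\<^sup>2 + c2" for \<omega>
    \<comment> \<open>Up to the constant \<open>576 / n^2\<close>, the square of the bound for the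
      increment of the centred loss; \<open>v\<close> collects the pointwise part and its mean
      \<open>c2\<close> from the risk.\<close>
    define Q where "Q \<omega> = \<Theta> \<omega> ^ 6 * T \<omega> ^ 4 * w \<omega> ^ 4 * (v \<omega>)\<^sup>2" for \<omega>
    have Q_measurable: "Q \<in> borel_measurable M"
      unfolding Q_def T_def w_def v_def by measurable
    have Q_int: "(\<integral>\<^sup>+\<omega>. ennreal (Q \<omega>) \<partial>M) \<le> ennreal K"
    proof -
      have "(\<integral>\<^sup>+\<omega>. ennreal (Q \<omega>) \<partial>M) \<le> (\<integral>\<^sup>+\<omega>. ennreal (\<Theta> \<omega> ^ 24)
          + ennreal (2 ^ 16 / real (card J)) * (\<Sum>j\<in>J. ennreal (data_weight (observation j \<omega>) ^ 32))
          + ennreal (2 ^ 16) * (ennreal (data_weight (Z 1 \<omega>) ^ 16) + ennreal (data_weight (Z1' \<omega>) ^ 16))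
          + ennreal ((1 + c2) ^ 8) * ennreal (data_weight (Z 0 \<omega>) ^ 16) \<partial>M)"
      proof (rule nn_integral_mono)
        fix \<omega>
        have dw: "0 \<le> data_weight z" for z :: "(real ^ 'p) \<times> real" using data_weight_ge(1)[of z] by linarith
        have T_le: "T \<omega> ^ 16 \<le> 2 ^ 16 / real (card J) * (\<Sum>j\<in>J. data_weight (observation j \<omega>) ^ 32)"
        proof -
          have "T \<omega> ^ 16 \<le> (\<Sum>j\<in>J. (2 * (data_weight (observation j \<omega>))\<^sup>2) ^ 16) / real (card J)"
            unfolding T_def by (rule power_mean[OF J(1,2)]) simp
          also have "\<dots> = 2 ^ 16 / real (card J) * (\<Sum>j\<in>J. data_weight (observation j \<omega>) ^ 32)"
            by (simp add: power_mult_distrib power_mult[symmetric] sum_distrib_left sum_divide_distrib)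
          finally show ?thesis .
        qed
        have w_le: "w \<omega> ^ 16 \<le> 2 ^ 16 * (data_weight (Z 1 \<omega>) ^ 16 + data_weight (Z1' \<omega>) ^ 16)"
          unfolding w_def by (rule add_power_le[OF dw dw])
        have v_le: "v \<omega> ^ 8 \<le> (1 + c2) ^ 8 * data_weight (Z 0 \<omega>) ^ 16"
        proof -
          have "1 \<le> (data_weight (Z 0 \<omega>))\<^sup>2" by (rule one_le_power[OF data_weight_ge(1)])
          then have "c2 * 1 \<le> c2 * (data_weight (Z 0 \<omega>))\<^sup>2" using \<open>0 \<le> c2\<close> by (intro mult_left_mono)
          then have "v \<omega> \<le> (1 + c2) * (data_weight (Z 0 \<omega>))\<^sup>2" by (simp add: v_def distrib_right)
          then have "v \<omega> ^ 8 \<le> ((1 + c2) * (data_weight (Z 0 \<omega>))\<^sup>2) ^ 8"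
            using \<open>0 \<le> c2\<close> by (intro power_mono) (auto simp: v_def)
          then show ?thesis by (simp add: power_mult_distrib power_mult[symmetric])
        qed
        have "Q \<omega> \<le> (\<Theta> \<omega> ^ 6) ^ 4 + (T \<omega> ^ 4) ^ 4 + (w \<omega> ^ 4) ^ 4 + ((v \<omega>)\<^sup>2) ^ 4"
          unfolding Q_def by (rule prod4_le_sum_power4)
        also have "\<dots> = \<Theta> \<omega> ^ 24 + T \<omega> ^ 16 + w \<omega> ^ 16 + v \<omega> ^ 8" by (simp add: power_mult[symmetric])
        also have "\<dots> \<le> \<Theta> \<omega> ^ 24 + 2 ^ 16 / real (card J) * (\<Sum>j\<in>J. data_weight (observation j \<omega>) ^ 32)
            + 2 ^ 16 * (data_weight (Z 1 \<omega>) ^ 16 + data_weight (Z1' \<omega>) ^ 16)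
            + (1 + c2) ^ 8 * data_weight (Z 0 \<omega>) ^ 16"
          by (intro add_mono order_refl T_le w_le v_le)
        finally have "ennreal (Q \<omega>) \<le> ennreal (\<Theta> \<omega> ^ 24 + 2 ^ 16 / real (card J) * (\<Sum>j\<in>J. data_weight (observation j \<omega>) ^ 32)
            + 2 ^ 16 * (data_weight (Z 1 \<omega>) ^ 16 + data_weight (Z1' \<omega>) ^ 16)
            + (1 + c2) ^ 8 * data_weight (Z 0 \<omega>) ^ 16)"
          by (rule ennreal_leI)
        also have "\<dots> = ennreal (\<Theta> \<omega> ^ 24)
          + ennreal (2 ^ 16 / real (card J)) * (\<Sum>j\<in>J. ennreal (data_weight (observation j \<omega>) ^ 32))
          + ennreal (2 ^ 16) * (ennreal (data_weight (Z 1 \<omega>) ^ 16) + ennreal (data_weight (Z1' \<omega>) ^ 16))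
          + ennreal ((1 + c2) ^ 8) * ennreal (data_weight (Z 0 \<omega>) ^ 16)"
        proof -
          note nonneg = mult_nonneg_nonneg add_nonneg_nonneg zero_le_power sum_nonneg divide_nonneg_nonneg dw \<open>0 \<le> c2\<close>
          have \<Theta>0: "0 \<le> \<Theta> \<omega>" using \<Theta>_ge[of \<omega>] by linarith
          have plus: "ennreal (a + b) = ennreal a + ennreal b" if "0 \<le> a" "0 \<le> b" for a b
            using that by (rule ennreal_plus)
          have mult: "ennreal (a * b) = ennreal a * ennreal b" if "0 \<le> a" "0 \<le> b" for a b
            using that by (rule ennreal_mult)
          have s: "ennreal (\<Sum>j\<in>J. data_weight (observation j \<omega>) ^ 32) = (\<Sum>j\<in>J. ennreal (data_weight (observation j \<omega>) ^ 32))"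
            by (rule sum_ennreal[symmetric]) (intro nonneg)
          show ?thesis
            by (simp only: plus mult s nonneg \<Theta>0 zero_le_numeral of_nat_0_le_iff zero_le_one)
        qed
        finally show "ennreal (Q \<omega>) \<le> ennreal (\<Theta> \<omega> ^ 24)
          + ennreal (2 ^ 16 / real (card J)) * (\<Sum>j\<in>J. ennreal (data_weight (observation j \<omega>) ^ 32))
          + ennreal (2 ^ 16) * (ennreal (data_weight (Z 1 \<omega>) ^ 16) + ennreal (data_weight (Z1' \<omega>) ^ 16))
          + ennreal ((1 + c2) ^ 8) * ennreal (data_weight (Z 0 \<omega>) ^ 16)" .
      qed
      also have "\<dots> = (\<integral>\<^sup>+\<omega>. ennreal (\<Theta> \<omega> ^ 24) \<partial>M)
          + ennreal (2 ^ 16 / real (card J)) * (\<Sum>j\<in>J. \<integral>\<^sup>+\<omega>. ennreal (data_weight (observation j \<omega>) ^ 32) \<partial>M)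
          + ennreal (2 ^ 16) * ((\<integral>\<^sup>+\<omega>. ennreal (data_weight (Z 1 \<omega>) ^ 16) \<partial>M) + (\<integral>\<^sup>+\<omega>. ennreal (data_weight (Z1' \<omega>) ^ 16) \<partial>M))
          + ennreal ((1 + c2) ^ 8) * (\<integral>\<^sup>+\<omega>. ennreal (data_weight (Z 0 \<omega>) ^ 16) \<partial>M)"
        by (simp add: nn_integral_add nn_integral_cmult nn_integral_sum del: sum_ennreal)
      also have "\<dots> \<le> ennreal C\<Theta>
          + ennreal (2 ^ 16 / real (card J)) * (\<Sum>j\<in>J. ennreal C32)
          + ennreal (2 ^ 16) * (ennreal C16 + ennreal C16)
          + ennreal ((1 + c2) ^ 8) * ennreal C16"
        using C16(2)[of "Some 0"] C16(2)[of "Some 1"] C16(2)[of None]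
        by (intro add_mono mult_left_mono sum_mono \<Theta>_int C32(2)) auto
      also have "ennreal (2 ^ 16 / real (card J)) * (\<Sum>j\<in>J. ennreal C32) = ennreal (2 ^ 16 * C32)"
      proof -
        have "(\<Sum>j\<in>J. ennreal C32) = ennreal (\<Sum>j\<in>J. C32)" using C32(1) by (intro sum_ennreal)
        also have "ennreal (2 ^ 16 / real (card J)) * \<dots> = ennreal (2 ^ 16 / real (card J) * (\<Sum>j\<in>J. C32))"
          using C32(1) by (intro ennreal_mult[symmetric]) (auto intro!: sum_nonneg)
        also have "2 ^ 16 / real (card J) * (\<Sum>j\<in>J. C32) = 2 ^ 16 * C32" using J by simp
        finally show ?thesis .
      qed
      also have "ennreal C\<Theta> + ennreal (2 ^ 16 * C32) + ennreal (2 ^ 16) * (ennreal C16 + ennreal C16)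
          + ennreal ((1 + c2) ^ 8) * ennreal C16 = ennreal K"
        unfolding K_def using C\<Theta>(1) C32(1) C16(1) \<open>0 \<le> c2\<close>
        by (simp only: ennreal_plus ennreal_mult add_nonneg_nonneg mult_nonneg_nonneg zero_le_power
              zero_le_numeral zero_le_one)
      finally show ?thesis .
    qed
    have T_ge: "1 \<le> T \<omega>" for \<omega>
    proof -
      have "(\<Sum>j\<in>J. 2) \<le> (\<Sum>j\<in>J. 2 * (data_weight (observation j \<omega>))\<^sup>2)"
      proof (rule sum_mono)
        fix j
        have "1 \<le> (data_weight (observation j \<omega>))\<^sup>2" by (rule one_le_power[OF data_weight_ge(1)])
        then show "2 \<le> 2 * (data_weight (observation j \<omega>))\<^sup>2" by simp
      qed
      then have "2 * real (card J) \<le> (\<Sum>j\<in>J. 2 * (data_weight (observation j \<omega>))\<^sup>2)" by simp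
      then show ?thesis unfolding T_def using J by (simp add: le_divide_eq)
    qed
    \<comment> \<open>Injectivity ensures that no observation is counted twice when the places are
      replaced by the observations standing there.\<close>
    have responses: "(\<Sum>i\<in>{1..n}. (snd (sample \<sigma> n \<omega> i))\<^sup>2) \<le> real n * T \<omega>"
      if "inj_on \<sigma> {1..n}" "\<sigma> ` {1..n} \<subseteq> J" for \<sigma> \<omega>
    proof -
      have "(\<Sum>i\<in>{1..n}. (snd (sample \<sigma> n \<omega> i))\<^sup>2) \<le> (\<Sum>i\<in>{1..n}. (data_weight (observation (\<sigma> i) \<omega>))\<^sup>2)"
      proof (rule sum_mono)
        fix i assume "i \<in> {1..n}"
        then show "(snd (sample \<sigma> n \<omega> i))\<^sup>2 \<le> (data_weight (observation (\<sigma> i) \<omega>))\<^sup>2"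
          using power_mono[OF data_weight_ge(3)[of "observation (\<sigma> i) \<omega>"], of 2] by (simp add: sample_def)
      qed
      also have "\<dots> = (\<Sum>j\<in>\<sigma> ` {1..n}. (data_weight (observation j \<omega>))\<^sup>2)"
        using that(1) by (simp add: sum.reindex)
      also have "\<dots> \<le> (\<Sum>j\<in>J. (data_weight (observation j \<omega>))\<^sup>2)"
        using that(2) J(1) by (intro sum_mono2) auto
      also have "\<dots> = (real n + 1) / 2 * T \<omega>"
        using J by (simp add: T_def sum_distrib_left[symmetric] field_simps)
      also have "\<dots> \<le> real n * T \<omega>"
        using T_ge[of \<omega>] \<open>1 \<le> n\<close> by (intro mult_right_mono) auto
      finally show ?thesis .
    qed
    define b where "b \<omega> = bhat n (sample Some n \<omega>)" for \<omega>
    define b' where "b' \<omega> = bhat n (sample (Some(1 := None)) n \<omega>)" for \<omega>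
    have min: "is_arg_min (lasso_objective n (lam n) (sample \<sigma> n \<omega>)) (\<lambda>_. True) (bhat n (sample \<sigma> n \<omega>))" for \<sigma> \<omega>
      using est[OF \<open>CARD('p) \<le> n\<close>] unfolding lasso_estimator_def by (auto simp: sample_def)
    have "AE \<omega> in M. 0 \<le> Q \<omega> \<and>
        (norm (b \<omega>))\<^sup>2 \<le> 4 * Q \<omega> \<and>
        (snd (Z 0 \<omega>) - fst (Z 0 \<omega>) \<bullet> b \<omega>)\<^sup>2 \<le> 4 * Q \<omega> \<and>
        (snd (Z 0 \<omega>) - fst (Z 0 \<omega>) \<bullet> b' \<omega>)\<^sup>2 \<le> 4 * Q \<omega> \<and>
        ((snd (Z 0 \<omega>) - fst (Z 0 \<omega>) \<bullet> b \<omega>)\<^sup>2 - risk (b \<omega>)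
          - ((snd (Z 0 \<omega>) - fst (Z 0 \<omega>) \<bullet> b' \<omega>)\<^sup>2 - risk (b' \<omega>)))\<^sup>2 \<le> 576 / (real n)\<^sup>2 * Q \<omega>"
      using \<Theta>_gram
    proof eventually_elim
      fix \<omega>
      assume gram: "\<forall>u. real n * (norm u)\<^sup>2 \<le> \<Theta> \<omega> * (\<Sum>i\<in>{2..n}. (fst (Z i \<omega>) \<bullet> u)\<^sup>2)"
      define R where "R = 2 * \<Theta> \<omega> * T \<omega>"
      define x where "x = data_weight (Z 0 \<omega>)"
      have ge: "1 \<le> \<Theta> \<omega>" "1 \<le> T \<omega>" "1 \<le> x"
        using \<Theta>_ge T_ge data_weight_ge(1) by (simp_all add: x_def)
      have "1 \<le> w \<omega>"
        using data_weight_ge(1)[of "Z 1 \<omega>"] data_weight_ge(1)[of "Z1' \<omega>"] by (simp add: w_def)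
      have "1 * 1 \<le> \<Theta> \<omega> * T \<omega>" using ge by (intro mult_mono) auto
      then have "1 \<le> R" by (simp add: R_def)
      have bounds: "norm (b \<omega>) \<le> R" "norm (b' \<omega>) \<le> R"
        "norm (b' \<omega> - b \<omega>) \<le> 6 * (\<Theta> \<omega>)\<^sup>2 * T \<omega> * (w \<omega>)\<^sup>2 / real n"
      proof -
        have l: "0 \<le> lam n" using lam[OF \<open>1 \<le> n\<close>] by simp
        have agree: "sample (Some(1 := None)) n \<omega> i = sample Some n \<omega> i" if "i \<in> {2..n}" for i
          using that by (simp add: sample_def)
        have gram': "real n * (norm u)\<^sup>2 \<le> \<Theta> \<omega> * (\<Sum>i\<in>{2..n}. (fst (sample Some n \<omega> i) \<bullet> u)\<^sup>2)" for u
          using gram by (simp add: sample_def)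
        have "(\<Sum>i\<in>{1..n}. (snd (sample Some n \<omega> i))\<^sup>2) \<le> real n * T \<omega>"
          by (rule responses) (auto simp: J_def)
        moreover have "(\<Sum>i\<in>{1..n}. (snd (sample (Some(1 := None)) n \<omega> i))\<^sup>2) \<le> real n * T \<omega>"
          by (rule responses) (auto simp: J_def inj_on_def)
        moreover have "data_weight (sample Some n \<omega> 1) \<le> w \<omega>" "data_weight (sample (Some(1 := None)) n \<omega> 1) \<le> w \<omega>"
          using \<open>1 \<le> n\<close> data_weight_ge(1)[of "Z 1 \<omega>"] data_weight_ge(1)[of "Z1' \<omega>"]
          by (simp_all add: sample_def w_def)
        ultimately show "norm (b \<omega>) \<le> R" "norm (b' \<omega>) \<le> R"
          "norm (b' \<omega> - b \<omega>) \<le> 6 * (\<Theta> \<omega>)\<^sup>2 * T \<omega> * (w \<omega>)\<^sup>2 / real n"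
          using lasso_perturbation[OF min min agree l \<open>1 \<le> n\<close> ge(1) gram' ge(2)]
          unfolding b_def b'_def R_def by blast+
      qed
      have v_ge: "x\<^sup>2 \<le> (v \<omega>)\<^sup>2" "1 \<le> (v \<omega>)\<^sup>2"
      proof -
        have "1 \<le> x\<^sup>2" using ge(3) by simp
        moreover have "x\<^sup>2 \<le> v \<omega>" using \<open>0 \<le> c2\<close> by (simp add: v_def x_def)
        ultimately have "1 \<le> v \<omega>" "x\<^sup>2 \<le> v \<omega>" by auto
        then have "v \<omega> * 1 \<le> v \<omega> * v \<omega>" by (intro mult_left_mono) auto
        then have "v \<omega> \<le> (v \<omega>)\<^sup>2" by (simp add: power2_eq_square)
        with \<open>1 \<le> v \<omega>\<close> \<open>x\<^sup>2 \<le> v \<omega>\<close> show "x\<^sup>2 \<le> (v \<omega>)\<^sup>2" "1 \<le> (v \<omega>)\<^sup>2"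
          by linarith+
      qed
      \<comment> \<open>All factors of \<open>Q\<close> are at least 1, so their powers may be
        raised. The values 0, 1 and \<open>x^2\<close> of \<open>y\<close> give nonnegativity, the
        bound for the estimator and the bound for the losses.\<close>
      have R_Q: "R\<^sup>2 * y \<le> 4 * Q \<omega>" if "0 \<le> y" "y \<le> (v \<omega>)\<^sup>2" for y
      proof -
        have "R\<^sup>2 * y = 4 * ((\<Theta> \<omega>)\<^sup>2 * (T \<omega>)\<^sup>2 * 1 * y)" by (simp add: R_def power_mult_distrib)
        also have "\<dots> \<le> 4 * (\<Theta> \<omega> ^ 6 * T \<omega> ^ 4 * w \<omega> ^ 4 * (v \<omega>)\<^sup>2)"
          using ge \<open>1 \<le> w \<omega>\<close> that
          by (intro mult_left_mono mult_mono power_increasing one_le_power) (auto intro!: mult_nonneg_nonneg)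
        finally show ?thesis by (simp add: Q_def)
      qed
      have Q0: "0 \<le> Q \<omega>" using R_Q[of 0] by simp
      have norm_b: "(norm (b \<omega>))\<^sup>2 \<le> 4 * Q \<omega>"
        using power_mono[OF bounds(1), of 2] R_Q[of 1] v_ge by simp
      have loss: "(snd (Z 0 \<omega>) - fst (Z 0 \<omega>) \<bullet> a)\<^sup>2 \<le> 4 * Q \<omega>" if "norm a \<le> R" for a
        using squared_error_le[OF that \<open>1 \<le> R\<close>, of "Z 0 \<omega>"] R_Q[of "x\<^sup>2"] v_ge by (simp add: x_def)
      define \<delta> where "\<delta> = 2 * R * norm (b' \<omega> - b \<omega>)"
      have "\<bar>(snd (Z 0 \<omega>) - fst (Z 0 \<omega>) \<bullet> b \<omega>)\<^sup>2 - (snd (Z 0 \<omega>) - fst (Z 0 \<omega>) \<bullet> b' \<omega>)\<^sup>2\<bar> \<le> \<delta> * x\<^sup>2"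
        unfolding \<delta>_def x_def by (rule squared_error_diff[OF bounds(1,2) \<open>1 \<le> R\<close>])
      moreover have "\<bar>risk (b \<omega>) - risk (b' \<omega>)\<bar> \<le> \<delta> * c2"
        unfolding \<delta>_def c2_def by (rule risk_diff[OF bounds(1,2) \<open>1 \<le> R\<close>])
      ultimately have "\<bar>(snd (Z 0 \<omega>) - fst (Z 0 \<omega>) \<bullet> b \<omega>)\<^sup>2 - risk (b \<omega>)
          - ((snd (Z 0 \<omega>) - fst (Z 0 \<omega>) \<bullet> b' \<omega>)\<^sup>2 - risk (b' \<omega>))\<bar> \<le> \<delta> * v \<omega>"
        unfolding v_def x_def[symmetric] distrib_left by linarith
      \<comment> \<open>The constant is \<open>2 * 2 * 6\<close>: from the difference of squares,
        from \<open>R\<close>, and from the perturbation bound. Its square is the 576.\<close>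
      also have "\<dots> \<le> (24 / real n * (\<Theta> \<omega> ^ 3 * (T \<omega>)\<^sup>2 * (w \<omega>)\<^sup>2)) * v \<omega>"
      proof (rule mult_right_mono)
        have "\<delta> \<le> 2 * R * (6 * (\<Theta> \<omega>)\<^sup>2 * T \<omega> * (w \<omega>)\<^sup>2 / real n)"
          unfolding \<delta>_def using bounds(3) \<open>1 \<le> R\<close> by (intro mult_left_mono) auto
        also have "\<dots> = 24 / real n * (\<Theta> \<omega> ^ 3 * (T \<omega>)\<^sup>2 * (w \<omega>)\<^sup>2)"
          by (simp add: R_def power2_eq_square power3_eq_cube)
        finally show "\<delta> \<le> 24 / real n * (\<Theta> \<omega> ^ 3 * (T \<omega>)\<^sup>2 * (w \<omega>)\<^sup>2)" .
        show "0 \<le> v \<omega>" using \<open>0 \<le> c2\<close> by (simp add: v_def)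
      qed
      finally have le: "\<bar>(snd (Z 0 \<omega>) - fst (Z 0 \<omega>) \<bullet> b \<omega>)\<^sup>2 - risk (b \<omega>)
          - ((snd (Z 0 \<omega>) - fst (Z 0 \<omega>) \<bullet> b' \<omega>)\<^sup>2 - risk (b' \<omega>))\<bar>
          \<le> (24 / real n * (\<Theta> \<omega> ^ 3 * (T \<omega>)\<^sup>2 * (w \<omega>)\<^sup>2)) * v \<omega>" .
      have "((snd (Z 0 \<omega>) - fst (Z 0 \<omega>) \<bullet> b \<omega>)\<^sup>2 - risk (b \<omega>)
          - ((snd (Z 0 \<omega>) - fst (Z 0 \<omega>) \<bullet> b' \<omega>)\<^sup>2 - risk (b' \<omega>)))\<^sup>2
          \<le> ((24 / real n * (\<Theta> \<omega> ^ 3 * (T \<omega>)\<^sup>2 * (w \<omega>)\<^sup>2)) * v \<omega>)\<^sup>2"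
        using power_mono[OF le abs_ge_zero, of 2] by (simp only: power2_abs)
      also have "\<dots> = 576 / (real n)\<^sup>2 * Q \<omega>"
        by (simp add: Q_def power_mult_distrib power_divide power_mult[symmetric])
      finally show "0 \<le> Q \<omega> \<and>
        (norm (b \<omega>))\<^sup>2 \<le> 4 * Q \<omega> \<and>
        (snd (Z 0 \<omega>) - fst (Z 0 \<omega>) \<bullet> b \<omega>)\<^sup>2 \<le> 4 * Q \<omega> \<and>
        (snd (Z 0 \<omega>) - fst (Z 0 \<omega>) \<bullet> b' \<omega>)\<^sup>2 \<le> 4 * Q \<omega> \<and>
        ((snd (Z 0 \<omega>) - fst (Z 0 \<omega>) \<bullet> b \<omega>)\<^sup>2 - risk (b \<omega>)
          - ((snd (Z 0 \<omega>) - fst (Z 0 \<omega>) \<bullet> b' \<omega>)\<^sup>2 - risk (b' \<omega>)))\<^sup>2 \<le> 576 / (real n)\<^sup>2 * Q \<omega>"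
        using Q0 norm_b loss bounds by blast
    qed
    with Q_measurable Q_int show "\<exists>Q. Q \<in> borel_measurable M \<and> (\<integral>\<^sup>+\<omega>. ennreal (Q \<omega>) \<partial>M) \<le> ennreal K \<and>
      (AE \<omega> in M. 0 \<le> Q \<omega> \<and>
        (norm (bhat n (sample Some n \<omega>)))\<^sup>2 \<le> 4 * Q \<omega> \<and>
        squared_loss (bhat n) (Z 0 \<omega>) (sample Some n \<omega>) \<le> 4 * Q \<omega> \<and>
        squared_loss (bhat n) (Z 0 \<omega>) (sample (Some(1 := None)) n \<omega>) \<le> 4 * Q \<omega> \<and>
        (squared_loss (bhat n) (Z 0 \<omega>) (sample Some n \<omega>) - risk (bhat n (sample Some n \<omega>))
          - (squared_loss (bhat n) (Z 0 \<omega>) (sample (Some(1 := None)) n \<omega>)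
             - risk (bhat n (sample (Some(1 := None)) n \<omega>))))\<^sup>2 \<le> 576 / (real n)\<^sup>2 * Q \<omega>)"
      unfolding squared_loss_def b_def b'_def by (intro exI[of _ Q] conjI)
  qed
qed

end
end

section \<open>Rates for the variance and the stability\<close>

context gaussian_linear_model begin

lemma lasso_stability_bounds:
  assumes tau_pos: "0 < \<tau>"
    and est: "\<And>n. n \<ge> CARD('p) \<Longrightarrow> lasso_estimator n (lam n) (bhat n)"
    and lam: "\<And>n. n \<ge> 1 \<Longrightarrow> lam n > 0"
  obtains K n0 where "0 \<le> K"
    "\<And>n. n0 < n \<Longrightarrow> 2 * \<tau> ^ 4 \<le> sigma_squared M Z n (squared_loss (bhat n))"
    "\<And>n. n0 < n \<Longrightarrow> loss_stability M Z Z1' n (squared_loss (bhat n)) \<le> K / (real n)\<^sup>2"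
proof -
  obtain K n0 where K: "0 \<le> K" "CARD('p) \<le> n0" "\<And>n. n0 < n \<Longrightarrow>
    \<exists>Q. Q \<in> borel_measurable M \<and> (\<integral>\<^sup>+\<omega>. ennreal (Q \<omega>) \<partial>M) \<le> ennreal K \<and>
      (AE \<omega> in M. 0 \<le> Q \<omega> \<and>
        (norm (bhat n (sample Some n \<omega>)))\<^sup>2 \<le> 4 * Q \<omega> \<and>
        squared_loss (bhat n) (Z 0 \<omega>) (sample Some n \<omega>) \<le> 4 * Q \<omega> \<and>
        squared_loss (bhat n) (Z 0 \<omega>) (sample (Some(1 := None)) n \<omega>) \<le> 4 * Q \<omega> \<and>
        (squared_loss (bhat n) (Z 0 \<omega>) (sample Some n \<omega>) - risk (bhat n (sample Some n \<omega>))
          - (squared_loss (bhat n) (Z 0 \<omega>) (sample (Some(1 := None)) n \<omega>)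
             - risk (bhat n (sample (Some(1 := None)) n \<omega>))))\<^sup>2 \<le> 576 / (real n)\<^sup>2 * Q \<omega>)"
    using lasso_domination[OF tau_pos est lam] by blast
  have bounds: "2 * \<tau> ^ 4 \<le> sigma_squared M Z n (squared_loss (bhat n)) \<and>
      loss_stability M Z Z1' n (squared_loss (bhat n)) \<le> 576 * K / (real n)\<^sup>2" if n: "n0 < n" for n
  proof -
    let ?S = "sample Some n" and ?S' = "sample (Some(1 := None)) n"
    let ?H = "\<lambda>\<omega>. squared_loss (bhat n) (Z 0 \<omega>) (?S \<omega>)"
    let ?H' = "\<lambda>\<omega>. squared_loss (bhat n) (Z 0 \<omega>) (?S' \<omega>)"
    have bh[measurable]: "bhat n \<in> borel_measurable (\<Pi>\<^sub>M i\<in>{1..n}. borel)"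
      using est[of n] K(2) n by (simp add: lasso_estimator_def)
    obtain Q where [measurable]: "Q \<in> borel_measurable M"
      and Q_int: "(\<integral>\<^sup>+\<omega>. ennreal (Q \<omega>) \<partial>M) \<le> ennreal K"
      and Q: "AE \<omega> in M. 0 \<le> Q \<omega> \<and> (norm (bhat n (?S \<omega>)))\<^sup>2 \<le> 4 * Q \<omega> \<and> ?H \<omega> \<le> 4 * Q \<omega> \<and> ?H' \<omega> \<le> 4 * Q \<omega> \<and>
        (?H \<omega> - risk (bhat n (?S \<omega>)) - (?H' \<omega> - risk (bhat n (?S' \<omega>))))\<^sup>2 \<le> 576 / (real n)\<^sup>2 * Q \<omega>"
      using K(3)[OF n] by blast
    have "integrable M Q"
      using Q Q_int by (intro integrableI_nonneg) (auto elim: eventually_mono intro: le_less_trans)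
    then have Q4: "integrable M (\<lambda>\<omega>. 4 * Q \<omega>)" by simp
    have dominated: "integrable M f"
      if "f \<in> borel_measurable M" "AE \<omega> in M. 0 \<le> f \<omega> \<and> f \<omega> \<le> 4 * Q \<omega>" for f :: "'a \<Rightarrow> real"
      using that(2) by (intro Bochner_Integration.integrable_bound[OF Q4 that(1)]) (auto elim: eventually_mono)
    have loss_measurable: "(\<lambda>\<omega>. squared_loss (bhat n) (Z 0 \<omega>) (sample \<sigma> n \<omega>)) \<in> borel_measurable M" for \<sigma>
      unfolding squared_loss_def by measurable
    have loss_nonneg: "0 \<le> squared_loss (bhat n) z s" for z s by (simp add: squared_loss_def)
    have H: "integrable M ?H" and H': "integrable M ?H'"
      using Q by (auto intro!: dominated loss_measurable loss_nonneg elim: eventually_mono)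
    have b2: "integrable M (\<lambda>\<omega>. (norm (bhat n (?S \<omega>)))\<^sup>2)"
      using Q by (intro dominated) (auto elim: eventually_mono)
    have "2 * \<tau> ^ 4 \<le> sigma_squared M Z n (squared_loss (bhat n))"
      by (rule sigma_squared_ge[OF tau_pos bh]) (use b2 H in \<open>simp_all add: training_set_sample\<close>)
    moreover have "loss_stability M Z Z1' n (squared_loss (bhat n)) \<le> 576 * K / (real n)\<^sup>2"
    proof -
      let ?D = "\<Pi>\<^sub>M i\<in>{1..n}. (borel :: ((real ^ 'p) \<times> real) measure)"
      let ?f = "\<lambda>\<omega>. (?H \<omega> - cond_expectation M ?D ?S ?H \<omega> - (?H' \<omega> - cond_expectation M ?D ?S' ?H' \<omega>))\<^sup>2"
      have "AE \<omega> in M. cond_expectation M ?D ?S ?H \<omega> = risk (bhat n (?S \<omega>))"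
        unfolding risk_def by (rule cond_expectation_sample[OF bh _ H]) auto
      moreover have "AE \<omega> in M. cond_expectation M ?D ?S' ?H' \<omega> = risk (bhat n (?S' \<omega>))"
        unfolding risk_def by (rule cond_expectation_sample[OF bh _ H']) auto
      moreover note Q
      ultimately have le: "AE \<omega> in M. ?f \<omega> \<le> 576 / (real n)\<^sup>2 * Q \<omega>"
        by eventually_elim simp
      \<comment> \<open>The nonnegative integral is bounded first; this bounds the Bochner integral
        too, with no separate argument that \<open>?f\<close> is integrable.\<close>
      have "(\<integral>\<^sup>+\<omega>. ennreal (?f \<omega>) \<partial>M) \<le> (\<integral>\<^sup>+\<omega>. ennreal (576 / (real n)\<^sup>2) * ennreal (Q \<omega>) \<partial>M)"
        using le by (intro nn_integral_mono_AE) (auto simp: ennreal_mult'[symmetric] elim!: eventually_mono intro: ennreal_leI)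
      also have "\<dots> = ennreal (576 / (real n)\<^sup>2) * (\<integral>\<^sup>+\<omega>. ennreal (Q \<omega>) \<partial>M)"
        by (rule nn_integral_cmult) measurable
      also have "\<dots> \<le> ennreal (576 / (real n)\<^sup>2) * ennreal K" by (intro mult_left_mono Q_int) simp
      also have "\<dots> = ennreal (576 * K / (real n)\<^sup>2)" by (simp add: ennreal_mult'[symmetric])
      finally have "integral\<^sup>L M ?f \<le> 576 * K / (real n)\<^sup>2"
        using K(1) by (intro integral_real_bounded) auto
      then show ?thesis
        unfolding loss_stability_def Let_def training_set_sample training_set_copy_sample .
    qed
    ultimately show ?thesis by blast
  qed
  show thesis by (rule that[of "576 * K" n0]) (use bounds K(1) in auto)
qed

end

theorem theorem3p4:
  fixes M :: "'a measure"
    and Z :: "nat \<Rightarrow> 'a \<Rightarrow> (real ^ 'p) \<times> real"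
    and \<epsilon> :: "nat \<Rightarrow> 'a \<Rightarrow> real"
    and Z1' :: "'a \<Rightarrow> (real ^ 'p) \<times> real"
    and \<beta> :: "real ^ 'p"
    and \<tau> :: real
    and lam :: "nat \<Rightarrow> real"
    and bhat :: "nat \<Rightarrow> (nat \<Rightarrow> (real ^ 'p) \<times> real) \<Rightarrow> real ^ 'p"
  assumes "\<tau> > 0"
    and "gaussian_linear_model M Z \<epsilon> Z1' \<beta> \<tau>"
    and "\<And>n. n \<ge> 1 \<Longrightarrow> lam n > 0"
    and "lam \<in> o(\<lambda>n. real n)"
    and "\<And>n. n \<ge> CARD('p) \<Longrightarrow> lasso_estimator n (lam n) (bhat n)"
  shows "(\<lambda>n. sigma_squared M Z n (squared_loss (bhat n))) \<in> \<Omega>(\<lambda>_. 1)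
       \<and> (\<lambda>n. loss_stability M Z Z1' n (squared_loss (bhat n))) \<in> o(\<lambda>n. 1 / real n)
       \<and> (\<lambda>n. relative_loss_stability M Z Z1' n (squared_loss (bhat n))) \<in> o(\<lambda>_. 1)"
proof -
  interpret gaussian_linear_model M Z \<epsilon> Z1' \<beta> \<tau> by fact
  define \<sigma> where "\<sigma> n = sigma_squared M Z n (squared_loss (bhat n))" for n
  define \<gamma> where "\<gamma> n = loss_stability M Z Z1' n (squared_loss (bhat n))" for n
  obtain K n0 where K: "0 \<le> K" "\<And>n. n0 < n \<Longrightarrow> 2 * \<tau> ^ 4 \<le> \<sigma> n" "\<And>n. n0 < n \<Longrightarrow> \<gamma> n \<le> K / (real n)\<^sup>2"
    unfolding \<sigma>_def \<gamma>_def using lasso_stability_bounds[OF assms(1,5,3)] by blast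
  have large: "eventually (\<lambda>n. n0 < n) sequentially" by (rule eventually_gt_at_top)
  have \<gamma>_nonneg: "0 \<le> \<gamma> n" for n unfolding \<gamma>_def loss_stability_def Let_def by simp
  have pos: "0 < 2 * \<tau> ^ 4" using assms(1) by simp
  have "\<sigma> \<in> \<Omega>(\<lambda>_. 1)"
  proof (rule landau_omega.bigI[OF pos])
    show "eventually (\<lambda>n. 2 * \<tau> ^ 4 * norm (1 :: real) \<le> norm (\<sigma> n)) sequentially"
      using large
    proof eventually_elim
      case (elim n)
      show ?case using K(2)[OF elim] by simp
    qed
  qed
  moreover have "\<gamma> \<in> o(\<lambda>n. 1 / real n)"
  proof (rule landau_o.big_small_trans)
    show "\<gamma> \<in> O(\<lambda>n. 1 / (real n)\<^sup>2)"
    proof (rule bigoI[where c = K])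
      show "eventually (\<lambda>n. norm (\<gamma> n) \<le> K * norm (1 / (real n)\<^sup>2)) sequentially"
        using large
      proof eventually_elim
        case (elim n)
        show ?case using K(3)[OF elim] \<gamma>_nonneg[of n] by simp
      qed
    qed
    \<comment> \<open>The identity holds at \<open>n = 0\<close> as well, where division by zero
      makes both sides 0.\<close>
    have "(\<lambda>n. 1 / (real n)\<^sup>2 / (1 / real n)) = (\<lambda>n. 1 / real n)"
      by (simp add: fun_eq_iff power2_eq_square)
    then show "(\<lambda>n. 1 / (real n)\<^sup>2) \<in> o(\<lambda>n. 1 / real n)"
      using lim_1_over_n[where 'a = real] eventually_gt_at_top[of "0::nat"]
      by (intro smalloI_tendsto) (auto elim!: eventually_mono)
  qed
  moreover have "(\<lambda>n. real n * \<gamma> n / \<sigma> n) \<in> o(\<lambda>_. 1)"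
  proof (rule landau_o.big_small_trans)
    show "(\<lambda>n. real n * \<gamma> n / \<sigma> n) \<in> O(\<lambda>n. 1 / real n)"
    proof (rule bigoI[where c = "K / (2 * \<tau> ^ 4)"])
      show "eventually (\<lambda>n. norm (real n * \<gamma> n / \<sigma> n) \<le> K / (2 * \<tau> ^ 4) * norm (1 / real n)) sequentially"
        using large
      proof eventually_elim
        case (elim n)
        \<comment> \<open>The denominator is bounded below by a positive constant, so the ratio
          keeps the order \<open>1 / n\<close> of \<open>n * \<gamma> n\<close>.\<close>
        have "real n * \<gamma> n / \<sigma> n \<le> (real n * (K / (real n)\<^sup>2)) / (2 * \<tau> ^ 4)"
          using K(1) K(2,3)[OF elim] \<gamma>_nonneg[of n] pos by (intro frac_le mult_left_mono mult_nonneg_nonneg) auto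
        also have "\<dots> = K / (2 * \<tau> ^ 4) * norm (1 / real n)"
          using elim by (simp add: power2_eq_square)
        finally have "real n * \<gamma> n / \<sigma> n \<le> K / (2 * \<tau> ^ 4) * norm (1 / real n)" .
        moreover have "0 \<le> \<sigma> n" using K(2)[OF elim] pos by linarith
        then have "0 \<le> real n * \<gamma> n / \<sigma> n"
          using \<gamma>_nonneg[of n] by (intro divide_nonneg_nonneg mult_nonneg_nonneg) auto
        ultimately show ?case by simp
      qed
    qed
    show "(\<lambda>n. 1 / real n) \<in> o(\<lambda>_. 1 :: real)"
      using lim_1_over_n[where 'a = real] by (intro smalloI_tendsto) auto
  qed
  ultimately show ?thesis
    unfolding \<sigma>_def \<gamma>_def relative_loss_stability_def by blast
qed

end
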